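(* Let $1\le p\le 2$ and let $p'$ be the conjugate exponent of $p$ ($1/p+1/p'=1$). (i) If $s\ge d(1/p-1/p')$ and $1\le q\le p$, then $B^{p,q}_s(\mathbb{R}^d)\hookrightarrow\mathcal{M}^{p}(\mathbb{R}^d)$. (ii) If $s>d(1/p-1/p')$ and $1\le q\le\infty$, then $B^{p,q}_s(\mathbb{R}^d)\hookrightarrow\mathcal{M}^{p}(\mathbb{R}^d)$.
   Context: $B^{p,q}_s(\mathbb{R}^d)$ is the usual inhomogeneous Besov space with integrability exponent $p$, summability exponent $q$ and smoothness $s\in\mathbb{R}$. $\mathcal{M}^p=\mathcal{M}^{p,p}$ is the unweighted modulation space, where $\mathcal{M}^{p,q}(\mathbb{R}^d)$ consists of all $f\in\mathcal{S}'(\mathbb{R}^d)$ with $\|f\|_{\mathcal{M}^{p,q}}=\big(\int_{\mathbb{R}^d}(\int_{\mathbb{R}^d}|V_gf(x,\omega)|^p\,dx)^{q/p}\,d\omega\big)^{1/q}<\infty$ (usual modifications for infinite exponents), with $V_gf(x,\omega)=\int_{\mathbb{R}^d}f(y)\overline{g(y-x)}e^{-2\pi i y\cdot\omega}\,dy$ for a fixed nonzero window $g\in\mathcal{S}(\mathbb{R}^d)$; different windows give equivalent norms. $\hookrightarrow$ denotes continuous embedding. *)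

theory Defs
  imports "HOL-Analysis.Analysis" "HOL-Probability.Essential_Supremum"
begin

text \<open>
  The space \<open>\<real>\<^sup>d\<close> is an arbitrary type \<open>'a::euclidean_space\<close> with \<open>d = DIM('a)\<close>.
  Exponents in \<open>[1,\<infinity>]\<close> are of type \<^typ>\<open>ennreal\<close>, so that \<open>1 / \<infinity> = 0\<close>.
\<close>

section \<open>Schwartz functions and tempered distributions\<close>

text \<open>\<open>iter_deriv [b\<^sub>1, \<dots>, b\<^sub>n] f\<close> is \<open>\<partial>\<^bsub>b\<^sub>1\<^esub> \<dots> \<partial>\<^bsub>b\<^sub>n\<^esub> f\<close>.\<close>

primrec iter_deriv :: "'a::euclidean_space list \<Rightarrow> ('a \<Rightarrow> complex) \<Rightarrow> 'a \<Rightarrow> complex" where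
  "iter_deriv [] f = f"
| "iter_deriv (b # bs) f = (\<lambda>x. frechet_derivative (iter_deriv bs f) (at x) b)"

text \<open>If all iterated partial derivatives are everywhere differentiable, they are in particular
  continuous, so this is membership in \<open>C\<^sup>\<infinity>\<close>.\<close>

definition smooth :: "('a::euclidean_space \<Rightarrow> complex) \<Rightarrow> bool" where
  "smooth f \<longleftrightarrow> (\<forall>bs. set bs \<subseteq> Basis \<longrightarrow> iter_deriv bs f differentiable_on UNIV)"

definition schwartz :: "('a::euclidean_space \<Rightarrow> complex) set" where
  "schwartz = {f. smooth f \<and>
     (\<forall>k bs. set bs \<subseteq> Basis \<longrightarrow> bdd_above (range (\<lambda>x. norm x ^ k * cmod (iter_deriv bs f x))))}"

text \<open>The sum of all Schwartz seminorms of order at most \<open>N\<close>.\<close>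

definition schwartz_seminorm :: "nat \<Rightarrow> ('a::euclidean_space \<Rightarrow> complex) \<Rightarrow> real" where
  "schwartz_seminorm N f =
     (\<Sum>k\<le>N. \<Sum>bs | set bs \<subseteq> Basis \<and> length bs \<le> N. SUP x. norm x ^ k * cmod (iter_deriv bs f x))"

type_synonym 'a functional = "('a \<Rightarrow> complex) \<Rightarrow> complex"

text \<open>Tempered distributions are the complex-linear functionals on Schwartz space that are
  continuous for the topology given by the seminorms. They take a dummy value outside Schwartz
  space, so that equality of distributions is equality of functions. The pairing is bilinear.\<close>

definition tempered :: "'a::euclidean_space functional set" where
  "tempered = {u. u \<in> extensional schwartz \<and>
     (\<forall>f\<in>schwartz. \<forall>g\<in>schwartz. \<forall>a b. u (\<lambda>x. a * f x + b * g x) = a * u f + b * u g) \<and>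
     (\<exists>C N. \<forall>f\<in>schwartz. cmod (u f) \<le> C * schwartz_seminorm N f)}"

definition fourier :: "('a::euclidean_space \<Rightarrow> complex) \<Rightarrow> 'a \<Rightarrow> complex" where
  "fourier f \<omega> = (LINT x|lborel. f x * cis (- 2 * pi * (x \<bullet> \<omega>)))"

definition inv_fourier :: "('a::euclidean_space \<Rightarrow> complex) \<Rightarrow> 'a \<Rightarrow> complex" where
  "inv_fourier f x = (LINT \<omega>|lborel. f \<omega> * cis (2 * pi * (x \<bullet> \<omega>)))"

definition fourier_dist :: "'a::euclidean_space functional \<Rightarrow> 'a functional" where
  "fourier_dist u = (\<lambda>f\<in>schwartz. u (fourier f))"

definition inv_fourier_dist :: "'a::euclidean_space functional \<Rightarrow> 'a functional" where
  "inv_fourier_dist u = (\<lambda>f\<in>schwartz. u (inv_fourier f))"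

definition mult_dist :: "('a::euclidean_space \<Rightarrow> complex) \<Rightarrow> 'a functional \<Rightarrow> 'a functional" where
  "mult_dist m u = (\<lambda>f\<in>schwartz. u (\<lambda>x. m x * f x))"


section \<open>Lebesgue norms\<close>

text \<open>For \<open>a > 0\<close>.\<close>

definition ennreal_powr :: "ennreal \<Rightarrow> real \<Rightarrow> ennreal" where
  "ennreal_powr x a = (if x = \<infinity> then \<infinity> else ennreal (enn2real x powr a))"

definition Lp_enorm :: "'b measure \<Rightarrow> ennreal \<Rightarrow> ('b \<Rightarrow> ennreal) \<Rightarrow> ennreal" where
  "Lp_enorm M p f =
     (if p = \<infinity> then esssup M f
      else ennreal_powr (\<integral>\<^sup>+ x. ennreal_powr (f x) (enn2real p) \<partial>M) (1 / enn2real p))"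

definition represents :: "('a::euclidean_space \<Rightarrow> complex) \<Rightarrow> 'a functional \<Rightarrow> bool" where
  "represents h u \<longleftrightarrow> h \<in> borel_measurable lborel \<and>
     (\<forall>f\<in>schwartz. integrable lborel (\<lambda>x. h x * f x) \<and> u f = (LINT x|lborel. h x * f x))"

text \<open>The \<open>L\<^sup>p\<close> norm of a distribution is that of its representing function (which is unique up
  to null sets), and \<open>\<infinity>\<close> if the distribution is not a function.\<close>

definition Lp_enorm_dist :: "ennreal \<Rightarrow> 'a::euclidean_space functional \<Rightarrow> ennreal" where
  "Lp_enorm_dist p u = (INF h\<in>{h. represents h u}. Lp_enorm lborel p (\<lambda>x. ennreal (cmod (h x))))"


section \<open>Besov spaces\<close>

text \<open>A generator \<open>\<phi>\<close> of the dyadic partition of unity \<open>\<phi>\<^sub>0 = \<phi>\<close>,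
  \<open>\<phi>\<^sub>j(\<xi>) = \<phi>(2\<^sup>-\<^sup>j \<xi>) - \<phi>(2\<^sup>-\<^sup>j\<^sup>+\<^sup>1 \<xi>)\<close> for \<open>j \<ge> 1\<close>; here \<open>\<phi>\<^sub>j\<close> is supported in
  \<open>2\<^sup>j\<^sup>-\<^sup>1 \<le> |\<xi>| \<le> 2\<^sup>j\<^sup>+\<^sup>1\<close>.\<close>

definition dyadic_generator :: "('a::euclidean_space \<Rightarrow> complex) \<Rightarrow> bool" where
  "dyadic_generator \<phi> \<longleftrightarrow> smooth \<phi> \<and>
     (\<forall>\<xi>. norm \<xi> \<le> 1 \<longrightarrow> \<phi> \<xi> = 1) \<and> (\<forall>\<xi>. norm \<xi> \<ge> 2 \<longrightarrow> \<phi> \<xi> = 0)"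

definition dyadic :: "('a::euclidean_space \<Rightarrow> complex) \<Rightarrow> nat \<Rightarrow> 'a \<Rightarrow> complex" where
  "dyadic \<phi> j \<xi> =
     (if j = 0 then \<phi> \<xi> else \<phi> ((1/2) ^ j *\<^sub>R \<xi>) - \<phi> ((1/2) ^ (j - 1) *\<^sub>R \<xi>))"

definition LP_block ::
    "('a::euclidean_space \<Rightarrow> complex) \<Rightarrow> nat \<Rightarrow> 'a functional \<Rightarrow> 'a functional" where
  "LP_block \<phi> j u = inv_fourier_dist (mult_dist (dyadic \<phi> j) (fourier_dist u))"

definition besov_enorm ::
    "('a::euclidean_space \<Rightarrow> complex) \<Rightarrow> ennreal \<Rightarrow> ennreal \<Rightarrow> real \<Rightarrow> 'a functional \<Rightarrow> ennreal" where
  "besov_enorm \<phi> p q s u =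
     Lp_enorm (count_space (UNIV :: nat set)) q
       (\<lambda>j. ennreal (2 powr (real j * s)) * Lp_enorm_dist p (LP_block \<phi> j u))"

definition besov_space ::
    "('a::euclidean_space \<Rightarrow> complex) \<Rightarrow> ennreal \<Rightarrow> ennreal \<Rightarrow> real \<Rightarrow> 'a functional set" where
  "besov_space \<phi> p q s = {u \<in> tempered. besov_enorm \<phi> p q s u < \<infinity>}"


section \<open>Modulation spaces\<close>

text \<open>The window is \<open>g\<close>; the integral defining the short-time Fourier transform is read as
  the bilinear pairing of \<open>u\<close> with \<open>y \<mapsto> cnj (g (y - x)) e\<^sup>-\<^sup>2\<^sup>\<pi>\<^sup>i\<^sup>y\<^sup>\<omega>\<close>.\<close>

definition stft ::
    "('a::euclidean_space \<Rightarrow> complex) \<Rightarrow> 'a functional \<Rightarrow> 'a \<Rightarrow> 'a \<Rightarrow> complex" where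
  "stft g u x \<omega> = u (\<lambda>y. cnj (g (y - x)) * cis (- 2 * pi * (y \<bullet> \<omega>)))"

definition modulation_enorm ::
    "('a::euclidean_space \<Rightarrow> complex) \<Rightarrow> ennreal \<Rightarrow> ennreal \<Rightarrow> 'a functional \<Rightarrow> ennreal" where
  "modulation_enorm g p q u =
     Lp_enorm lborel q (\<lambda>\<omega>. Lp_enorm lborel p (\<lambda>x. ennreal (cmod (stft g u x \<omega>))))"

definition modulation_space ::
    "('a::euclidean_space \<Rightarrow> complex) \<Rightarrow> ennreal \<Rightarrow> ennreal \<Rightarrow> 'a functional set" where
  "modulation_space g p q = {u \<in> tempered. modulation_enorm g p q u < \<infinity>}"


section \<open>Continuous embeddings\<close>

text \<open>For normed spaces, given by their carriers and norms: the inclusion map is well-defined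
  and bounded.\<close>

definition continuously_embedded ::
    "'b set \<Rightarrow> ('b \<Rightarrow> ennreal) \<Rightarrow> 'b set \<Rightarrow> ('b \<Rightarrow> ennreal) \<Rightarrow> bool" where
  "continuously_embedded X nX Y nY \<longleftrightarrow>
     X \<subseteq> Y \<and> (\<exists>C::real. \<forall>u\<in>X. nY u \<le> ennreal C * nX u)"

end

(*
The short-time Fourier transform V_g u is the sum over j of the pieces T_j h_j, where h_j is the function
representing the j-th dyadic block of u, and T_j is an integral operator whose kernel contains a smooth
cut-off to frequencies of size about 2^j. Two estimates hold. A pointwise bound of the kernel gives
|T_j h|_1 <= C 2^(jd) |h|_1. Plancherel's inequality, used once for h_j and once for T_j h_j, and the finite
overlap of the cut-offs give |sum_j T_j h_j|_2^2 <= C sum_j |h_j|_2^2. Marcinkiewicz interpolation, with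
the j-th function split at a height proportional to 2^(jd), turns them into
|sum_j T_j h_j|_p^p <= C sum_j (2^(jd))^(2-p) |h_j|_p^p, which is the embedding for q = p and
s = d (2/p - 1) = d (1/p - 1/p'). The other cases follow from embeddings between Besov spaces.
*)

theory Submission
  imports Defs "HOL-Probability.Characteristic_Functions" "HOL-Probability.Sinc_Integral"
begin

section \<open>Integration\<close>

text \<open>The cut-off in T_j is a fattened one, equal to 1 on the support of the j-th dyadic
  function. It can therefore be moved onto the window without changing the pairing, and the kernel
  becomes a Schwartz function that decays in y - x and, at scale 2^j, in \<omega>; integrating the
  second decay produces the factor 2^(jd). The L^1 norm thus grows with j, while the L^2 bound is
  uniform in j and rests on an almost orthogonality that summing the pieces one by one would lose.
  Hence the whole sequence (h_j) is interpolated at once, and the split height has to follow the L^1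
  norm: at height 2^(jd) \<lambda> both halves of the estimate end with the same weight
  (2^(jd))^(2-p). The constant contains 1/(p-1) + 1/(2-p), so p = 1 and p = 2 are read off directly
  from the two estimates. Since p is the exponent in both x and \<omega>, all this takes place in
  one Lebesgue space over the product. A function representing a block need not be integrable, so
  the estimates are proved for integrable functions and carried over by truncation and Fatou's
  lemma. The limit in the number of blocks uses Fatou again, because the blocks sum to u only when
  tested on a Schwartz function.\<close>

lemma lborel_isometry:
  fixes t :: "'a::euclidean_space"
  assumes "\<bar>c\<bar> = 1"
  shows "distr lborel borel (\<lambda>x. t + c *\<^sub>R x) = lborel"
  using lborel_affine[of c t] assms by (auto simp: density_1)

lemma nn_integral_lborel_affine:
  fixes t :: "'a::euclidean_space"
  assumes [measurable]: "f \<in> borel_measurable borel" and c: "c \<noteq> 0"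
  shows "(\<integral>\<^sup>+x. f x \<partial>lborel) = ennreal (\<bar>c\<bar> ^ DIM('a)) * (\<integral>\<^sup>+x. f (t + c *\<^sub>R x) \<partial>lborel)"
  by (subst lborel_affine[OF c, of t])
     (simp add: nn_integral_density nn_integral_distr nn_integral_cmult)

lemma nn_integral_lborel_isometry:
  fixes t :: "'a::euclidean_space"
  assumes "f \<in> borel_measurable borel" and "\<bar>c\<bar> = 1"
  shows "(\<integral>\<^sup>+x. f (t + c *\<^sub>R x) \<partial>lborel) = (\<integral>\<^sup>+x. f x \<partial>lborel)"
  using nn_integral_lborel_affine[OF assms(1), of c t] assms(2) by auto

lemma integral_lborel_isometry:
  fixes t :: "'a::euclidean_space" and f :: "'a \<Rightarrow> 'b::{banach,second_countable_topology}"
  assumes [measurable]: "f \<in> borel_measurable borel" and c: "\<bar>c\<bar> = 1"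
  shows "(\<integral>x. f (t + c *\<^sub>R x) \<partial>lborel) = (\<integral>x. f x \<partial>lborel)"
  by (subst (2) lborel_isometry[OF c, symmetric, of t]) (simp add: integral_distr)

lemma integrable_lborel_isometry:
  fixes t :: "'a::euclidean_space" and f :: "'a \<Rightarrow> 'b::{banach,second_countable_topology}"
  assumes "integrable lborel f" and c: "\<bar>c\<bar> = 1"
  shows "integrable lborel (\<lambda>x. f (t + c *\<^sub>R x))"
proof -
  have [measurable]: "f \<in> borel_measurable borel"
    using assms(1) by auto
  show ?thesis
    using assms(1) by (subst (asm) lborel_isometry[OF c, symmetric, of t]) (simp add: integrable_distr_eq)
qed

text \<open>The bound on \<open>k\<close> dominates the integrand by |f(x)| |m(y)|, whose double
  integral is a product of two finite ones, so the order of integration may be exchanged. With a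
  character as kernel, this makes the Fourier transform symmetric for the bilinear pairing.\<close>

lemma Fubini_tensor:
  fixes f m :: "'a::euclidean_space \<Rightarrow> complex"
  assumes f: "integrable lborel f" and m: "integrable lborel m"
    and k[measurable]: "(\<lambda>(x, y). k x y) \<in> borel_measurable (lborel \<Otimes>\<^sub>M lborel)"
    and k1: "\<And>x y. cmod (k x y) \<le> 1"
  shows "(\<integral>y. (\<integral>x. f x * k x y \<partial>lborel) * m y \<partial>lborel)
    = (\<integral>x. f x * (\<integral>y. m y * k x y \<partial>lborel) \<partial>lborel)"
proof -
  have [measurable]: "f \<in> borel_measurable borel" "m \<in> borel_measurable borel"
    using f m by auto
  have int: "integrable (lborel \<Otimes>\<^sub>M lborel) (\<lambda>(x, y). f x * m y * k x y)"
  proof (subst integrable_iff_bounded, intro conjI)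
    have "(\<integral>\<^sup>+z. norm (case z of (x, y) \<Rightarrow> f x * m y * k x y) \<partial>(lborel \<Otimes>\<^sub>M lborel))
      \<le> (\<integral>\<^sup>+z. ennreal (cmod (f (fst z))) * ennreal (cmod (m (snd z))) \<partial>(lborel \<Otimes>\<^sub>M lborel))"
    proof (intro nn_integral_mono)
      fix z :: "'a \<times> 'a"
      have "cmod (f (fst z)) * cmod (m (snd z)) * cmod (k (fst z) (snd z))
        \<le> cmod (f (fst z)) * cmod (m (snd z)) * 1"
        by (intro mult_left_mono k1) auto
      then show "ennreal (norm (case z of (x, y) \<Rightarrow> f x * m y * k x y))
          \<le> ennreal (cmod (f (fst z))) * ennreal (cmod (m (snd z)))"
        by (auto simp: norm_mult split: prod.split simp flip: ennreal_mult)
    qed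
    also have "\<dots> = (\<integral>\<^sup>+x. ennreal (cmod (f x)) \<partial>lborel) * (\<integral>\<^sup>+x. ennreal (cmod (m x)) \<partial>lborel)"
      by (subst lborel.nn_integral_fst[symmetric]) (auto simp: nn_integral_cmult nn_integral_multc)
    also have "\<dots> < \<infinity>"
      using f m by (auto simp: integrable_iff_bounded ennreal_mult_less_top)
    finally show "(\<integral>\<^sup>+z. norm (case z of (x, y) \<Rightarrow> f x * m y * k x y) \<partial>(lborel \<Otimes>\<^sub>M lborel)) < \<infinity>" .
  qed measurable
  have "(\<integral>y. (\<integral>x. f x * k x y \<partial>lborel) * m y \<partial>lborel) = (\<integral>y. (\<integral>x. f x * m y * k x y \<partial>lborel) \<partial>lborel)"
    by (simp add: mult_ac flip: integral_mult_left_zero integral_mult_right_zero)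
  also have "\<dots> = (\<integral>x. (\<integral>y. f x * m y * k x y \<partial>lborel) \<partial>lborel)"
    by (rule lborel_pair.Fubini_integral[OF int])
  also have "\<dots> = (\<integral>x. f x * (\<integral>y. m y * k x y \<partial>lborel) \<partial>lborel)"
    by (simp add: mult.assoc flip: integral_mult_right_zero)
  finally show ?thesis .
qed

section \<open>An integrable weight of product form\<close>

lemma integrable_1D_weight: "integrable lborel (\<lambda>x::real. 1 / (1 + x\<^sup>2))"
  using integrable_inverse_1_plus_square
  by (simp add: set_integrable_def einterval_def inverse_eq_divide)

text \<open>\<open>lborel\<close> is the image of a product of one-dimensional Lebesgue measures, so
  an integral of a product over the coordinates factorises. Both \<open>weight\<close> and the
  Gaussians are built as such products.\<close>

lemma
  fixes f :: "'a::euclidean_space \<Rightarrow> real \<Rightarrow> 'b::{real_normed_field,banach,second_countable_topology}"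
  assumes f: "\<And>b. b \<in> Basis \<Longrightarrow> integrable lborel (f b)"
  shows integrable_lborel_prod: "integrable lborel (\<lambda>x::'a. \<Prod>b\<in>Basis. f b (x \<bullet> b))"
    and integral_lborel_prod:
      "(\<integral>x. (\<Prod>b\<in>Basis. f b ((x::'a) \<bullet> b)) \<partial>lborel) = (\<Prod>b\<in>Basis. (\<integral>x. f b x \<partial>lborel))"
proof -
  have [measurable]: "f b \<in> borel_measurable borel" if "b \<in> Basis" for b
    using f[OF that] by auto
  interpret product_sigma_finite "\<lambda>_::'a. lborel :: real measure" ..
  have [measurable]: "(\<lambda>f. \<Sum>b\<in>Basis. f b *\<^sub>R b) \<in> (\<Pi>\<^sub>M b\<in>(Basis::'a set). lborel) \<rightarrow>\<^sub>M borel"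
    by measurable
  have [measurable]: "(\<lambda>x::'a. \<Prod>b\<in>Basis. f b (x \<bullet> b)) \<in> borel_measurable borel"
    by measurable
  show "integrable lborel (\<lambda>x::'a. \<Prod>b\<in>Basis. f b (x \<bullet> b))"
    by (subst lborel_eq, subst integrable_distr_eq) (auto intro!: product_integrable_prod f)
  show "(\<integral>x. (\<Prod>b\<in>Basis. f b ((x::'a) \<bullet> b)) \<partial>lborel) = (\<Prod>b\<in>Basis. (\<integral>x. f b x \<partial>lborel))"
    by (subst lborel_eq, subst integral_distr)
       (auto simp: product_integral_prod f)
qed

text \<open>The product form makes integrability a one-dimensional matter. Each factor is at least
  (1 + |x|)^(-2), so decay of order 2d suffices to be dominated by a multiple of
  \<open>weight\<close>, and decay estimates are stated against it from here on.\<close>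

definition weight :: "'a::euclidean_space \<Rightarrow> real" where
  "weight x = (\<Prod>b\<in>Basis. 1 / (1 + (x \<bullet> b)\<^sup>2))"

lemma weight_pos: "0 < weight x"
  unfolding weight_def by (intro prod_pos) (auto intro: add_pos_nonneg)

lemma weight_nonneg [simp]: "0 \<le> weight x"
  using weight_pos[of x] by simp

lemma borel_measurable_weight [measurable]: "weight \<in> borel_measurable borel"
  unfolding weight_def[abs_def] by measurable

lemma integrable_weight: "integrable lborel weight"
  unfolding weight_def[abs_def] by (intro integrable_lborel_prod integrable_1D_weight)

lemma weight_ge: "1 \<le> weight x * (1 + norm x) ^ (2 * DIM('a))" for x :: "'a::euclidean_space"
proof -
  have "(\<Prod>b\<in>Basis. (1 + (x \<bullet> b)\<^sup>2)) \<le> (\<Prod>b\<in>(Basis::'a set). (1 + norm x)\<^sup>2)"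
  proof (intro prod_mono conjI)
    fix b :: 'a assume "b \<in> Basis"
    then have "\<bar>x \<bullet> b\<bar> \<le> norm x"
      by (rule Basis_le_norm)
    then have "(x \<bullet> b)\<^sup>2 \<le> (norm x)\<^sup>2"
      by (metis abs_le_square_iff abs_norm_cancel)
    then show "1 + (x \<bullet> b)\<^sup>2 \<le> (1 + norm x)\<^sup>2"
      by (simp add: power2_sum add_increasing2)
  qed (auto intro: add_nonneg_nonneg)
  then have "(\<Prod>b\<in>Basis. (1 + (x \<bullet> b)\<^sup>2)) \<le> (1 + norm x) ^ (2 * DIM('a))"
    by (simp add: power_mult)
  moreover have "0 < (\<Prod>b\<in>Basis. (1 + (x \<bullet> b)\<^sup>2))"
    by (intro prod_pos) (auto intro: add_pos_nonneg)
  ultimately show ?thesis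
    by (simp add: weight_def prod_dividef field_simps)
qed

lemma le_weightI:
  fixes x :: "'a::euclidean_space"
  assumes "(1 + norm x) ^ (2 * DIM('a)) * a \<le> C" and "0 \<le> a"
  shows "a \<le> C * weight x"
proof -
  have "a \<le> a * (weight x * (1 + norm x) ^ (2 * DIM('a)))"
    using mult_left_mono[OF weight_ge[of x] assms(2)] by simp
  also have "\<dots> = weight x * ((1 + norm x) ^ (2 * DIM('a)) * a)"
    by simp
  also have "\<dots> \<le> weight x * C"
    by (intro mult_left_mono assms) auto
  finally show ?thesis by (simp add: mult.commute)
qed

abbreviation wave :: "'a::real_inner \<Rightarrow> 'a \<Rightarrow> complex" where
  "wave x \<omega> \<equiv> cis (- 2 * pi * (x \<bullet> \<omega>))"

section \<open>Families of Schwartz functions\<close>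

definition dir_deriv :: "'a::euclidean_space \<Rightarrow> ('a \<Rightarrow> complex) \<Rightarrow> 'a \<Rightarrow> complex" where
  "dir_deriv b f = (\<lambda>x. frechet_derivative f (at x) b)"

lemma dir_deriv_eqI:
  "(\<And>x. (f has_derivative f' x) (at x)) \<Longrightarrow> dir_deriv b f = (\<lambda>x. f' x b)"
  unfolding dir_deriv_def by (rule ext) (metis frechet_derivative_at)

lemma differentiable_has_derivative:
  "f differentiable at x \<Longrightarrow> (f has_derivative frechet_derivative f (at x)) (at x)"
  by (simp add: frechet_derivative_works)

text \<open>The head of the list in \<open>iter_deriv\<close> is the outermost derivative. Splitting
  off the innermost one instead lets an induction replace the function by one of its
  derivatives.\<close>

lemma iter_deriv_append: "iter_deriv (bs @ [b]) f = iter_deriv bs (dir_deriv b f)"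
  by (induction bs) (auto simp: dir_deriv_def)

text \<open>The growth condition \<open>Q\<close> is imposed on a whole family of functions, so that its bounds are
  uniform over the index. Schwartz seminorms are thereby handled without naming them.\<close>

primrec deriv_bound ::
    "(('i \<Rightarrow> 'a::euclidean_space \<Rightarrow> complex) \<Rightarrow> bool) \<Rightarrow> nat \<Rightarrow> ('i \<Rightarrow> 'a \<Rightarrow> complex) \<Rightarrow> bool" where
  "deriv_bound Q 0 f \<longleftrightarrow> Q f"
| "deriv_bound Q (Suc n) f \<longleftrightarrow> Q f \<and> (\<forall>i x. f i differentiable at x) \<and>
     (\<forall>b\<in>Basis. deriv_bound Q n (\<lambda>i. dir_deriv b (f i)))"

definition decay :: "('i \<Rightarrow> 'a::euclidean_space \<Rightarrow> complex) \<Rightarrow> bool" where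
  "decay f \<longleftrightarrow> (\<forall>k. \<exists>C. \<forall>i x. (1 + norm x) ^ k * cmod (f i x) \<le> C)"

definition slow :: "('i \<Rightarrow> 'a::euclidean_space \<Rightarrow> complex) \<Rightarrow> bool" where
  "slow f \<longleftrightarrow> (\<exists>k C. \<forall>i x. cmod (f i x) \<le> C * (1 + norm x) ^ k)"

definition schwartz_family :: "('i \<Rightarrow> 'a::euclidean_space \<Rightarrow> complex) \<Rightarrow> bool" where
  "schwartz_family f \<longleftrightarrow> (\<forall>n. deriv_bound decay n f)"

definition multiplier_family :: "('i \<Rightarrow> 'a::euclidean_space \<Rightarrow> complex) \<Rightarrow> bool" where
  "multiplier_family f \<longleftrightarrow> (\<forall>n. deriv_bound slow n f)"

lemma deriv_bound_base: "deriv_bound Q n f \<Longrightarrow> Q f"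
  by (cases n) auto

lemma deriv_bound_SucD: "deriv_bound Q (Suc n) f \<Longrightarrow> deriv_bound Q n f"
  by (induction n arbitrary: f) auto

section \<open>Closure of the derivative bounds under sums and products\<close>

lemma deriv_bound_add:
  assumes Q: "\<And>f g. Q f \<Longrightarrow> Q g \<Longrightarrow> Q (\<lambda>i x. f i x + g i x)"
  shows "deriv_bound Q n f \<Longrightarrow> deriv_bound Q n g \<Longrightarrow> deriv_bound Q n (\<lambda>i x. f i x + g i x)"
proof (induction n arbitrary: f g)
  case (Suc n)
  have "dir_deriv b (\<lambda>x. f i x + g i x) = (\<lambda>x. dir_deriv b (f i) x + dir_deriv b (g i) x)" for b i
    using Suc.prems unfolding dir_deriv_def[of _ "f i"] dir_deriv_def[of _ "g i"]
    by (intro dir_deriv_eqI has_derivative_add differentiable_has_derivative) auto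
  with Suc show ?case
    by (auto intro: Q differentiable_add)
qed (auto intro: Q)

text \<open>By the Leibniz rule a derivative of the product is a sum of two products, in each of
  which one factor is undifferentiated and has an order to spare. Separate conditions for the
  factors are needed because slow growth times rapid decay is rapid decay.\<close>

lemma deriv_bound_mult:
  assumes Q: "\<And>f g. Q1 f \<Longrightarrow> Q2 g \<Longrightarrow> Q3 (\<lambda>i x. f i x * g i x)"
    and Q3: "\<And>f g. Q3 f \<Longrightarrow> Q3 g \<Longrightarrow> Q3 (\<lambda>i x. f i x + g i x)"
  shows "deriv_bound Q1 n f \<Longrightarrow> deriv_bound Q2 n g \<Longrightarrow> deriv_bound Q3 n (\<lambda>i x. f i x * g i x)"
proof (induction n arbitrary: f g)
  case (Suc n)
  have "dir_deriv b (\<lambda>x. f i x * g i x)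
      = (\<lambda>x. f i x * dir_deriv b (g i) x + dir_deriv b (f i) x * g i x)" for b i
    using Suc.prems unfolding dir_deriv_def[of _ "f i"] dir_deriv_def[of _ "g i"]
    by (intro dir_deriv_eqI has_derivative_mult differentiable_has_derivative) auto
  moreover have "deriv_bound Q1 n f" "deriv_bound Q2 n g"
    using Suc.prems by (blast intro: deriv_bound_SucD)+
  ultimately show ?case
    using Suc by (auto intro!: Q deriv_bound_add Q3 differentiable_mult)
qed (auto intro: Q)

text \<open>Translates between the recursion, convenient for inductions, and the lists of
  derivatives in the definition of Schwartz space. The recursion differentiates from the inside, so
  lists are taken apart at their end.\<close>

lemma deriv_bound_iff:
  "(\<forall>n. deriv_bound Q n f) \<longleftrightarrow> (\<forall>bs. set bs \<subseteq> Basis \<longrightarrow>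
     Q (\<lambda>i. iter_deriv bs (f i)) \<and> (\<forall>i x. iter_deriv bs (f i) differentiable at x))"
proof (intro iffI allI impI)
  fix bs :: "'b list" assume "\<forall>n. deriv_bound Q n f" and "set bs \<subseteq> Basis"
  then show "Q (\<lambda>i. iter_deriv bs (f i)) \<and> (\<forall>i x. iter_deriv bs (f i) differentiable at x)"
  proof (induction bs arbitrary: f rule: rev_induct)
    case Nil
    from Nil(1)[rule_format, of "Suc 0"] show ?case by simp
  next
    case (snoc b bs)
    have "deriv_bound Q n (\<lambda>i. dir_deriv b (f i))" for n
      using snoc.prems(1)[rule_format, of "Suc n"] snoc.prems(2) by simp
    then show ?case using snoc.IH[of "\<lambda>i. dir_deriv b (f i)"] snoc.prems by (simp add: iter_deriv_append)
  qed
next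
  fix n assume "\<forall>bs. set bs \<subseteq> Basis \<longrightarrow>
     Q (\<lambda>i. iter_deriv bs (f i)) \<and> (\<forall>i x. iter_deriv bs (f i) differentiable at x)"
  then show "deriv_bound Q n f"
  proof (induction n arbitrary: f)
    case 0
    then show ?case by (auto dest: spec[of _ "[]"])
  next
    case (Suc n)
    have "deriv_bound Q n (\<lambda>i. dir_deriv b (f i))" if "b \<in> Basis" for b
    proof (intro Suc.IH allI impI)
      fix bs :: "'b list" assume "set bs \<subseteq> Basis"
      then show "Q (\<lambda>i. iter_deriv bs (dir_deriv b (f i)))
          \<and> (\<forall>i x. iter_deriv bs (dir_deriv b (f i)) differentiable at x)"
        using Suc.prems[rule_format, of "bs @ [b]"] that by (simp add: iter_deriv_append)
    qed
    with Suc.prems[rule_format, of "[]"] show ?case by simp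
  qed
qed

text \<open>Since (1 + t)^k <= 2^k (t^k + 1), the bounds of orders k and 0 suffice. Powers of 1 +
  |x| are preferred because they increase with k and are submultiplicative.\<close>

lemma decayI:
  assumes "\<And>k. \<exists>C. \<forall>i x. norm x ^ k * cmod (f i x) \<le> C"
  shows "decay f"
  unfolding decay_def
proof
  fix k
  obtain C where C: "\<And>i x. norm x ^ k * cmod (f i x) \<le> C" using assms by blast
  obtain D where D: "\<And>i x. norm x ^ 0 * cmod (f i x) \<le> D" using assms by blast
  have "(1 + norm x) ^ k * cmod (f i x) \<le> 2 ^ k * (C + D)" for i x
  proof -
    have "(1 + norm x) ^ k \<le> (2 * max 1 (norm x)) ^ k"
      by (intro power_mono) auto
    also have "\<dots> \<le> 2 ^ k * (norm x ^ k + 1)"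
      by (auto simp: power_mult_distrib max_def)
    finally have "(1 + norm x) ^ k * cmod (f i x) \<le> 2 ^ k * (norm x ^ k + 1) * cmod (f i x)"
      by (rule mult_right_mono) auto
    also have "\<dots> = 2 ^ k * (norm x ^ k * cmod (f i x) + norm x ^ 0 * cmod (f i x))"
      by (simp add: algebra_simps)
    also have "\<dots> \<le> 2 ^ k * (C + D)"
      by (intro mult_left_mono add_mono C D) auto
    finally show ?thesis .
  qed
  then show "\<exists>C. \<forall>i x. (1 + norm x) ^ k * cmod (f i x) \<le> C" by blast
qed

lemma decayD:
  assumes "decay f"
  shows "\<exists>C. \<forall>i x. norm x ^ k * cmod (f i x) \<le> C"
proof -
  obtain C where C: "\<And>i x. (1 + norm x) ^ k * cmod (f i x) \<le> C"
    using assms unfolding decay_def by blast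
  have "norm x ^ k * cmod (f i x) \<le> C" for i x
    by (rule order_trans[OF mult_right_mono[OF power_mono] C]) auto
  then show ?thesis by blast
qed

lemma decay_add: "decay f \<Longrightarrow> decay g \<Longrightarrow> decay (\<lambda>i x. f i x + g i x)"
  unfolding decay_def
proof
  fix k
  assume "\<forall>k. \<exists>C. \<forall>i x. (1 + norm x) ^ k * cmod (f i x) \<le> C"
    and "\<forall>k. \<exists>C. \<forall>i x. (1 + norm x) ^ k * cmod (g i x) \<le> C"
  then obtain C D where C: "\<And>i x. (1 + norm x) ^ k * cmod (f i x) \<le> C"
    and D: "\<And>i x. (1 + norm x) ^ k * cmod (g i x) \<le> D" by metis
  have "(1 + norm x) ^ k * cmod (f i x + g i x) \<le> C + D" for i x
  proof -
    have "(1 + norm x) ^ k * cmod (f i x + g i x) \<le> (1 + norm x) ^ k * (cmod (f i x) + cmod (g i x))"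
      by (intro mult_left_mono norm_triangle_ineq) auto
    also have "\<dots> \<le> C + D"
      unfolding distrib_left by (intro add_mono C D)
    finally show ?thesis .
  qed
  then show "\<exists>C. \<forall>i x. (1 + norm x) ^ k * cmod (f i x + g i x) \<le> C" by blast
qed

lemma slow_add: "slow f \<Longrightarrow> slow g \<Longrightarrow> slow (\<lambda>i x. f i x + g i x)"
proof -
  assume "slow f" "slow g"
  then obtain k C l D where C: "\<And>i x. cmod (f i x) \<le> C * (1 + norm x) ^ k"
    and D: "\<And>i x. cmod (g i x) \<le> D * (1 + norm x) ^ l" unfolding slow_def by metis
  have "cmod (f i x + g i x) \<le> (\<bar>C\<bar> + \<bar>D\<bar>) * (1 + norm x) ^ (k + l)" for i x
  proof -
    have "C * (1 + norm x) ^ k \<le> \<bar>C\<bar> * (1 + norm x) ^ (k + l)"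
      by (intro mult_mono power_increasing) auto
    moreover have "D * (1 + norm x) ^ l \<le> \<bar>D\<bar> * (1 + norm x) ^ (k + l)"
      by (intro mult_mono power_increasing) auto
    ultimately show ?thesis
      using C[of i x] D[of i x] norm_triangle_ineq[of "f i x" "g i x"]
      by (simp add: algebra_simps)
  qed
  then show ?thesis unfolding slow_def by blast
qed

lemma slow_bounded: "(\<And>i x. cmod (f i x) \<le> C) \<Longrightarrow> slow f"
  unfolding slow_def by (intro exI[of _ "0::nat"] exI[of _ C]) simp

lemma slow_mult_decay: "slow m \<Longrightarrow> decay f \<Longrightarrow> decay (\<lambda>i x. m i x * f i x)"
  unfolding decay_def
proof
  fix k
  assume "slow m" and f: "\<forall>k. \<exists>C. \<forall>i x. (1 + norm x) ^ k * cmod (f i x) \<le> C"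
  then obtain l D where D: "\<And>i x. cmod (m i x) \<le> D * (1 + norm x) ^ l"
    unfolding slow_def by blast
  obtain C where C: "\<And>i x. (1 + norm x) ^ (k + l) * cmod (f i x) \<le> C"
    using f by blast
  have "(1 + norm x) ^ k * cmod (m i x * f i x) \<le> \<bar>D\<bar> * C" for i x
  proof -
    have "(1 + norm x) ^ k * cmod (m i x * f i x) = (1 + norm x) ^ k * cmod (f i x) * cmod (m i x)"
      by (simp add: norm_mult)
    also have "\<dots> \<le> (1 + norm x) ^ k * cmod (f i x) * (\<bar>D\<bar> * (1 + norm x) ^ l)"
      by (intro mult_left_mono order_trans[OF D] mult_right_mono) auto
    also have "\<dots> = \<bar>D\<bar> * ((1 + norm x) ^ (k + l) * cmod (f i x))"
      by (simp add: power_add)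
    also have "\<dots> \<le> \<bar>D\<bar> * C"
      by (intro mult_left_mono C) auto
    finally show ?thesis .
  qed
  then show "\<exists>C. \<forall>i x. (1 + norm x) ^ k * cmod (m i x * f i x) \<le> C" by blast
qed

section \<open>Families and the definition of Schwartz space\<close>

lemma schwartz_family_iff:
  "schwartz_family f \<longleftrightarrow> (\<forall>bs. set bs \<subseteq> Basis \<longrightarrow>
     (\<forall>i x. iter_deriv bs (f i) differentiable at x) \<and>
     (\<forall>k. \<exists>C. \<forall>i x. norm x ^ k * cmod (iter_deriv bs (f i) x) \<le> C))"
  unfolding schwartz_family_def deriv_bound_iff
  by (auto 4 4 intro: decayI dest: decayD)

lemma schwartz_iff:
  "f \<in> schwartz \<longleftrightarrow> (\<forall>bs. set bs \<subseteq> Basis \<longrightarrow>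
     (\<forall>x. iter_deriv bs f differentiable at x) \<and>
     (\<forall>k. \<exists>C. \<forall>x. norm x ^ k * cmod (iter_deriv bs f x) \<le> C))"
  unfolding schwartz_def smooth_def differentiable_on_def bdd_above_def by auto

lemma schwartz_family_const: "f \<in> schwartz \<Longrightarrow> schwartz_family (\<lambda>_. f)"
  unfolding schwartz_family_iff schwartz_iff by metis

lemma schwartz_family_imp_schwartz: "schwartz_family f \<Longrightarrow> f i \<in> schwartz"
  unfolding schwartz_family_iff schwartz_iff by metis

lemma schwartz_iff_family: "f \<in> schwartz \<longleftrightarrow> schwartz_family (\<lambda>_::unit. f)"
  using schwartz_family_const schwartz_family_imp_schwartz by metis

text \<open>The bridge to continuity of distributions: a seminorm is a finite sum of suprema, each
  of which is bounded uniformly over the family.\<close>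

lemma schwartz_family_seminorm:
  fixes f :: "'i \<Rightarrow> 'a::euclidean_space \<Rightarrow> complex"
  assumes "schwartz_family f"
  shows "\<exists>C. \<forall>i. schwartz_seminorm N (f i) \<le> C"
proof -
  let ?L = "{bs. set bs \<subseteq> (Basis::'a set) \<and> length bs \<le> N}"
  have "\<forall>k. \<forall>bs\<in>?L. \<exists>C. \<forall>i x. norm x ^ k * cmod (iter_deriv bs (f i) x) \<le> C"
    using assms unfolding schwartz_family_iff by auto
  then obtain C where C: "\<And>k bs i x. bs \<in> ?L \<Longrightarrow> norm x ^ k * cmod (iter_deriv bs (f i) x) \<le> C k bs"
    by metis
  have "schwartz_seminorm N (f i) \<le> (\<Sum>k\<le>N. \<Sum>bs\<in>?L. C k bs)" for i
    unfolding schwartz_seminorm_def by (intro sum_mono cSUP_least) (auto intro!: C)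
  then show ?thesis by blast
qed

lemma schwartz_family_mult:
  assumes "multiplier_family m" and "schwartz_family f"
  shows "schwartz_family (\<lambda>i x. m i x * f i x)"
  using assms unfolding schwartz_family_def multiplier_family_def
  by (blast intro: deriv_bound_mult slow_mult_decay decay_add)

lemma multiplier_family_add:
  assumes "multiplier_family f" and "multiplier_family g"
  shows "multiplier_family (\<lambda>i x. f i x + g i x)"
  using assms unfolding multiplier_family_def
  by (blast intro: deriv_bound_add slow_add)

lemma schwartz_family_add:
  assumes "schwartz_family f" and "schwartz_family g"
  shows "schwartz_family (\<lambda>i x. f i x + g i x)"
  using assms unfolding schwartz_family_def
  by (blast intro: deriv_bound_add decay_add)

lemma multiplier_mult_schwartz:
  assumes "multiplier_family (\<lambda>_::unit. m)" and "f \<in> schwartz"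
  shows "(\<lambda>x. m x * f x) \<in> schwartz"
  using schwartz_family_mult[OF assms(1) schwartz_family_const[OF assms(2)]]
  by (simp add: schwartz_iff_family)

lemma schwartz_family_dir_deriv:
  assumes "schwartz_family f" and "b \<in> Basis"
  shows "schwartz_family (\<lambda>i. dir_deriv b (f i))"
  using assms unfolding schwartz_family_def by (metis deriv_bound.simps(2))

lemma schwartz_family_differentiable:
  "schwartz_family f \<Longrightarrow> f i differentiable at x"
  unfolding schwartz_family_def by (metis deriv_bound.simps(2))

lemma schwartz_differentiable: "f \<in> schwartz \<Longrightarrow> f differentiable at x"
  unfolding schwartz_iff_family by (rule schwartz_family_differentiable)

lemma schwartz_dir_deriv: "f \<in> schwartz \<Longrightarrow> b \<in> Basis \<Longrightarrow> dir_deriv b f \<in> schwartz"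
  unfolding schwartz_iff_family by (rule schwartz_family_dir_deriv)

lemma schwartz_continuous: "f \<in> schwartz \<Longrightarrow> continuous_on UNIV f"
  by (auto intro!: differentiable_imp_continuous_on simp: differentiable_on_def schwartz_differentiable)

lemma schwartz_measurable: "f \<in> schwartz \<Longrightarrow> f \<in> borel_measurable borel"
  by (rule borel_measurable_continuous_onI[OF schwartz_continuous])

lemma schwartz_family_decay:
  "schwartz_family f \<Longrightarrow> \<exists>C. \<forall>i x. (1 + norm x) ^ k * cmod (f i x) \<le> C"
  unfolding schwartz_family_def using deriv_bound_base unfolding decay_def by blast

lemma schwartz_decay: "f \<in> schwartz \<Longrightarrow> \<exists>C\<ge>0. \<forall>x. (1 + norm x) ^ k * cmod (f x) \<le> C"
  using schwartz_family_decay[of "\<lambda>_::unit. f" k] unfolding schwartz_iff_family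
  by (metis abs_ge_self abs_ge_zero order_trans)

lemma schwartz_family_weight:
  fixes f :: "'i \<Rightarrow> 'a::euclidean_space \<Rightarrow> complex"
  assumes "schwartz_family f"
  shows "\<exists>C\<ge>0. \<forall>i x. cmod (f i x) \<le> C * weight x"
proof -
  obtain C where "\<And>i x. (1 + norm x) ^ (2 * DIM('a)) * cmod (f i x) \<le> C"
    using schwartz_family_decay[OF assms] by blast
  then have C: "cmod (f i x) \<le> C * weight x" for i x
    by (intro le_weightI) auto
  have "cmod (f i x) \<le> \<bar>C\<bar> * weight x" for i x
    by (rule order_trans[OF C]) (auto intro: mult_right_mono)
  then show ?thesis by (metis abs_ge_zero)
qed

lemma schwartz_weight: "f \<in> schwartz \<Longrightarrow> \<exists>C\<ge>0. \<forall>x. cmod (f x) \<le> C * weight x"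
  using schwartz_family_weight[of "\<lambda>_::unit. f"] unfolding schwartz_iff_family by auto

lemma schwartz_integrable:
  assumes "f \<in> schwartz"
  shows "integrable lborel f"
proof -
  obtain C where "\<And>x. cmod (f x) \<le> C * weight x" using schwartz_weight[OF assms] by blast
  moreover have "integrable lborel (\<lambda>x. C * weight x)" by (simp add: integrable_weight)
  ultimately show ?thesis
    using schwartz_measurable[OF assms]
    by (intro Bochner_Integration.integrable_bound[of lborel "\<lambda>x. C * weight x" f] AE_I2)
       (auto intro: order_trans[OF _ abs_ge_self])
qed

section \<open>Affine substitutions and multipliers\<close>

lemma power_one_plus_le:
  fixes a b c :: real
  assumes "a \<le> b + c" and "0 \<le> a" and "0 \<le> b" and "0 \<le> c"
  shows "(1 + a) ^ k \<le> (1 + b) ^ k * (1 + c) ^ k"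
proof -
  have "1 + a \<le> (1 + b) * (1 + c)"
    using assms(1) mult_nonneg_nonneg[OF assms(3,4)] by (simp add: algebra_simps)
  then show ?thesis
    using assms(2) by (subst power_mult_distrib[symmetric]) (intro power_mono, auto)
qed

text \<open>The factor \<open>a i\<close> may grow in the translation \<open>v i\<close>, by Peetre's inequality
  \<open>1 + |v| \<le> (1 + |v + c x|) (1 + |x|)\<close>.\<close>

lemma deriv_bound_affine:
  assumes c: "\<And>i. \<bar>c i\<bar> \<le> 1" and "\<phi> \<in> schwartz" and "\<And>i. cmod (a i) \<le> A i"
    and Q: "\<And>a \<psi>. \<psi> \<in> schwartz \<Longrightarrow> (\<And>i. cmod (a i) \<le> A i) \<Longrightarrow> Q (\<lambda>i x. a i * \<psi> (v i + c i *\<^sub>R x))"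
  shows "deriv_bound Q n (\<lambda>i x. a i * \<phi> (v i + c i *\<^sub>R x))"
  using assms(2,3)
proof (induction n arbitrary: \<phi> a)
  case (Suc n)
  have d: "((\<lambda>x. a i * \<phi> (v i + c i *\<^sub>R x)) has_derivative
      (\<lambda>h. a i * frechet_derivative \<phi> (at (v i + c i *\<^sub>R x)) (c i *\<^sub>R h))) (at x)" for i x
    by (rule derivative_eq_intros refl
        has_derivative_compose[OF _ differentiable_has_derivative[OF schwartz_differentiable[OF Suc.prems(1)]]])+
      simp
  have "dir_deriv b (\<lambda>x. a i * \<phi> (v i + c i *\<^sub>R x))
      = (\<lambda>x. (a i * c i) * dir_deriv b \<phi> (v i + c i *\<^sub>R x))" for b i
    unfolding dir_deriv_eqI[OF d] dir_deriv_def
    by (simp add: linear_scale[OF linear_frechet_derivative[OF schwartz_differentiable[OF Suc.prems(1)]]]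
        scaleR_conv_of_real mult.assoc)
  moreover have "cmod (a i * c i) \<le> A i" for i
    using mult_mono[OF Suc.prems(2) c[of i] order_trans[OF norm_ge_zero Suc.prems(2)]]
    by (simp add: norm_mult)
  ultimately have "deriv_bound Q n (\<lambda>i. dir_deriv b (\<lambda>x. a i * \<phi> (v i + c i *\<^sub>R x)))" if "b \<in> Basis" for b
    using Suc.IH[of "dir_deriv b \<phi>" "\<lambda>i. a i * c i"] schwartz_dir_deriv[OF Suc.prems(1) that] by simp
  then show ?case
    using Q[of \<phi> a] Suc.prems differentiableI[OF d] by simp
qed (auto intro: Q)

text \<open>For small x the argument of \<open>\<phi>\<close> stays near v i, where the decay of
  \<open>\<phi>\<close> absorbs the growth of a i; for large x the factor (1 + |x|)^k does, which a
  multiplier is allowed. The uniformity in i is what later gives the kernels their decay in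
  frequency.\<close>

lemma multiplier_family_affine:
  fixes v :: "'i \<Rightarrow> 'a::euclidean_space"
  assumes c: "\<And>i. \<bar>c i\<bar> \<le> 1" and "\<phi> \<in> schwartz" and "\<And>i. cmod (a i) \<le> D * (1 + norm (v i)) ^ k"
  shows "multiplier_family (\<lambda>i x. a i * \<phi> (v i + c i *\<^sub>R x))"
  unfolding multiplier_family_def
proof (intro allI deriv_bound_affine[OF assms])
  fix a :: "'i \<Rightarrow> complex" and \<psi> :: "'a \<Rightarrow> complex"
  assume "\<psi> \<in> schwartz" and a: "\<And>i. cmod (a i) \<le> D * (1 + norm (v i)) ^ k"
  then obtain C where C: "\<And>x. (1 + norm x) ^ k * cmod (\<psi> x) \<le> C"
    using schwartz_decay by blast
  have "cmod (a i * \<psi> (v i + c i *\<^sub>R x)) \<le> \<bar>D\<bar> * C * (1 + norm x) ^ k" for i x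
  proof -
    let ?y = "v i + c i *\<^sub>R x"
    have "norm (v i) = norm (?y - c i *\<^sub>R x)" by simp
    also have "\<dots> \<le> norm ?y + \<bar>c i\<bar> * norm x"
      by (metis norm_scaleR norm_triangle_ineq4)
    also have "\<dots> \<le> norm ?y + 1 * norm x"
      using c by (intro add_left_mono mult_right_mono) auto
    finally have *: "(1 + norm (v i)) ^ k \<le> (1 + norm ?y) ^ k * (1 + norm x) ^ k"
      by (intro power_one_plus_le) auto
    have "cmod (a i * \<psi> ?y) \<le> \<bar>D\<bar> * ((1 + norm ?y) ^ k * (1 + norm x) ^ k) * cmod (\<psi> ?y)"
      unfolding norm_mult
      by (intro mult_right_mono order_trans[OF a] mult_mono *) auto
    also have "\<dots> = \<bar>D\<bar> * (1 + norm x) ^ k * ((1 + norm ?y) ^ k * cmod (\<psi> ?y))"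
      by simp
    also have "\<dots> \<le> \<bar>D\<bar> * (1 + norm x) ^ k * C"
      by (intro mult_left_mono C) auto
    finally show ?thesis by (simp add: mult_ac)
  qed
  then show "slow (\<lambda>i x. a i * \<psi> (v i + c i *\<^sub>R x))" unfolding slow_def by blast
qed

text \<open>Covers translations and reflections. The induction is that of
  \<open>multiplier_family_affine\<close> with decay as growth condition; |c| = 1 recovers the size
  of x from that of v + c x.\<close>

lemma schwartz_isometry:
  fixes v :: "'a::euclidean_space"
  assumes c: "\<bar>c\<bar> = 1" and "\<phi> \<in> schwartz"
  shows "(\<lambda>x. \<phi> (v + c *\<^sub>R x)) \<in> schwartz"
proof -
  have "deriv_bound decay n (\<lambda>i::unit. \<lambda>x. 1 * \<phi> (v + c *\<^sub>R x))" for n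
  proof (rule deriv_bound_affine[where A="\<lambda>_. 1"])
    fix a :: "unit \<Rightarrow> complex" and \<psi> :: "'a \<Rightarrow> complex"
    assume \<psi>: "\<psi> \<in> schwartz" and a: "\<And>i. cmod (a i) \<le> 1"
    show "decay (\<lambda>i x. a i * \<psi> (v + c *\<^sub>R x))"
      unfolding decay_def
    proof
      fix k
      obtain C where C: "\<And>x. (1 + norm x) ^ k * cmod (\<psi> x) \<le> C"
        using schwartz_decay[OF \<psi>] by blast
      have "(1 + norm x) ^ k * cmod (a i * \<psi> (v + c *\<^sub>R x)) \<le> (1 + norm v) ^ k * C" for i x
      proof -
        let ?y = "v + c *\<^sub>R x"
        have "norm x = norm (?y - v)" using c by simp
        also have "\<dots> \<le> norm ?y + norm v"
          by (metis norm_triangle_ineq4)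
        finally have *: "(1 + norm x) ^ k \<le> (1 + norm ?y) ^ k * (1 + norm v) ^ k"
          by (intro power_one_plus_le) auto
        have "(1 + norm x) ^ k * cmod (a i * \<psi> ?y)
            \<le> ((1 + norm ?y) ^ k * (1 + norm v) ^ k) * (1 * cmod (\<psi> ?y))"
          unfolding norm_mult by (intro mult_mono * a) auto
        also have "\<dots> = (1 + norm v) ^ k * ((1 + norm ?y) ^ k * cmod (\<psi> ?y))" by simp
        also have "\<dots> \<le> (1 + norm v) ^ k * C"
          by (intro mult_left_mono C) auto
        finally show ?thesis .
      qed
      then show "\<exists>C. \<forall>i x. (1 + norm x) ^ k * cmod (a i * \<psi> (v + c *\<^sub>R x)) \<le> C" by blast
    qed
  qed (use assms in auto)
  then show ?thesis
    by (simp add: schwartz_iff_family schwartz_family_def)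
qed

lemma multiplier_family_const:
  fixes a :: "'i \<Rightarrow> complex"
  assumes "\<And>i. cmod (a i) \<le> C"
  shows "multiplier_family (\<lambda>i (x::'a::euclidean_space). a i)"
proof -
  have "deriv_bound slow n (\<lambda>i (x::'a). a i)" if "\<And>i. cmod (a i) \<le> C" for n C and a :: "'i \<Rightarrow> complex"
    using that
  proof (induction n arbitrary: a C)
    case 0
    show ?case using slow_bounded[of "\<lambda>i (x::'a). a i", OF 0] by simp
  next
    case (Suc n)
    have "deriv_bound slow n (\<lambda>(i::'i) (x::'a). 0)"
      using Suc.IH[of "\<lambda>_. 0" 0] by auto
    with slow_bounded[of "\<lambda>i (x::'a). a i", OF Suc.prems] show ?case
      by (simp add: dir_deriv_def)
  qed
  with assms show ?thesis unfolding multiplier_family_def by blast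
qed

text \<open>Differentiating a Fourier transform multiplies the function by such a coordinate. The
  first derivatives are constants, which leaves only the growth of the coordinate itself to be
  checked.\<close>

lemma multiplier_family_coordinate:
  fixes b :: "'a::euclidean_space"
  shows "multiplier_family (\<lambda>(i::'i) x. a * complex_of_real (x \<bullet> b))"
  unfolding multiplier_family_def
proof
  fix n
  have slow: "slow (\<lambda>(i::'i) x. a * complex_of_real (x \<bullet> b))"
  proof -
    have "cmod (a * complex_of_real (x \<bullet> b)) \<le> (cmod a * norm b) * (1 + norm x) ^ 1" for x :: 'a
    proof -
      have "\<bar>x \<bullet> b\<bar> \<le> (1 + norm x) * norm b"
        by (rule order_trans[OF Cauchy_Schwarz_ineq2]) (simp add: mult_right_mono)
      from mult_left_mono[OF this, of "cmod a"] show ?thesis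
        by (simp add: norm_mult mult_ac)
    qed
    then show ?thesis unfolding slow_def by blast
  qed
  have d: "((\<lambda>x. a * complex_of_real (x \<bullet> b)) has_derivative (\<lambda>h. a * complex_of_real (h \<bullet> b))) (at x)" for x :: 'a
    by (intro has_derivative_mult_right has_derivative_of_real has_derivative_inner_left has_derivative_ident)
  have const: "deriv_bound slow n (\<lambda>(i::'i) (x::'a). a * complex_of_real (b' \<bullet> b))" for n b'
    by (rule multiplier_family_const[OF order_refl, unfolded multiplier_family_def, rule_format])
  show "deriv_bound slow n (\<lambda>(i::'i) x. a * complex_of_real (x \<bullet> b))"
  proof (cases n)
    case 0
    then show ?thesis using slow by simp
  next
    case (Suc m)
    then show ?thesis
      unfolding Suc deriv_bound.simps dir_deriv_eqI[OF d]
      by (intro conjI allI ballI slow differentiableI[OF d] const)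
  qed
qed

lemma multiplier_cis:
  fixes v :: "'a::euclidean_space"
  shows "multiplier_family (\<lambda>(_::'i) x. cis (x \<bullet> v))"
proof -
  have d: "((\<lambda>x. a * cis (x \<bullet> v)) has_derivative (\<lambda>h. (h \<bullet> v) * (a * \<i>) * cis (x \<bullet> v))) (at x)" for x :: 'a and a
    by (rule has_derivative_eq_rhs[OF has_derivative_mult_right[OF
          has_derivative_cis[OF has_derivative_inner_left[OF has_derivative_ident]]]])
       (simp add: scaleR_conv_of_real fun_eq_iff mult_ac)
  have slow: "slow (\<lambda>(i::'i) x. a * cis (x \<bullet> v))" for a
    by (rule slow_bounded[of _ "cmod a"]) (simp add: norm_mult)
  \<comment> \<open>The scalar a is generalised because every derivative multiplies it by a new
    constant.\<close>
  have "deriv_bound slow n (\<lambda>(i::'i) x. a * cis (x \<bullet> v))" for n a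
  proof (induction n arbitrary: a)
    case 0
    show ?case using slow by simp
  next
    case (Suc n)
    show ?case
      unfolding deriv_bound.simps dir_deriv_eqI[OF d]
      by (intro conjI allI ballI slow differentiableI[OF d] Suc.IH)
  qed
  from this[of _ 1] show ?thesis unfolding multiplier_family_def by simp
qed

lemma schwartz_cnj:
  assumes "f \<in> schwartz"
  shows "(\<lambda>x. cnj (f x)) \<in> schwartz"
proof -
  have d: "((\<lambda>x. cnj (iter_deriv bs f x)) has_derivative
      (\<lambda>h. cnj (frechet_derivative (iter_deriv bs f) (at x) h))) (at x)" if "set bs \<subseteq> Basis" for bs x
  proof (intro has_derivative_cnj differentiable_has_derivative)
    show "iter_deriv bs f differentiable at x"
      using assms that by (simp add: schwartz_iff)
  qed
  have eq: "iter_deriv bs (\<lambda>x. cnj (f x)) = (\<lambda>x. cnj (iter_deriv bs f x))"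
    if "set bs \<subseteq> Basis" for bs
    using that
  proof (induction bs)
    case (Cons b bs)
    then have "set bs \<subseteq> Basis" by simp
    from dir_deriv_eqI[OF d[OF this], of b] Cons show ?case
      by (simp add: dir_deriv_def)
  qed simp
  show ?thesis
    unfolding schwartz_iff
  proof (intro allI impI conjI)
    fix bs :: "'a list" assume bs: "set bs \<subseteq> Basis"
    show "iter_deriv bs (\<lambda>x. cnj (f x)) differentiable at x" for x
      unfolding eq[OF bs] by (rule differentiableI[OF d[OF bs]])
    show "\<exists>C. \<forall>x. norm x ^ k * cmod (iter_deriv bs (\<lambda>x. cnj (f x)) x) \<le> C" for k
      using assms bs unfolding eq[OF bs] schwartz_iff by simp
  qed
qed

lemma dyadic_generator_schwartz:
  assumes "dyadic_generator \<phi>"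
  shows "\<phi> \<in> schwartz"
  unfolding schwartz_iff
proof (intro allI impI conjI)
  fix bs :: "'a list" assume bs: "set bs \<subseteq> Basis"
  have diff: "iter_deriv bs \<phi> differentiable at x" if "set bs \<subseteq> Basis" for bs x
    using assms that unfolding dyadic_generator_def smooth_def differentiable_on_def by auto
  show "iter_deriv bs \<phi> differentiable at x" for x by (rule diff[OF bs])
  \<comment> \<open>The strict inequality describes an open set, on which vanishing passes to
    derivatives. The sphere |x| = 2 is left to the compact ball, where continuity gives the
    bound.\<close>
  have zero: "iter_deriv bs \<phi> x = 0" if "norm x > 2" for x
    using bs that
  proof (induction bs arbitrary: x)
    case Nil
    with assms show ?case by (simp add: dyadic_generator_def)
  next
    case (Cons b bs)
    have "((\<lambda>x. 0) has_derivative (\<lambda>_. 0)) (at x)" by simp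
    then have "(iter_deriv bs \<phi> has_derivative (\<lambda>_. 0)) (at x)"
      by (rule has_derivative_transform_within_open[where s="- cball 0 2"]) (use Cons in auto)
    then show ?case by (auto dest!: frechet_derivative_at[symmetric])
  qed
  fix k
  have cont: "continuous_on (cball 0 2) (\<lambda>x. norm x ^ k * cmod (iter_deriv bs \<phi> x))"
    using diff[OF bs] by (intro continuous_intros)
      (auto simp: continuous_on_eq_continuous_within intro: differentiable_imp_continuous_within differentiable_at_withinI)
  obtain C where "\<forall>x\<in>cball 0 2. norm x ^ k * cmod (iter_deriv bs \<phi> x) \<le> C"
    using compact_imp_bounded[OF compact_continuous_image[OF cont compact_cball]]
    unfolding bounded_iff by auto
  then have "norm x ^ k * cmod (iter_deriv bs \<phi> x) \<le> max 0 C" for x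
    by (cases "norm x \<le> 2") (auto simp: zero intro: max.coboundedI2)
  then show "\<exists>C. \<forall>x. norm x ^ k * cmod (iter_deriv bs \<phi> x) \<le> C" by blast
qed

text \<open>The low-pass multipliers approximate \<open>1\<close> at rate \<open>2\<^sup>-\<^sup>J\<close> on Schwartz functions.\<close>

lemma multiplier_family_low_pass:
  fixes \<phi> :: "'a::euclidean_space \<Rightarrow> complex"
  assumes "dyadic_generator \<phi>"
  shows "multiplier_family (\<lambda>J x. 2 ^ J * (\<phi> ((1/2) ^ J *\<^sub>R x) - 1))"
  unfolding multiplier_family_def
proof
  fix n
  have \<phi>: "\<phi> \<in> schwartz" by (rule dyadic_generator_schwartz[OF assms])
  obtain C where C: "\<And>x. (1 + norm x) ^ 0 * cmod (\<phi> x) \<le> C"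
    using schwartz_decay[OF \<phi>] by blast
  have "cmod (2 ^ J * (\<phi> ((1/2) ^ J *\<^sub>R x) - 1)) \<le> (C + 1) * (1 + norm x) ^ 1" for J and x :: 'a
  \<comment> \<open>Where the low-pass function equals 1 there is nothing to prove. Elsewhere 2^J <=
    |x|, so the large factor 2^J is slow growth in x.\<close>
  proof (cases "norm ((1/2) ^ J *\<^sub>R x) \<le> 1")
    case True
    have "0 \<le> C" using order_trans[OF _ C[of 0]] by simp
    then show ?thesis
      using assms True by (simp add: dyadic_generator_def)
  next
    case False
    then have "2 ^ J \<le> norm x" by (simp add: field_simps)
    moreover have "cmod (\<phi> ((1/2) ^ J *\<^sub>R x) - 1) \<le> C + 1"
      using C[of "(1/2) ^ J *\<^sub>R x"] norm_triangle_ineq4[of "\<phi> ((1/2) ^ J *\<^sub>R x)" 1] by simp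
    ultimately have "2 ^ J * cmod (\<phi> ((1/2) ^ J *\<^sub>R x) - 1) \<le> (1 + norm x) * (C + 1)"
      by (intro mult_mono) auto
    then show ?thesis by (simp add: norm_mult norm_power mult.commute)
  qed
  then have slow: "slow (\<lambda>J x. 2 ^ J * (\<phi> ((1/2) ^ J *\<^sub>R x) - 1))" unfolding slow_def by blast
  have d: "((\<lambda>x. 2 ^ J * (\<phi> ((1/2) ^ J *\<^sub>R x) - 1)) has_derivative
      (\<lambda>h. 2 ^ J * frechet_derivative \<phi> (at ((1/2) ^ J *\<^sub>R x)) ((1/2) ^ J *\<^sub>R h))) (at x)" for J x
    by (rule derivative_eq_intros refl
        has_derivative_compose[OF _ differentiable_has_derivative[OF schwartz_differentiable[OF \<phi>]]])+
      simp
  \<comment> \<open>The chain rule produces (1/2)^J, which cancels the factor 2^J. From the first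
    derivative on, the family is a plain rescaling with coefficient 1.\<close>
  have "dir_deriv b (\<lambda>x. 2 ^ J * (\<phi> ((1/2) ^ J *\<^sub>R x) - 1))
      = (\<lambda>x. 1 * dir_deriv b \<phi> (0 + (1/2) ^ J *\<^sub>R x))" for b J
    unfolding dir_deriv_eqI[OF d] dir_deriv_def
    by (simp add: linear_scale[OF linear_frechet_derivative[OF schwartz_differentiable[OF \<phi>]]]
        scaleR_conv_of_real power_one_over)
  moreover have "deriv_bound slow n (\<lambda>J x. 1 * dir_deriv b \<phi> (0 + (1/2) ^ J *\<^sub>R x))"
    if "b \<in> Basis" for n and b :: 'a
    using multiplier_family_affine[of "\<lambda>J. (1/2) ^ J" "dir_deriv b \<phi>" "\<lambda>_. 1" 1 "\<lambda>_. 0" 0]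
      schwartz_dir_deriv[OF \<phi> that] power_le_one[of "1/2 :: real"]
    unfolding multiplier_family_def by (simp add: power_abs)
  ultimately show "deriv_bound slow n (\<lambda>J x. 2 ^ J * (\<phi> ((1/2) ^ J *\<^sub>R x) - 1))"
    using slow differentiableI[OF d] by (cases n) auto
qed

section \<open>The Fourier transform\<close>

text \<open>Fatou's lemma, in the form that carries an upper bound to a pointwise limit without a
  dominating function.\<close>

lemma nn_integral_le_limit:
  fixes u :: "nat \<Rightarrow> 'b \<Rightarrow> ennreal"
  assumes "\<And>n. u n \<in> borel_measurable M" and "\<And>x. x \<in> space M \<Longrightarrow> (\<lambda>n. u n x) \<longlonglongrightarrow> U x"
    and "\<And>n. (\<integral>\<^sup>+x. u n x \<partial>M) \<le> K"
  shows "(\<integral>\<^sup>+x. U x \<partial>M) \<le> K"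
proof -
  have "(\<integral>\<^sup>+x. U x \<partial>M) = (\<integral>\<^sup>+x. liminf (\<lambda>n. u n x) \<partial>M)"
    by (intro nn_integral_cong) (metis assms(2) lim_imp_Liminf sequentially_bot)
  also have "\<dots> \<le> liminf (\<lambda>n. \<integral>\<^sup>+x. u n x \<partial>M)"
    by (rule nn_integral_liminf[OF assms(1)])
  also have "\<dots> \<le> liminf (\<lambda>n. K)"
    by (intro Liminf_mono) (simp add: assms(3))
  also have "\<dots> = K" by (simp add: Liminf_const)
  finally show ?thesis .
qed

text \<open>If f is not integrable, its Bochner integral is 0 by convention, so integrability need
  not be checked before estimating.\<close>

lemma norm_integral_le_nn_integral:
  fixes f :: "'b \<Rightarrow> 'c::{banach,second_countable_topology}"
  shows "ennreal (norm (integral\<^sup>L M f)) \<le> (\<integral>\<^sup>+x. ennreal (norm (f x)) \<partial>M)"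
  by (cases "integrable M f") (auto intro: integral_norm_bound_ennreal simp: not_integrable_integral_eq)

lemma integrable_mult_bounded:
  fixes f k :: "'a::euclidean_space \<Rightarrow> complex"
  assumes f: "integrable lborel f" and [measurable]: "k \<in> borel_measurable borel"
    and k: "\<And>x. cmod (k x) \<le> B"
  shows "integrable lborel (\<lambda>x. f x * k x)"
proof -
  have [measurable]: "f \<in> borel_measurable borel" using f by auto
  show ?thesis
  proof (rule Bochner_Integration.integrable_bound)
    show "integrable lborel (\<lambda>x. cmod (f x) * B)" using f by simp
    have "cmod (f x) * cmod (k x) \<le> cmod (f x) * \<bar>B\<bar>" for x
      using k[of x] by (intro mult_left_mono) (simp_all add: order_trans[OF _ abs_ge_self])
    then show "AE x in lborel. norm (f x * k x) \<le> norm (cmod (f x) * B)"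
      by (simp add: norm_mult abs_mult)
  qed measurable
qed

lemma borel_measurable_cis [measurable (raw)]:
  assumes [measurable]: "f \<in> borel_measurable M"
  shows "(\<lambda>x. cis (f x)) \<in> borel_measurable M"
  unfolding cis_conv_exp by measurable

lemma borel_measurable_cnj [measurable (raw)]:
  assumes [measurable]: "f \<in> borel_measurable M"
  shows "(\<lambda>x. cnj (f x)) \<in> borel_measurable M"
  by (rule borel_measurable_continuous_on[OF _ assms]) (intro continuous_intros)

lemma borel_measurable_fourier [measurable]:
  assumes [measurable]: "f \<in> borel_measurable borel"
  shows "fourier f \<in> borel_measurable borel"
  unfolding fourier_def[abs_def] by measurable

lemma norm_fourier_le: "cmod (fourier f \<omega>) \<le> (\<integral>x. cmod (f x) \<partial>lborel)"
proof -
  have "cmod (fourier f \<omega>) \<le> (\<integral>x. cmod (f x * wave x \<omega>) \<partial>lborel)"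
    unfolding fourier_def by (rule integral_norm_bound)
  then show ?thesis by (simp add: norm_mult)
qed

lemma integrable_fourier_integrand:
  "integrable lborel f \<Longrightarrow> integrable lborel (\<lambda>x. f x * wave x \<omega>)"
  by (rule integrable_mult_bounded[where B=1]) auto

lemma inv_fourier_eq: "inv_fourier f x = fourier f (- x)"
  by (simp add: inv_fourier_def fourier_def inner_commute[of x])

lemma inv_fourier_reflect:
  assumes [measurable]: "f \<in> borel_measurable borel"
  shows "inv_fourier f x = fourier (\<lambda>y. f (- y)) x"
  using integral_lborel_isometry[of "\<lambda>y. f y * cis (2 * pi * (y \<bullet> x))" "-1" 0]
  by (simp add: inv_fourier_def fourier_def inner_commute[of x])

lemma fourier_multiplication_formula:
  assumes "integrable lborel f" and "integrable lborel m"
  shows "(\<integral>y. fourier f y * m y \<partial>lborel) = (\<integral>x. f x * fourier m x \<partial>lborel)"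
  unfolding fourier_def
  using Fubini_tensor[OF assms, of "\<lambda>x y. wave x y"]
  by (subst (2) inner_commute) simp

subsection \<open>Gaussians\<close>

text \<open>This is exp(-2 \<pi>^2 \<sigma>^2 |\<omega>|^2), normalised so that its Fourier
  transform is the centred normal density of standard deviation \<sigma> in each coordinate. As
  \<sigma> tends to 0 it tends to 1, while the density concentrates at the origin.\<close>

definition gaussian :: "real \<Rightarrow> 'a::euclidean_space \<Rightarrow> real" where
  "gaussian \<sigma> \<omega> = (\<Prod>b\<in>Basis. exp (- 2 * pi\<^sup>2 * \<sigma>\<^sup>2 * (\<omega> \<bullet> b)\<^sup>2))"

definition gaussian_density :: "real \<Rightarrow> 'a::euclidean_space \<Rightarrow> real" where
  "gaussian_density \<sigma> x = (\<Prod>b\<in>Basis. normal_density 0 \<sigma> (x \<bullet> b))"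

lemma borel_measurable_gaussian [measurable]: "gaussian \<sigma> \<in> borel_measurable borel"
  unfolding gaussian_def[abs_def] by measurable

lemma borel_measurable_gaussian_density [measurable]:
  "gaussian_density \<sigma> \<in> borel_measurable borel"
  unfolding gaussian_density_def[abs_def] by measurable

lemma gaussian_nonneg [simp]: "0 \<le> gaussian \<sigma> \<omega>"
  unfolding gaussian_def by (intro prod_nonneg) auto

lemma gaussian_le_1: "gaussian \<sigma> \<omega> \<le> 1"
  unfolding gaussian_def by (intro prod_le_1) auto

lemma gaussian_density_nonneg [simp]: "0 \<le> gaussian_density \<sigma> x"
  unfolding gaussian_density_def by (intro prod_nonneg) auto

lemma gaussian_tendsto_1: "(\<lambda>n. gaussian (1 / real (Suc n)) \<omega>) \<longlonglongrightarrow> 1"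
proof -
  have "(\<lambda>n. 1 / real (Suc n)) \<longlonglongrightarrow> 0"
    using LIMSEQ_inverse_real_of_nat by (simp add: inverse_eq_divide)
  then have "(\<lambda>n. gaussian (1 / real (Suc n)) \<omega>)
      \<longlonglongrightarrow> (\<Prod>b\<in>(Basis::'a set). exp (- 2 * pi\<^sup>2 * 0\<^sup>2 * (\<omega> \<bullet> b)\<^sup>2))"
    unfolding gaussian_def by (intro tendsto_intros)
  then show ?thesis by simp
qed

text \<open>This is the characteristic function of the standard normal distribution at -s/\<sigma>,
  after the substitution x = 2 \<pi> \<sigma> \<omega>.\<close>

lemma
  assumes "0 < \<sigma>"
  shows integrable_gaussian_1D: "integrable lborel (\<lambda>\<omega>::real. exp (- 2 * pi\<^sup>2 * \<sigma>\<^sup>2 * \<omega>\<^sup>2))"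
    and fourier_gaussian_1D:
      "(\<integral>\<omega>. complex_of_real (exp (- 2 * pi\<^sup>2 * \<sigma>\<^sup>2 * \<omega>\<^sup>2)) * cis (- 2 * pi * (\<omega> * s)) \<partial>lborel)
        = normal_density 0 \<sigma> s"
proof -
  let ?w = "\<lambda>\<omega>. cis (- 2 * pi * (\<omega> * s))"
  let ?e = "\<lambda>\<omega>. exp (- 2 * pi\<^sup>2 * \<sigma>\<^sup>2 * \<omega>\<^sup>2) :: real"
  let ?c = "2 * pi * \<sigma>"
  have c: "?c \<noteq> 0" using assms by simp
  have std: "std_normal_density (?c * \<omega>) = 1 / sqrt (2 * pi) * ?e \<omega>" for \<omega>
    by (simp add: std_normal_density_def power_mult_distrib mult_ac)
  have "integrable lborel (\<lambda>\<omega>. sqrt (2 * pi) * std_normal_density (0 + ?c * \<omega>))"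
    by (intro integrable_mult_right lborel_integrable_real_affine c integrable_normal_density) auto
  then show "integrable lborel (\<lambda>\<omega>::real. ?e \<omega>)"
    by (simp add: std)
  have "exp (- ((- s / \<sigma>)\<^sup>2) / 2) = char std_normal_distribution (- s / \<sigma>)"
    by (simp add: char_std_normal_distribution)
  also have "\<dots> = (\<integral>x. std_normal_density x *\<^sub>R iexp (- s / \<sigma> * x) \<partial>lborel)"
    unfolding char_def by (subst integral_density) auto
  also have "\<dots> = ?c *\<^sub>R (\<integral>\<omega>. std_normal_density (?c * \<omega>) *\<^sub>R iexp (- s / \<sigma> * (?c * \<omega>)) \<partial>lborel)"
    using lborel_integral_real_affine[OF c, of "\<lambda>x. std_normal_density x *\<^sub>R iexp (- s / \<sigma> * x)" 0] assms
    by simp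
  also have "(\<lambda>\<omega>. std_normal_density (?c * \<omega>) *\<^sub>R iexp (- s / \<sigma> * (?c * \<omega>)))
    = (\<lambda>\<omega>. complex_of_real (1 / sqrt (2 * pi)) *
        (complex_of_real (?e \<omega>) * ?w \<omega>))"
  proof
    fix \<omega>
    have e: "- s / \<sigma> * (?c * \<omega>) = - 2 * pi * (\<omega> * s)" using assms by simp
    have E: "iexp (- s / \<sigma> * (?c * \<omega>)) = ?w \<omega>"
      unfolding cis_conv_exp by (simp only: e)
    show "std_normal_density (?c * \<omega>) *\<^sub>R iexp (- s / \<sigma> * (?c * \<omega>)) = complex_of_real (1 / sqrt (2 * pi)) *
        (complex_of_real (?e \<omega>) * ?w \<omega>)"
      unfolding std E scaleR_conv_of_real unfolding of_real_mult by (rule mult.assoc)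
  qed
  finally have *: "complex_of_real (exp (- ((- s / \<sigma>)\<^sup>2) / 2)) = complex_of_real (?c / sqrt (2 * pi)) *
      (\<integral>\<omega>. complex_of_real (?e \<omega>) * ?w \<omega> \<partial>lborel)"
    by (simp add: scaleR_conv_of_real)
  have "normal_density 0 \<sigma> s = sqrt (2 * pi) / ?c * exp (- ((- s / \<sigma>)\<^sup>2) / 2)"
  proof -
    have "sqrt (2 * pi * \<sigma>\<^sup>2) = sqrt (2 * pi) * \<sigma>"
      using assms by (simp add: real_sqrt_mult)
    moreover have "sqrt (2 * pi) / ?c = 1 / (sqrt (2 * pi) * \<sigma>)"
      using assms by (simp add: field_simps flip: power2_eq_square)
    ultimately show ?thesis
      by (simp add: normal_density_def power_divide mult.commute)
  qed
  then have "complex_of_real (normal_density 0 \<sigma> s)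
      = complex_of_real (sqrt (2 * pi) / ?c) * complex_of_real (exp (- ((- s / \<sigma>)\<^sup>2) / 2))"
    by simp
  also have "\<dots> = (\<integral>\<omega>. complex_of_real (?e \<omega>) * ?w \<omega> \<partial>lborel)"
    unfolding * using assms by simp
  finally show "(\<integral>\<omega>. complex_of_real (?e \<omega>) * ?w \<omega> \<partial>lborel)
        = normal_density 0 \<sigma> s" by simp
qed

lemma integrable_gaussian: "0 < \<sigma> \<Longrightarrow> integrable lborel (gaussian \<sigma>)"
  unfolding gaussian_def[abs_def] by (intro integrable_lborel_prod integrable_gaussian_1D)

lemma cis_sum: "finite A \<Longrightarrow> cis (\<Sum>b\<in>A. f b) = (\<Prod>b\<in>A. cis (f b))"
  by (induction A rule: finite_induct) (auto simp flip: cis_mult)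

lemma fourier_gaussian:
  fixes x :: "'a::euclidean_space"
  assumes \<sigma>: "0 < \<sigma>"
  shows "fourier (\<lambda>\<omega>. complex_of_real (gaussian \<sigma> \<omega>)) x = gaussian_density \<sigma> x"
proof -
  have "complex_of_real (gaussian \<sigma> \<omega>) * wave \<omega> x
    = (\<Prod>b\<in>Basis. complex_of_real (exp (- 2 * pi\<^sup>2 * \<sigma>\<^sup>2 * (\<omega> \<bullet> b)\<^sup>2)) * cis (- 2 * pi * ((\<omega> \<bullet> b) * (x \<bullet> b))))" for \<omega>
    unfolding prod.distrib gaussian_def cis_sum[OF finite_Basis, symmetric]
    by (simp add: euclidean_inner[of \<omega> x] sum_distrib_left)
  moreover have int: "integrable lborel (\<lambda>\<omega>. complex_of_real (exp (- 2 * pi\<^sup>2 * \<sigma>\<^sup>2 * \<omega>\<^sup>2)) * cis (- 2 * pi * (\<omega> * s)))" for s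
    by (rule integrable_mult_bounded[where B=1, OF integrable_of_real[OF integrable_gaussian_1D[OF \<sigma>]]]) auto
  ultimately have "fourier (\<lambda>\<omega>. complex_of_real (gaussian \<sigma> \<omega>)) x
    = (\<Prod>b\<in>Basis. (\<integral>\<omega>. complex_of_real (exp (- 2 * pi\<^sup>2 * \<sigma>\<^sup>2 * \<omega>\<^sup>2)) * cis (- 2 * pi * (\<omega> * (x \<bullet> b))) \<partial>lborel))"
    unfolding fourier_def by (simp only: integral_lborel_prod[OF int])
  also have "\<dots> = gaussian_density \<sigma> x"
    unfolding fourier_gaussian_1D[OF \<sigma>] gaussian_density_def by simp
  finally show ?thesis .
qed

lemma nn_integral_gaussian_density:
  "0 < \<sigma> \<Longrightarrow> (\<integral>\<^sup>+x. gaussian_density \<sigma> (x::'a::euclidean_space) \<partial>lborel) = 1"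
proof -
  assume \<sigma>: "0 < \<sigma>"
  have 1: "(\<integral>\<^sup>+x. ennreal (normal_density 0 \<sigma> x) \<partial>lborel) = 1"
    using prob_space.emeasure_space_1[OF prob_space_normal_density[OF \<sigma>, of 0]]
    by (simp add: emeasure_density)
  have "(\<integral>\<^sup>+x. gaussian_density \<sigma> (x::'a) \<partial>lborel)
      = (\<integral>\<^sup>+x. (\<Prod>b\<in>Basis. ennreal (normal_density 0 \<sigma> ((x::'a) \<bullet> b))) \<partial>lborel)"
    unfolding gaussian_density_def by (simp add: prod_ennreal)
  also have "\<dots> = (\<Prod>b\<in>(Basis::'a set). (\<integral>\<^sup>+x. ennreal (normal_density 0 \<sigma> x) \<partial>lborel))"
    by (rule nn_integral_lborel_prod) auto
  finally show ?thesis by (simp add: 1)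
qed

lemma fourier_modulated_gaussian:
  assumes \<sigma>: "0 < \<sigma>"
  shows "fourier (\<lambda>\<omega>. complex_of_real (gaussian \<sigma> \<omega>) * wave \<omega> x) y
    = gaussian_density \<sigma> (y + x)"
  unfolding fourier_gaussian[OF \<sigma>, symmetric] fourier_def
  by (simp add: cis_mult mult.assoc inner_add_right distrib_left add.commute)

subsection \<open>Bessel's inequality\<close>

text \<open>With the Gaussian, the integral becomes \<open>\<integral>\<integral> f(x) cnj (f(y)) N\<^sub>\<sigma>(x - y) dx dy\<close> for a
  probability density \<open>N\<^sub>\<sigma>\<close>, and \<open>|f(x) f(y)| \<le> (|f(x)|\<^sup>2 + |f(y)|\<^sup>2) / 2\<close>.\<close>

lemma gaussian_bessel:
  fixes f :: "'a::euclidean_space \<Rightarrow> complex"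
  assumes f: "integrable lborel f" and \<sigma>: "0 < \<sigma>"
  shows "(\<integral>\<^sup>+\<omega>. ennreal (gaussian \<sigma> \<omega> * (cmod (fourier f \<omega>))\<^sup>2) \<partial>lborel)
    \<le> (\<integral>\<^sup>+x. ennreal ((cmod (f x))\<^sup>2) \<partial>lborel)"
proof -
  have [measurable]: "f \<in> borel_measurable borel" using f by auto
  let ?N = "gaussian_density \<sigma> :: 'a \<Rightarrow> real"
  let ?T = "\<lambda>x z. ennreal ((cmod (f x))\<^sup>2 / 2) * ennreal (?N z)"
  let ?g = "\<lambda>\<omega>. gaussian \<sigma> \<omega> * (cmod (fourier f \<omega>))\<^sup>2"
  define B where "B = (\<integral>x. cmod (f x) \<partial>lborel)"
  \<comment> \<open>Chosen so that \<open>fourier f\<close> times m is the weighted square to be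
    integrated. The multiplication formula then moves the transform from f to m.\<close>
  define m where "m \<omega> = complex_of_real (gaussian \<sigma> \<omega>) * cnj (fourier f \<omega>)" for \<omega>
  have g: "integrable lborel (\<lambda>\<omega>::'a. complex_of_real (gaussian \<sigma> \<omega>))"
    by (intro integrable_of_real integrable_gaussian \<sigma>)
  have m: "integrable lborel m"
    unfolding m_def by (rule integrable_mult_bounded[where B=B, OF g]) (auto simp: B_def norm_fourier_le)
  have f': "integrable lborel (\<lambda>y. cnj (f (- y)))"
    using integrable_lborel_isometry[OF integrable_cnj[OF f], of "-1" 0] by simp
  \<comment> \<open>Rewriting the conjugate as a Fourier transform lets the multiplication formula
    be used again, to compute the transform of m as a Gaussian average.\<close>
  have cnj_fourier: "cnj (fourier f \<omega>) = fourier (\<lambda>y. cnj (f (- y))) \<omega>" for \<omega>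
  proof -
    have "cnj (fourier f \<omega>) = (\<integral>x. cnj (f x * wave x \<omega>) \<partial>lborel)"
      unfolding fourier_def by (rule Bochner_Integration.integral_cnj[symmetric])
    also have "\<dots> = inv_fourier (\<lambda>y. cnj (f y)) \<omega>"
      unfolding inv_fourier_def by (simp add: cis_cnj inner_commute del: Bochner_Integration.integral_cnj)
    finally show ?thesis by (simp add: inv_fourier_reflect)
  qed
  have Fm: "fourier m x = (\<integral>y. cnj (f (- y)) * ?N (y + x) \<partial>lborel)" for x
  proof -
    have "fourier m x = (\<integral>\<omega>. fourier (\<lambda>y. cnj (f (- y))) \<omega> *
        (complex_of_real (gaussian \<sigma> \<omega>) * wave \<omega> x) \<partial>lborel)"
      unfolding fourier_def[of m] m_def cnj_fourier by (simp add: mult_ac)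
    also have "\<dots> = (\<integral>y. cnj (f (- y)) * fourier (\<lambda>\<omega>. complex_of_real (gaussian \<sigma> \<omega>) * wave \<omega> x) y \<partial>lborel)"
      by (intro fourier_multiplication_formula f' integrable_fourier_integrand g)
    finally show ?thesis unfolding fourier_modulated_gaussian[OF \<sigma>] .
  qed
  have Fm_le: "ennreal (cmod (fourier m x)) \<le> (\<integral>\<^sup>+y. ennreal (cmod (f y) * ?N (x - y)) \<partial>lborel)" for x
  proof -
    have "ennreal (cmod (fourier m x)) \<le> (\<integral>\<^sup>+y. norm (cnj (f (- y)) * ?N (y + x)) \<partial>lborel)"
      unfolding Fm by (rule norm_integral_le_nn_integral)
    also have "\<dots> = (\<integral>\<^sup>+y. ennreal (cmod (f y) * ?N (x - y)) \<partial>lborel)"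
      using nn_integral_lborel_isometry[of "\<lambda>y. ennreal (cmod (f y) * ?N (x - y))" "-1" 0]
      by (simp add: norm_mult add.commute)
    finally show ?thesis .
  qed
  have "(\<integral>\<omega>. complex_of_real (?g \<omega>) \<partial>lborel) = (\<integral>\<omega>. fourier f \<omega> * m \<omega> \<partial>lborel)"
    unfolding m_def of_real_mult complex_norm_square by (simp add: mult_ac)
  also have "\<dots> = (\<integral>x. f x * fourier m x \<partial>lborel)"
    by (rule fourier_multiplication_formula[OF f m])
  finally have eq: "(\<integral>\<omega>. complex_of_real (?g \<omega>) \<partial>lborel) = (\<integral>x. f x * fourier m x \<partial>lborel)" .
  have N1: "(\<integral>\<^sup>+y. ennreal (?N (x - y)) \<partial>lborel) = 1" "(\<integral>\<^sup>+y. ennreal (?N (y - x)) \<partial>lborel) = 1" for x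
    using nn_integral_lborel_isometry[of "\<lambda>y. ennreal (?N y)" "-1" x]
      nn_integral_lborel_isometry[of "\<lambda>y. ennreal (?N y)" 1 "-x"] nn_integral_gaussian_density[OF \<sigma>, where 'a='a]
    by simp_all
  have int: "integrable lborel (\<lambda>\<omega>. ?g \<omega>)"
  proof (rule Bochner_Integration.integrable_bound[OF integrable_mult_right[OF integrable_gaussian[OF \<sigma>], of "B\<^sup>2"]])
    have "(cmod (fourier f \<omega>))\<^sup>2 \<le> B\<^sup>2" for \<omega>
      unfolding B_def by (intro power_mono norm_fourier_le) auto
    then show "AE \<omega> in lborel. norm (?g \<omega>) \<le> norm (B\<^sup>2 * gaussian \<sigma> \<omega>)"
      by (intro AE_I2) (auto simp: abs_mult mult.commute intro: mult_left_mono)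
  qed measurable
  have "(\<integral>\<^sup>+\<omega>. ennreal (?g \<omega>) \<partial>lborel)
    = ennreal (\<integral>\<omega>. ?g \<omega> \<partial>lborel)"
    by (rule nn_integral_eq_integral[OF int]) auto
  also have "\<dots> \<le> ennreal (cmod (\<integral>x. f x * fourier m x \<partial>lborel))"
    unfolding eq[symmetric] by (subst integral_of_real) (auto intro: ennreal_leI int)
  also have "\<dots> \<le> (\<integral>\<^sup>+x. ennreal (cmod (f x * fourier m x)) \<partial>lborel)"
    by (rule norm_integral_le_nn_integral)
  also have "\<dots> \<le> (\<integral>\<^sup>+x. ennreal (cmod (f x)) * (\<integral>\<^sup>+y. ennreal (cmod (f y) * ?N (x - y)) \<partial>lborel) \<partial>lborel)"
    unfolding norm_mult ennreal_mult[OF norm_ge_zero norm_ge_zero]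
    by (intro nn_integral_mono mult_left_mono Fm_le) auto
  also have "\<dots> = (\<integral>\<^sup>+x. (\<integral>\<^sup>+y. ennreal (cmod (f x)) * ennreal (cmod (f y) * ?N (x - y)) \<partial>lborel) \<partial>lborel)"
    by (intro nn_integral_cong nn_integral_cmult[symmetric]) measurable
  also have "\<dots> \<le> (\<integral>\<^sup>+x. (\<integral>\<^sup>+y. ?T x (x - y)
      + ?T y (x - y) \<partial>lborel) \<partial>lborel)"
  proof (intro nn_integral_mono)
    fix x y
    have "cmod (f x) * cmod (f y) * ?N (x - y) \<le> ((cmod (f x))\<^sup>2 / 2 + (cmod (f y))\<^sup>2 / 2) * ?N (x - y)"
      using sum_squares_bound[of "cmod (f x)" "cmod (f y)"] by (intro mult_right_mono) auto
    then show "ennreal (cmod (f x)) * ennreal (cmod (f y) * ?N (x - y))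
      \<le> ?T x (x - y) + ?T y (x - y)"
      by (simp add: distrib_right mult.assoc ennreal_leI flip: ennreal_mult ennreal_plus)
  qed
  also have "\<dots> = (\<integral>\<^sup>+x. (\<integral>\<^sup>+y. ?T x (x - y) \<partial>lborel) \<partial>lborel)
      + (\<integral>\<^sup>+x. (\<integral>\<^sup>+y. ?T y (x - y) \<partial>lborel) \<partial>lborel)"
    by (simp add: nn_integral_add)
  also have "(\<integral>\<^sup>+x. (\<integral>\<^sup>+y. ?T y (x - y) \<partial>lborel) \<partial>lborel)
      = (\<integral>\<^sup>+y. (\<integral>\<^sup>+x. ?T y (x - y) \<partial>lborel) \<partial>lborel)"
    by (rule lborel_pair.Fubini') measurable
  also have "(\<integral>\<^sup>+x. (\<integral>\<^sup>+y. ?T x (x - y) \<partial>lborel) \<partial>lborel)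
      + (\<integral>\<^sup>+y. (\<integral>\<^sup>+x. ?T y (x - y) \<partial>lborel) \<partial>lborel)
      = (\<integral>\<^sup>+x. ennreal ((cmod (f x))\<^sup>2 / 2) \<partial>lborel) + (\<integral>\<^sup>+x. ennreal ((cmod (f x))\<^sup>2 / 2) \<partial>lborel)"
    by (simp add: nn_integral_cmult N1)
  also have "\<dots> = (\<integral>\<^sup>+x. ennreal ((cmod (f x))\<^sup>2) \<partial>lborel)"
    by (subst nn_integral_add[symmetric]) (auto simp flip: ennreal_plus)
  finally show ?thesis .
qed

text \<open>The Gaussian factor tends to 1 as \<sigma> = 1/(n+1) tends to 0, and Fatou's lemma
  removes it. Integrability of f makes the transform a genuine integral; the right-hand side may be
  infinite.\<close>

lemma bessel:
  fixes f :: "'a::euclidean_space \<Rightarrow> complex"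
  assumes f: "integrable lborel f"
  shows "(\<integral>\<^sup>+\<omega>. ennreal ((cmod (fourier f \<omega>))\<^sup>2) \<partial>lborel) \<le> (\<integral>\<^sup>+x. ennreal ((cmod (f x))\<^sup>2) \<partial>lborel)"
proof (rule nn_integral_le_limit)
  have [measurable]: "f \<in> borel_measurable borel" using f by auto
  show "(\<lambda>\<omega>. ennreal (gaussian (1 / real (Suc n)) \<omega> * (cmod (fourier f \<omega>))\<^sup>2)) \<in> borel_measurable lborel" for n
    by measurable
  have "(\<lambda>n. gaussian (1 / real (Suc n)) \<omega> * (cmod (fourier f \<omega>))\<^sup>2) \<longlonglongrightarrow> 1 * (cmod (fourier f \<omega>))\<^sup>2" for \<omega>
    by (intro tendsto_intros gaussian_tendsto_1)
  then show "(\<lambda>n. ennreal (gaussian (1 / real (Suc n)) \<omega> * (cmod (fourier f \<omega>))\<^sup>2))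
      \<longlonglongrightarrow> ennreal ((cmod (fourier f \<omega>))\<^sup>2)" for \<omega>
    by (intro tendsto_ennrealI) simp
  show "(\<integral>\<^sup>+\<omega>. ennreal (gaussian (1 / real (Suc n)) \<omega> * (cmod (fourier f \<omega>))\<^sup>2) \<partial>lborel)
      \<le> (\<integral>\<^sup>+x. ennreal ((cmod (f x))\<^sup>2) \<partial>lborel)" for n
    by (rule gaussian_bessel[OF f]) simp
qed

subsection \<open>The Fourier transform on Schwartz functions\<close>

lemma integrable_bound_weight:
  fixes f :: "'a::euclidean_space \<Rightarrow> 'b::{banach,second_countable_topology}"
  assumes "f \<in> borel_measurable borel" and "\<And>x. norm (f x) \<le> C * weight x"
  shows "integrable lborel f"
  using assms
  by (intro Bochner_Integration.integrable_bound[OF integrable_mult_right[OF integrable_weight, of C]] AE_I2)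
     (simp_all add: order_trans[OF _ abs_ge_self])

lemma schwartz_moment_integrable:
  fixes f :: "'a::euclidean_space \<Rightarrow> complex"
  assumes f: "f \<in> schwartz"
  shows "integrable lborel (\<lambda>x. norm x ^ k * cmod (f x))"
proof -
  note [measurable] = schwartz_measurable[OF f]
  obtain C where C: "\<And>x. (1 + norm x) ^ (2 * DIM('a) + k) * cmod (f x) \<le> C"
    using schwartz_decay[OF f] by blast
  have "norm x ^ k * cmod (f x) \<le> C * weight x" for x
  proof (rule le_weightI)
    have "(1 + norm x) ^ (2 * DIM('a)) * (norm x ^ k * cmod (f x))
        \<le> (1 + norm x) ^ (2 * DIM('a)) * ((1 + norm x) ^ k * cmod (f x))"
      by (intro mult_left_mono mult_right_mono power_mono) auto
    also have "\<dots> = (1 + norm x) ^ (2 * DIM('a) + k) * cmod (f x)"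
      by (simp add: power_add)
    finally show "(1 + norm x) ^ (2 * DIM('a)) * (norm x ^ k * cmod (f x)) \<le> C"
      using C[of x] by linarith
  qed auto
  then show ?thesis by (intro integrable_bound_weight) auto
qed

text \<open>The first-order Taylor remainder of the exponential, which bounds the error of
  differentiating under the integral sign by a second moment.\<close>

lemma norm_cis_diff_le: "cmod (cis (a + h) - cis a - \<i> * h * cis a) \<le> h\<^sup>2 / 2"
proof -
  have "cis (a + h) - cis a - \<i> * h * cis a = cis a * (cis h - (\<Sum>k\<le>1. (\<i> * h) ^ k / fact k))"
    by (simp add: cis_mult[symmetric] algebra_simps)
  then have "cmod (cis (a + h) - cis a - \<i> * h * cis a) = cmod (iexp h - (\<Sum>k\<le>1. (\<i> * h) ^ k / fact k))"
    by (simp add: norm_mult cis_conv_exp)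
  also have "\<dots> \<le> \<bar>h\<bar> ^ Suc 1 / fact (Suc 1)"
    by (rule iexp_approx1)
  finally show ?thesis by (simp add: power2_eq_square)
qed

text \<open>Differentiation under the integral with an explicit remainder: the error of the linear
  approximation is at most \<open>K2\<close> |h|^2, where \<open>K2\<close> is a multiple of the
  second moment of f. The first moment in \<open>K1\<close> bounds the derivative as a linear
  map.\<close>

lemma fourier_has_derivative:
  fixes f :: "'a::euclidean_space \<Rightarrow> complex"
  assumes f: "f \<in> schwartz"
  shows "(fourier f has_derivative (\<lambda>h. fourier (\<lambda>x. - 2 * pi * \<i> * (x \<bullet> h) * f x) \<omega>)) (at \<omega>)"
proof -
  let ?D = "\<lambda>h. fourier (\<lambda>x. - 2 * pi * \<i> * (x \<bullet> h) * f x) \<omega>"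
  note [measurable] = schwartz_measurable[OF f]
  define K1 where "K1 = 2 * pi * (\<integral>x. norm x ^ 1 * cmod (f x) \<partial>lborel)"
  define K2 where "K2 = 2 * pi\<^sup>2 * (\<integral>x. norm x ^ 2 * cmod (f x) \<partial>lborel)"
  have bound: "cmod (- 2 * pi * \<i> * (x \<bullet> h) * f x) \<le> norm h * (2 * pi * (norm x ^ 1 * cmod (f x)))" for x h
  proof -
    have "cmod (- 2 * pi * \<i> * (x \<bullet> h) * f x) = 2 * pi * cmod (f x) * \<bar>x \<bullet> h\<bar>"
      by (simp add: norm_mult)
    also have "\<dots> \<le> 2 * pi * cmod (f x) * (norm x * norm h)"
      by (intro mult_left_mono Cauchy_Schwarz_ineq2) auto
    finally show ?thesis by (simp add: mult_ac)
  qed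
  have i1: "integrable lborel (\<lambda>x. norm h * (2 * pi * (norm x ^ 1 * cmod (f x))))" for h :: 'a
    by (intro integrable_mult_right schwartz_moment_integrable f)
  have int: "integrable lborel (\<lambda>x. - 2 * pi * \<i> * (x \<bullet> h) * f x)" for h
  proof (rule Bochner_Integration.integrable_bound[OF i1[of h]])
    show "AE x in lborel. norm (- 2 * pi * \<i> * (x \<bullet> h) * f x) \<le> norm (norm h * (2 * pi * (norm x ^ 1 * cmod (f x))))"
      unfolding real_norm_def by (intro AE_I2 order_trans[OF bound abs_ge_self])
  qed measurable
  have lin: "bounded_linear ?D"
  proof (rule bounded_linear_intro)
    show "?D (h1 + h2) = ?D h1 + ?D h2" for h1 h2
    proof -
      let ?A = "\<lambda>h x. - 2 * pi * \<i> * (x \<bullet> h) * f x * wave x \<omega>"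
      have "?D (h1 + h2) = (\<integral>x. ?A h1 x + ?A h2 x \<partial>lborel)"
        unfolding fourier_def by (rule Bochner_Integration.integral_cong[OF refl]) (simp add: inner_add_right ring_distribs)
      also have "\<dots> = ?D h1 + ?D h2"
        unfolding fourier_def by (intro Bochner_Integration.integral_add integrable_fourier_integrand int)
      finally show ?thesis .
    qed
    show "?D (r *\<^sub>R h) = r *\<^sub>R ?D h" for r h
      unfolding fourier_def scaleR_conv_of_real
      by (subst integral_mult_right_zero[symmetric])
         (auto intro!: Bochner_Integration.integral_cong simp: algebra_simps)
    show "norm (?D h) \<le> norm h * K1" for h
    proof -
      have "norm (?D h) \<le> (\<integral>x. cmod (- 2 * pi * \<i> * (x \<bullet> h) * f x) \<partial>lborel)"
        by (rule norm_fourier_le)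
      also have "\<dots> \<le> (\<integral>x. norm h * (2 * pi * (norm x ^ 1 * cmod (f x))) \<partial>lborel)"
        by (intro integral_mono integrable_norm int i1 bound)
      also have "\<dots> = norm h * K1" by (simp add: K1_def)
      finally show ?thesis .
    qed
  qed
  have est: "norm (fourier f (\<omega> + h) - fourier f \<omega> - ?D h) \<le> K2 * (norm h)\<^sup>2" for h
  proof -
    define e where "e x = f x * wave x (\<omega> + h) - f x * wave x \<omega>
        - - 2 * pi * \<i> * (x \<bullet> h) * f x * wave x \<omega>" for x
    note ints = integrable_fourier_integrand[OF schwartz_integrable[OF f]] integrable_fourier_integrand[OF int]
    have int_e: "integrable lborel e"
      unfolding e_def[abs_def] by (intro Bochner_Integration.integrable_diff ints)
    have eq: "fourier f (\<omega> + h) - fourier f \<omega> - ?D h = (\<integral>x. e x \<partial>lborel)"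
      unfolding e_def fourier_def
      by (simp only: Bochner_Integration.integral_diff Bochner_Integration.integrable_diff ints)
    have le: "cmod (e x) \<le> (norm h)\<^sup>2 * (2 * pi\<^sup>2 * (norm x ^ 2 * cmod (f x)))" for x
    proof -
      define a t where "a = - 2 * pi * (x \<bullet> \<omega>)" and "t = - 2 * pi * (x \<bullet> h)"
      have at: "- 2 * pi * (x \<bullet> (\<omega> + h)) = a + t"
        by (simp add: a_def t_def inner_add_right algebra_simps)
      have "e x = f x * (cis (a + t) - cis a - \<i> * t * cis a)"
        unfolding e_def at a_def[symmetric] by (simp add: t_def algebra_simps)
      then have "cmod (e x) = cmod (f x) * cmod (cis (a + t) - cis a - \<i> * t * cis a)"
        by (simp only: norm_mult)
      then have "cmod (e x) \<le> cmod (f x) * (t\<^sup>2 / 2)"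
        using mult_left_mono[OF norm_cis_diff_le norm_ge_zero] by metis
      moreover have "t\<^sup>2 \<le> (2 * pi * (norm x * norm h))\<^sup>2"
        unfolding abs_le_square_iff[symmetric] t_def
        using Cauchy_Schwarz_ineq2[of x h] by (simp add: abs_mult)
      then have "cmod (f x) * (t\<^sup>2 / 2) \<le> cmod (f x) * ((2 * pi * (norm x * norm h))\<^sup>2 / 2)"
        by (intro mult_left_mono) simp_all
      ultimately show ?thesis
        by (simp add: power_mult_distrib mult_ac)
    qed
    have "cmod (\<integral>x. e x \<partial>lborel) \<le> (\<integral>x. cmod (e x) \<partial>lborel)"
      by (rule integral_norm_bound)
    moreover have "(\<integral>x. cmod (e x) \<partial>lborel) \<le> (\<integral>x. (norm h)\<^sup>2 * (2 * pi\<^sup>2 * (norm x ^ 2 * cmod (f x))) \<partial>lborel)"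
      by (rule integral_mono[OF integrable_norm[OF int_e] _ le])
         (intro integrable_mult_right schwartz_moment_integrable f)
    moreover have "(\<integral>x. (norm h)\<^sup>2 * (2 * pi\<^sup>2 * (norm x ^ 2 * cmod (f x))) \<partial>lborel) = K2 * (norm h)\<^sup>2"
      by (simp add: K2_def)
    ultimately show ?thesis
      unfolding eq by linarith
  qed
  show ?thesis
    unfolding has_derivative_iff_norm
  proof (intro conjI lin)
    show "((\<lambda>y. norm (fourier f y - fourier f \<omega> - ?D (y - \<omega>)) / norm (y - \<omega>)) \<longlongrightarrow> 0) (at \<omega>)"
    proof (rule tendsto_sandwich[OF _ _ tendsto_const])
      show "\<forall>\<^sub>F y in at \<omega>. norm (fourier f y - fourier f \<omega> - ?D (y - \<omega>)) / norm (y - \<omega>) \<le> K2 * norm (y - \<omega>)"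
      proof (intro always_eventually allI)
        fix y
        show "norm (fourier f y - fourier f \<omega> - ?D (y - \<omega>)) / norm (y - \<omega>) \<le> K2 * norm (y - \<omega>)"
          using est[of "y - \<omega>"] by (cases "y = \<omega>") (simp_all add: divide_simps power2_eq_square mult.assoc)
      qed
      have "((\<lambda>y. K2 * norm (y - \<omega>)) \<longlongrightarrow> K2 * norm (\<omega> - \<omega>)) (at \<omega>)"
        by (intro tendsto_intros)
      then show "((\<lambda>y. K2 * norm (y - \<omega>)) \<longlongrightarrow> 0) (at \<omega>)" by simp
    qed auto
  qed
qed

lemma has_derivative_quotient_tendsto:
  fixes f :: "'a::real_normed_vector \<Rightarrow> complex"
  assumes f: "(f has_derivative D) (at x)" and b: "b \<noteq> 0"
  shows "(\<lambda>n. (f (x + (1 / real (Suc n)) *\<^sub>R b) - f x) * real (Suc n)) \<longlonglongrightarrow> D b"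
proof -
  interpret D: bounded_linear D using f by (rule has_derivative_bounded_linear)
  let ?t = "\<lambda>n. 1 / real (Suc n)"
  let ?y = "\<lambda>n. x + ?t n *\<^sub>R b"
  have t: "?t \<longlonglongrightarrow> 0"
    using LIMSEQ_inverse_real_of_nat by (simp add: inverse_eq_divide)
  have "filterlim ?y (at x) sequentially"
  proof (rule filterlim_atI)
    have "?y \<longlonglongrightarrow> x + 0 *\<^sub>R b" by (intro tendsto_intros t)
    then show "?y \<longlonglongrightarrow> x" by simp
  qed (use b in auto)
  moreover have "((\<lambda>y. norm (f y - f x - D (y - x)) / norm (y - x)) \<longlongrightarrow> 0) (at x)"
    using f unfolding has_derivative_iff_norm by simp
  ultimately have "(\<lambda>n. norm (f (?y n) - f x - D (?y n - x)) / norm (?y n - x)) \<longlonglongrightarrow> 0"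
    by (rule filterlim_compose[rotated])
  then have "(\<lambda>n. norm b * (norm (f (?y n) - f x - D (?y n - x)) / norm (?y n - x))) \<longlonglongrightarrow> norm b * 0"
    by (intro tendsto_intros)
  moreover have "norm b * (norm (f (?y n) - f x - D (?y n - x)) / norm (?y n - x))
      = norm ((f (?y n) - f x) * real (Suc n) - D b)" for n
  proof -
    have "(f (?y n) - f x) * real (Suc n) - D b = of_real (real (Suc n)) * (f (?y n) - f x - D (?y n - x))"
      by (simp add: D.scaleR scaleR_conv_of_real algebra_simps del: of_nat_Suc)
    moreover have "norm (?y n - x) = norm b / real (Suc n)"
      by (simp del: of_nat_Suc)
    ultimately show ?thesis
      using b by (simp add: norm_mult del: of_nat_Suc)
  qed
  ultimately have "(\<lambda>n. norm ((f (?y n) - f x) * real (Suc n) - D b)) \<longlonglongrightarrow> 0" by simp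
  then show ?thesis using LIM_zero_cancel tendsto_norm_zero_iff by blast
qed

text \<open>The mean value inequality restricted to a segment. A bound on the segment alone is
  required, so that a derivative decaying at infinity gives a bound that decays in x.\<close>

lemma norm_line_diff_le:
  fixes f :: "'a::real_normed_vector \<Rightarrow> complex"
  assumes f: "\<And>y. (f has_derivative D y) (at y)" and t: "0 \<le> t"
    and B: "\<And>s. 0 \<le> s \<Longrightarrow> s \<le> t \<Longrightarrow> cmod (D (x + s *\<^sub>R b) b) \<le> B"
  shows "cmod (f (x + t *\<^sub>R b) - f x) \<le> B * t"
proof -
  have "norm (f (x + t *\<^sub>R b) - f (x + 0 *\<^sub>R b)) \<le> B * norm (t - 0)"
  proof (rule differentiable_bound[of "{0..t}" "\<lambda>s. f (x + s *\<^sub>R b)" "\<lambda>s h. h *\<^sub>R D (x + s *\<^sub>R b) b"])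
    fix s assume s: "s \<in> {0..t}"
    have "((\<lambda>s. f (x + s *\<^sub>R b)) has_derivative (\<lambda>h. D (x + s *\<^sub>R b) (h *\<^sub>R b))) (at s within {0..t})"
      by (rule has_derivative_compose[OF _ f]) (auto intro!: derivative_eq_intros)
    moreover have "D (x + s *\<^sub>R b) (h *\<^sub>R b) = h *\<^sub>R D (x + s *\<^sub>R b) b" for h
      using f[THEN has_derivative_bounded_linear, THEN bounded_linear.linear] by (rule linear_scale)
    ultimately show "((\<lambda>s. f (x + s *\<^sub>R b)) has_derivative (\<lambda>h. h *\<^sub>R D (x + s *\<^sub>R b) b)) (at s within {0..t})"
      by simp
    show "onorm (\<lambda>h. h *\<^sub>R D (x + s *\<^sub>R b) b) \<le> B"
      using B[of s] s by (intro onorm_le) (auto simp: mult.commute[of B] intro: mult_left_mono)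
  qed (use t in auto)
  then show ?thesis using t by simp
qed

text \<open>Difference quotients replace integration by parts. A translation of f multiplies its
  transform by a character, and dominated convergence identifies the limits of the two
  sides.\<close>

lemma fourier_dir_deriv:
  fixes f :: "'a::euclidean_space \<Rightarrow> complex"
  assumes f: "f \<in> schwartz" and b: "b \<in> Basis"
  shows "fourier (dir_deriv b f) \<omega> = 2 * pi * \<i> * (b \<bullet> \<omega>) * fourier f \<omega>"
proof -
  note [measurable] = schwartz_measurable[OF f]
  have f': "dir_deriv b f \<in> schwartz" by (rule schwartz_dir_deriv[OF f b])
  have [measurable]: "dir_deriv b f \<in> borel_measurable borel" by (rule schwartz_measurable[OF f'])
  have "b \<noteq> 0" using b by auto
  let ?t = "\<lambda>n. 1 / real (Suc n)"
  let ?c = "\<lambda>n. (cis (0 + ?t n *\<^sub>R (2 * pi * (b \<bullet> \<omega>))) - cis 0) * real (Suc n)"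
  let ?q = "\<lambda>n x. (f (x + ?t n *\<^sub>R b) - f x) * real (Suc n)"
  have d: "(f has_derivative frechet_derivative f (at x)) (at x)" for x
    by (rule differentiable_has_derivative[OF schwartz_differentiable[OF f]])
  have q_lim: "(\<lambda>n. ?q n x) \<longlonglongrightarrow> dir_deriv b f x" for x
    unfolding dir_deriv_def by (rule has_derivative_quotient_tendsto[OF d \<open>b \<noteq> 0\<close>])
  obtain C where C: "\<And>x. (1 + norm x) ^ (2 * DIM('a)) * cmod (dir_deriv b f x) \<le> C"
    using schwartz_decay[OF f'] by blast
  \<comment> \<open>On the segment from x to x + b the norm changes by at most 1, so 1 + |x| is at
    most 2 (1 + |y|). This gives the factor 2^(2d) in a majorant common to all difference
    quotients.\<close>
  let ?w = "\<lambda>x. (2 ^ (2 * DIM('a)) * C) * weight x"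
  have q_bound: "cmod (?q n x) \<le> ?w x" for n x
  proof -
    have "cmod (f (x + ?t n *\<^sub>R b) - f x) \<le> ?w x * ?t n"
    proof (rule norm_line_diff_le[OF d])
      fix s :: real assume s: "0 \<le> s" "s \<le> ?t n"
      then have "s \<le> 1" by (auto elim: order_trans)
      let ?y = "x + s *\<^sub>R b"
      have "norm x \<le> norm ?y + 1"
        using norm_triangle_ineq4[of ?y "s *\<^sub>R b"] s \<open>s \<le> 1\<close> b by simp
      then have "(1 + norm x) ^ (2 * DIM('a)) \<le> (1 + norm ?y) ^ (2 * DIM('a)) * (1 + 1) ^ (2 * DIM('a))"
        by (intro power_one_plus_le) auto
      then have "(1 + norm x) ^ (2 * DIM('a)) * cmod (dir_deriv b f ?y)
          \<le> (1 + norm ?y) ^ (2 * DIM('a)) * (1 + 1) ^ (2 * DIM('a)) * cmod (dir_deriv b f ?y)"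
        by (rule mult_right_mono) auto
      also have "\<dots> = 2 ^ (2 * DIM('a)) * ((1 + norm ?y) ^ (2 * DIM('a)) * cmod (dir_deriv b f ?y))"
        by simp
      also have "\<dots> \<le> 2 ^ (2 * DIM('a)) * C"
        by (intro mult_left_mono C) auto
      finally show "cmod (frechet_derivative f (at ?y) b) \<le> ?w x"
        unfolding dir_deriv_def[symmetric] by (intro le_weightI) (auto simp: dir_deriv_def)
    qed simp
    moreover have "cmod (?q n x) = cmod (f (x + ?t n *\<^sub>R b) - f x) * real (Suc n)"
      by (simp add: norm_mult del: of_nat_Suc)
    ultimately show ?thesis
      by (simp add: field_simps del: of_nat_Suc)
  qed
  have int: "integrable lborel (\<lambda>x. f (x + a))" for a
    using integrable_lborel_isometry[OF schwartz_integrable[OF f], of 1 a] by (simp add: add.commute)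
  have shift: "fourier (\<lambda>x. f (x + a)) \<omega> = cis (2 * pi * (a \<bullet> \<omega>)) * fourier f \<omega>" for a
  proof -
    have "fourier (\<lambda>x. f (x + a)) \<omega> = (\<integral>x. f x * wave (x - a) \<omega> \<partial>lborel)"
      using integral_lborel_isometry[of "\<lambda>x. f x * wave (x - a) \<omega>" 1 a]
      by (simp add: fourier_def add.commute)
    also have "\<dots> = (\<integral>x. cis (2 * pi * (a \<bullet> \<omega>)) * (f x * wave x \<omega>) \<partial>lborel)"
    proof (rule Bochner_Integration.integral_cong[OF refl])
      fix x
      have "wave (x - a) \<omega> = cis (2 * pi * (a \<bullet> \<omega>)) * wave x \<omega>"
        by (simp add: cis_mult inner_diff_left algebra_simps)
      then show "f x * wave (x - a) \<omega> = cis (2 * pi * (a \<bullet> \<omega>)) * (f x * wave x \<omega>)"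
        by simp
    qed
    finally show ?thesis by (simp add: fourier_def)
  qed
  have q_fourier: "(\<integral>x. ?q n x * wave x \<omega> \<partial>lborel)
      = ?c n * fourier f \<omega>" for n
  proof -
    have "(\<integral>x. ?q n x * wave x \<omega> \<partial>lborel)
        = (\<integral>x. real (Suc n) * (f (x + ?t n *\<^sub>R b) * wave x \<omega> - f x * wave x \<omega>) \<partial>lborel)"
      by (simp only: algebra_simps)
    also have "\<dots> = real (Suc n) * (fourier (\<lambda>x. f (x + ?t n *\<^sub>R b)) \<omega> - fourier f \<omega>)"
      unfolding fourier_def integral_mult_right_zero
      by (simp only: Bochner_Integration.integral_diff[OF integrable_fourier_integrand[OF int]
            integrable_fourier_integrand[OF schwartz_integrable[OF f]]])
    finally show ?thesis
      unfolding shift by (simp add: algebra_simps del: of_nat_Suc)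
  qed
  have "(\<lambda>n. \<integral>x. ?q n x * wave x \<omega> \<partial>lborel)
      \<longlonglongrightarrow> (\<integral>x. dir_deriv b f x * wave x \<omega> \<partial>lborel)"
  proof (rule integral_dominated_convergence[where w="?w"])
    show "integrable lborel ?w" by (intro integrable_mult_right integrable_weight)
    show "AE x in lborel. (\<lambda>n. ?q n x * wave x \<omega>) \<longlonglongrightarrow> dir_deriv b f x * wave x \<omega>"
      by (intro AE_I2 tendsto_intros q_lim)
    show "AE x in lborel. norm (?q n x * wave x \<omega>) \<le> ?w x" for n
      unfolding norm_mult[of _ "cis _"] norm_cis mult_1_right by (intro AE_I2 q_bound)
  qed measurable
  moreover have "(\<lambda>n. ?c n * fourier f \<omega>)
      \<longlonglongrightarrow> 2 * pi * \<i> * (b \<bullet> \<omega>) * fourier f \<omega>"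
  \<comment> \<open>The quotient lemma needs a nonzero increment, here 2 \<pi> (b \<bullet>
    \<omega>); if it is 0, both sides are constantly 0.\<close>
  proof (cases "b \<bullet> \<omega> = 0")
    case False
    have "(cis has_derivative (\<lambda>h. h *\<^sub>R (\<i> * cis 0))) (at 0)"
      by (rule has_derivative_cis[OF has_derivative_ident])
    from has_derivative_quotient_tendsto[OF this, of "2 * pi * (b \<bullet> \<omega>)"] False
    have "(\<lambda>n. ?c n) \<longlonglongrightarrow> (2 * pi * (b \<bullet> \<omega>)) *\<^sub>R (\<i> * cis 0)"
      by simp
    then have "(\<lambda>n. ?c n * fourier f \<omega>)
      \<longlonglongrightarrow> (2 * pi * (b \<bullet> \<omega>)) *\<^sub>R (\<i> * cis 0) * fourier f \<omega>"
      by (rule tendsto_mult_right)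
    then show ?thesis by (simp add: scaleR_conv_of_real mult_ac)
  qed simp
  ultimately show ?thesis
    unfolding q_fourier fourier_def[of "dir_deriv b f"] by (rule LIMSEQ_unique)
qed

text \<open>The transform exchanges differentiation and multiplication by coordinates: a power of
  |\<omega>| is paid for by a derivative of f, and a derivative in \<omega> by a coordinate factor.
  Each operation leads to another Schwartz family, so both inductions run over all families.\<close>

lemma schwartz_family_fourier:
  fixes f :: "'i \<Rightarrow> 'a::euclidean_space \<Rightarrow> complex"
  assumes "schwartz_family f"
  shows "schwartz_family (\<lambda>i. fourier (f i))"
proof -
  have power_bound: "\<exists>C. \<forall>i \<omega>. norm \<omega> ^ k * cmod (fourier (f i) \<omega>) \<le> C"
    if "schwartz_family f" for k and f :: "'i \<Rightarrow> 'a \<Rightarrow> complex"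
    using that
  proof (induction k arbitrary: f)
    case 0
    obtain C where C: "\<And>i x. cmod (f i x) \<le> C * weight x"
      using schwartz_family_weight[OF 0] by blast
    have "cmod (fourier (f i) \<omega>) \<le> (\<integral>x. C * weight (x::'a) \<partial>lborel)" for i \<omega>
      by (rule order_trans[OF norm_fourier_le integral_mono])
         (auto intro!: integrable_norm schwartz_integrable schwartz_family_imp_schwartz[OF 0] integrable_weight C)
    then show ?case by auto
  next
    case (Suc k)
    have "\<forall>b\<in>Basis. \<exists>C. \<forall>i \<omega>. norm \<omega> ^ k * cmod (fourier (dir_deriv b (f i)) \<omega>) \<le> C"
      by (intro ballI Suc.IH schwartz_family_dir_deriv Suc.prems)
    then obtain C where C: "\<And>b i \<omega>. b \<in> Basis \<Longrightarrow> norm \<omega> ^ k * cmod (fourier (dir_deriv b (f i)) \<omega>) \<le> C b"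
      by metis
    have "norm \<omega> ^ Suc k * cmod (fourier (f i) \<omega>) \<le> (\<Sum>b\<in>Basis. C b)" for i \<omega>
    proof -
      have "norm \<omega> ^ Suc k * cmod (fourier (f i) \<omega>) = norm \<omega> * (norm \<omega> ^ k * cmod (fourier (f i) \<omega>))"
        by simp
      also have "\<dots> \<le> (\<Sum>b\<in>Basis. \<bar>\<omega> \<bullet> b\<bar>) * (norm \<omega> ^ k * cmod (fourier (f i) \<omega>))"
        by (intro mult_right_mono norm_le_l1) auto
      also have "\<dots> = (\<Sum>b\<in>Basis. norm \<omega> ^ k * (\<bar>b \<bullet> \<omega>\<bar> * cmod (fourier (f i) \<omega>)))"
        by (simp add: sum_distrib_left sum_distrib_right mult_ac inner_commute)
      also have "\<dots> \<le> (\<Sum>b\<in>Basis. C b)"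
      proof (intro sum_mono)
        fix b :: 'a assume b: "b \<in> Basis"
        have "1 * (\<bar>b \<bullet> \<omega>\<bar> * cmod (fourier (f i) \<omega>)) \<le> (2 * pi) * (\<bar>b \<bullet> \<omega>\<bar> * cmod (fourier (f i) \<omega>))"
          using pi_ge_two by (intro mult_right_mono) auto
        also have "\<dots> = cmod (fourier (dir_deriv b (f i)) \<omega>)"
          by (simp add: fourier_dir_deriv[OF schwartz_family_imp_schwartz[OF Suc.prems] b] norm_mult)
        finally have "norm \<omega> ^ k * (\<bar>b \<bullet> \<omega>\<bar> * cmod (fourier (f i) \<omega>))
            \<le> norm \<omega> ^ k * cmod (fourier (dir_deriv b (f i)) \<omega>)"
          by (intro mult_left_mono) auto
        also have "\<dots> \<le> C b" by (rule C[OF b])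
        finally show "norm \<omega> ^ k * (\<bar>b \<bullet> \<omega>\<bar> * cmod (fourier (f i) \<omega>)) \<le> C b" .
      qed
      finally show ?thesis .
    qed
    then show ?case by blast
  qed
  have "deriv_bound decay n (\<lambda>i. fourier (f i))" for n
    using assms
  proof (induction n arbitrary: f)
    case 0
    then show ?case by (auto intro: decayI power_bound)
  next
    case (Suc n)
    have d: "(fourier (f i) has_derivative (\<lambda>h. fourier (\<lambda>x. - 2 * pi * \<i> * (x \<bullet> h) * f i x) \<omega>)) (at \<omega>)" for i \<omega>
      by (rule fourier_has_derivative[OF schwartz_family_imp_schwartz[OF Suc.prems]])
    have "dir_deriv b (fourier (f i)) = fourier (\<lambda>x. - 2 * pi * \<i> * (x \<bullet> b) * f i x)" for b i
      by (rule dir_deriv_eqI[OF d])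
    moreover have "deriv_bound decay n (\<lambda>i. fourier (\<lambda>x. - 2 * pi * \<i> * (x \<bullet> b) * f i x))" for b
      by (intro Suc.IH schwartz_family_mult[OF multiplier_family_coordinate] Suc.prems)
    moreover have "decay (\<lambda>i. fourier (f i))"
      by (intro decayI power_bound Suc.prems)
    ultimately show ?case
      using differentiableI[OF d] by simp
  qed
  then show ?thesis unfolding schwartz_family_def by blast
qed

lemma schwartz_fourier: "f \<in> schwartz \<Longrightarrow> fourier f \<in> schwartz"
  unfolding schwartz_iff_family by (rule schwartz_family_fourier)

lemma schwartz_inv_fourier: "f \<in> schwartz \<Longrightarrow> inv_fourier f \<in> schwartz"
  using schwartz_isometry[OF _ schwartz_fourier, of "-1" f 0] by (simp add: inv_fourier_eq[abs_def])

lemma integral_lborel_scale: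
  fixes f :: "'a::euclidean_space \<Rightarrow> complex"
  assumes [measurable]: "f \<in> borel_measurable borel" and c: "c \<noteq> 0"
  shows "(\<integral>x. f x \<partial>lborel) = \<bar>c\<bar> ^ DIM('a) *\<^sub>R (\<integral>x. f (c *\<^sub>R x) \<partial>lborel)"
  using c by (subst lborel_affine[OF c, of 0]) (simp add: integral_density integral_distr)

lemma gaussian_density_scale:
  fixes x :: "'a::euclidean_space"
  assumes "0 < \<sigma>"
  shows "\<sigma> ^ DIM('a) * gaussian_density \<sigma> (\<sigma> *\<^sub>R x) = gaussian_density 1 x"
proof -
  have "\<sigma> * normal_density 0 \<sigma> (\<sigma> * y) = normal_density 0 1 y" for y
    using assms by (simp add: normal_density_def real_sqrt_mult power_mult_distrib field_simps)
  then have "(\<Prod>b\<in>(Basis::'a set). \<sigma> * normal_density 0 \<sigma> (\<sigma> * (x \<bullet> b))) = gaussian_density 1 x"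
    by (simp add: gaussian_density_def)
  then show ?thesis by (simp add: gaussian_density_def prod.distrib)
qed

lemma integral_gaussian_density:
  "integrable lborel (gaussian_density 1 :: 'a::euclidean_space \<Rightarrow> real)"
  "(\<integral>x. gaussian_density 1 (x::'a) \<partial>lborel) = 1"
proof -
  show "integrable lborel (gaussian_density 1 :: 'a \<Rightarrow> real)"
    by (rule integrableI_nonneg) (auto simp: nn_integral_gaussian_density)
  show "(\<integral>x. gaussian_density 1 (x::'a) \<partial>lborel) = 1"
    by (subst integral_eq_nn_integral) (auto simp: nn_integral_gaussian_density)
qed

text \<open>With a Gaussian inserted, the multiplication formula turns the inverse transform into an
  average of f around x against a normal density of width \<sigma>. After rescaling the density to
  width 1, dominated convergence applies on both sides as \<sigma> tends to 0.\<close>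

lemma fourier_inversion:
  fixes f :: "'a::euclidean_space \<Rightarrow> complex"
  assumes f: "f \<in> schwartz"
  shows "inv_fourier (fourier f) = f"
proof
  fix x
  note [measurable] = schwartz_measurable[OF f]
  let ?\<sigma> = "\<lambda>n. 1 / real (Suc n)"
  let ?G = "\<lambda>n (\<omega>::'a). complex_of_real (gaussian (?\<sigma> n) \<omega>) * wave \<omega> (- x)"
  obtain B where B: "\<And>x. cmod (f x) \<le> B"
    using schwartz_decay[OF f, of 0] by auto
  have eq: "(\<integral>\<omega>. fourier f \<omega> * ?G n \<omega> \<partial>lborel)
      = (\<integral>w. f (?\<sigma> n *\<^sub>R w + x) * gaussian_density 1 w \<partial>lborel)" for n
  proof -
    have "(\<integral>\<omega>. fourier f \<omega> * ?G n \<omega> \<partial>lborel)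
      = (\<integral>y. f y * fourier (?G n) y \<partial>lborel)"
      by (rule fourier_multiplication_formula[OF schwartz_integrable[OF f]
            integrable_fourier_integrand[OF integrable_of_real[OF integrable_gaussian]]]) simp
    also have "\<dots> = (\<integral>y. f y * gaussian_density (?\<sigma> n) (y + - x) \<partial>lborel)"
      by (subst fourier_modulated_gaussian) auto
    also have "\<dots> = (\<integral>y. f (x + y) * gaussian_density (?\<sigma> n) y \<partial>lborel)"
      using integral_lborel_isometry[of "\<lambda>y. f y * gaussian_density (?\<sigma> n) (y + - x)" 1 x] by simp
    also have "\<dots> = \<bar>?\<sigma> n\<bar> ^ DIM('a) *\<^sub>R (\<integral>w. f (x + ?\<sigma> n *\<^sub>R w) * gaussian_density (?\<sigma> n) (?\<sigma> n *\<^sub>R w) \<partial>lborel)"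
      by (rule integral_lborel_scale) auto
    also have "\<dots> = (\<integral>w. f (x + ?\<sigma> n *\<^sub>R w) * complex_of_real (?\<sigma> n ^ DIM('a) * gaussian_density (?\<sigma> n) (?\<sigma> n *\<^sub>R w)) \<partial>lborel)"
      by (simp only: scaleR_conv_of_real integral_mult_right_zero[symmetric] of_real_mult) (simp add: mult_ac)
    also have "\<dots> = (\<integral>w. f (?\<sigma> n *\<^sub>R w + x) * gaussian_density 1 w \<partial>lborel)"
      by (subst gaussian_density_scale) (auto simp: add.commute)
    finally show ?thesis .
  qed
  have lim_f: "(\<lambda>n. \<integral>w. f (?\<sigma> n *\<^sub>R w + x) * gaussian_density 1 w \<partial>lborel)
      \<longlonglongrightarrow> (\<integral>w. f x * gaussian_density 1 (w::'a) \<partial>lborel)"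
  proof (rule integral_dominated_convergence[where w="\<lambda>w. B * gaussian_density 1 w"])
    show "integrable lborel (\<lambda>w::'a. B * gaussian_density 1 w)"
      by (intro integrable_mult_right integral_gaussian_density)
    have "isCont f x" using schwartz_continuous[OF f] by (simp add: continuous_on_eq_continuous_at)
    moreover have "(\<lambda>n. ?\<sigma> n *\<^sub>R w + x) \<longlonglongrightarrow> x" for w
    proof -
      have "(\<lambda>n. ?\<sigma> n *\<^sub>R w + x) \<longlonglongrightarrow> 0 *\<^sub>R w + x"
        using LIMSEQ_inverse_real_of_nat by (intro tendsto_intros) (simp add: inverse_eq_divide)
      then show ?thesis by simp
    qed
    ultimately have "(\<lambda>n. f (?\<sigma> n *\<^sub>R w + x)) \<longlonglongrightarrow> f x" for w
      using isCont_tendsto_compose by blast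
    then show "AE w in lborel. (\<lambda>n. f (?\<sigma> n *\<^sub>R w + x) * gaussian_density 1 w) \<longlonglongrightarrow> f x * gaussian_density 1 w"
      by (intro AE_I2 tendsto_mult tendsto_const) auto
    show "AE w in lborel. norm (f (?\<sigma> n *\<^sub>R w + x) * gaussian_density 1 w) \<le> B * gaussian_density 1 w" for n
      by (intro AE_I2) (auto simp: norm_mult intro!: mult_right_mono B)
  qed measurable
  have gauss: "(\<integral>w. f x * gaussian_density 1 (w::'a) \<partial>lborel) = f x"
    using integral_gaussian_density(2)[where 'a='a] by simp
  have lim_fourier: "(\<lambda>n. \<integral>\<omega>. fourier f \<omega> * ?G n \<omega> \<partial>lborel)
      \<longlonglongrightarrow> (\<integral>\<omega>. fourier f \<omega> * (complex_of_real 1 * wave \<omega> (- x)) \<partial>lborel)"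
  proof (rule integral_dominated_convergence[where w="\<lambda>\<omega>. cmod (fourier f \<omega>)"])
    show "integrable lborel (\<lambda>\<omega>. cmod (fourier f \<omega>))"
      by (intro integrable_norm schwartz_integrable schwartz_fourier f)
    show "AE \<omega> in lborel. (\<lambda>n. fourier f \<omega> * ?G n \<omega>)
        \<longlonglongrightarrow> fourier f \<omega> * (complex_of_real 1 * wave \<omega> (- x))"
      by (intro AE_I2 tendsto_mult tendsto_const tendsto_of_real gaussian_tendsto_1)
    show "AE \<omega> in lborel. norm (fourier f \<omega> * ?G n \<omega>)
        \<le> cmod (fourier f \<omega>)" for n
      unfolding norm_mult norm_cis norm_of_real
      by (intro AE_I2) (simp add: mult_left_le gaussian_le_1)
  qed measurable
  have "(\<integral>\<omega>. fourier f \<omega> * (complex_of_real 1 * wave \<omega> (- x)) \<partial>lborel) = f x"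
    using LIMSEQ_unique[OF lim_fourier[unfolded eq] lim_f] unfolding gauss .
  then show "inv_fourier (fourier f) x = f x"
    by (simp add: inv_fourier_def inner_commute)
qed

lemma fourier_inv_fourier:
  assumes f: "f \<in> schwartz"
  shows "fourier (inv_fourier f) = f"
proof -
  have [measurable]: "fourier f \<in> borel_measurable borel"
    by (rule schwartz_measurable[OF schwartz_fourier[OF f]])
  have "fourier (inv_fourier f) \<omega> = inv_fourier (fourier f) \<omega>" for \<omega>
    using inv_fourier_reflect[of "fourier f" \<omega>] by (simp add: inv_fourier_eq[abs_def])
  then show ?thesis using fourier_inversion[OF f] by auto
qed

section \<open>Frequency-localised short-time Fourier transforms\<close>

abbreviation lborel2 :: "('a::euclidean_space \<times> 'a) measure" where
  "lborel2 \<equiv> lborel \<Otimes>\<^sub>M lborel"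

locale dyadic_window =
  fixes \<phi> g :: "'a::euclidean_space \<Rightarrow> complex"
  assumes generator: "dyadic_generator \<phi>" and window: "g \<in> schwartz"
begin

lemma \<phi>_schwartz: "\<phi> \<in> schwartz"
  by (rule dyadic_generator_schwartz[OF generator])

lemma \<phi>_measurable [measurable]: "\<phi> \<in> borel_measurable borel"
  by (rule schwartz_measurable[OF \<phi>_schwartz])

text \<open>A fattened dyadic block, equal to \<open>1\<close> on the support of \<open>dyadic \<phi> j\<close>.\<close>

definition fat :: "nat \<Rightarrow> 'a \<Rightarrow> complex" where
  "fat j \<xi> = \<phi> ((1/2) ^ (j + 1) *\<^sub>R \<xi>) - (if j < 2 then 0 else \<phi> ((1/2) ^ (j - 2) *\<^sub>R \<xi>))"

text \<open>The window on the frequency side: up to a phase, the inverse transform of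
  \<open>window_at x \<omega>\<close> is the translate of \<open>\<gamma>\<close> by
  \<omega>.\<close>

definition \<gamma> :: "'a \<Rightarrow> complex" where
  "\<gamma> = inv_fourier (\<lambda>y. cnj (g y))"

definition window_at :: "'a \<Rightarrow> 'a \<Rightarrow> 'a \<Rightarrow> complex" where
  "window_at x \<omega> = (\<lambda>y. cnj (g (y - x)) * wave y \<omega>)"

text \<open>The cut-off acts on the window and not on the function to be analysed. For fixed j, x
  and \<omega> this is therefore a Schwartz function, and pairing with it makes sense for every
  representing function of a distribution.\<close>

definition kernel :: "nat \<Rightarrow> 'a \<Rightarrow> 'a \<Rightarrow> 'a \<Rightarrow> complex" where
  "kernel j x \<omega> = fourier (\<lambda>\<xi>. fat j \<xi> * inv_fourier (window_at x \<omega>) \<xi>)"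

definition local_stft :: "nat \<Rightarrow> ('a \<Rightarrow> complex) \<Rightarrow> 'a \<Rightarrow> 'a \<Rightarrow> complex" where
  "local_stft j h x \<omega> = (\<integral>y. h y * kernel j x \<omega> y \<partial>lborel)"

text \<open>A point z is read as (\<omega>, x), so that iterated integration over
  \<open>lborel2\<close> has x inside, as in \<open>modulation_enorm\<close>.\<close>

abbreviation local_stft_sum :: "nat \<Rightarrow> (nat \<Rightarrow> 'a \<Rightarrow> complex) \<Rightarrow> 'a \<times> 'a \<Rightarrow> complex" where
  "local_stft_sum J h z \<equiv> \<Sum>j<J. local_stft j (h j) (snd z) (fst z)"

abbreviation stft_power :: "real \<Rightarrow> nat \<Rightarrow> (nat \<Rightarrow> 'a \<Rightarrow> complex) \<Rightarrow> ennreal" where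
  "stft_power P J h \<equiv> \<integral>\<^sup>+z. ennreal (cmod (local_stft_sum J h z) powr P) \<partial>lborel2"

text \<open>The weight runs from 2^(jd) at P = 1, the norm in the L^1 estimate, to 1 at P =
  2.\<close>

abbreviation weighted_norms :: "real \<Rightarrow> nat \<Rightarrow> (nat \<Rightarrow> 'a \<Rightarrow> complex) \<Rightarrow> ennreal" where
  "weighted_norms P J h \<equiv> \<Sum>j<J. ennreal (((2 ^ j) ^ DIM('a)) powr (2 - P)) *
    (\<integral>\<^sup>+y. ennreal (cmod (h j y) powr P) \<partial>lborel)"

lemma fat_measurable [measurable]: "fat j \<in> borel_measurable borel"
  unfolding fat_def[abs_def] by measurable

lemma \<gamma>_schwartz: "\<gamma> \<in> schwartz"
  unfolding \<gamma>_def by (intro schwartz_inv_fourier schwartz_cnj window)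

lemma \<gamma>_measurable [measurable]: "\<gamma> \<in> borel_measurable borel"
  by (rule schwartz_measurable[OF \<gamma>_schwartz])

lemma schwartz_mult_cis: "f \<in> schwartz \<Longrightarrow> (\<lambda>y. f y * wave y v) \<in> schwartz"
  using multiplier_mult_schwartz[OF multiplier_cis[of "(- 2 * pi) *\<^sub>R v"], of f]
  by (simp add: mult.commute)

lemma window_at_schwartz: "window_at x \<omega> \<in> schwartz"
  unfolding window_at_def
  using schwartz_isometry[of 1 "\<lambda>y. cnj (g y)" "- x", OF _ schwartz_cnj[OF window]]
  by (intro schwartz_mult_cis) simp

lemma inv_fourier_window_at:
  "inv_fourier (window_at x \<omega>) \<xi> = cis (2 * pi * (x \<bullet> (\<xi> - \<omega>))) * \<gamma> (\<xi> - \<omega>)"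
proof -
  have [measurable]: "g \<in> borel_measurable borel" by (rule schwartz_measurable[OF window])
  have "inv_fourier (window_at x \<omega>) \<xi>
      = (\<integral>y. cnj (g (y - x)) * cis (2 * pi * (y \<bullet> (\<xi> - \<omega>))) \<partial>lborel)"
    unfolding inv_fourier_def window_at_def
    by (intro Bochner_Integration.integral_cong[OF refl])
       (simp add: mult.assoc cis_mult inner_diff_right inner_commute right_diff_distrib)
  also have "\<dots> = (\<integral>y. cnj (g y) * cis (2 * pi * ((x + y) \<bullet> (\<xi> - \<omega>))) \<partial>lborel)"
    using integral_lborel_isometry[of "\<lambda>y. cnj (g (y - x)) * cis (2 * pi * (y \<bullet> (\<xi> - \<omega>)))" 1 x]
    by simp
  also have "\<dots> = (\<integral>y. cis (2 * pi * (x \<bullet> (\<xi> - \<omega>))) * (cnj (g y) * cis (2 * pi * ((\<xi> - \<omega>) \<bullet> y))) \<partial>lborel)"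
    by (intro Bochner_Integration.integral_cong[OF refl])
       (simp add: mult_ac cis_mult inner_add_right inner_commute[of _ "\<xi> - \<omega>"] distrib_left add.commute)
  finally show ?thesis
    by (simp add: \<gamma>_def inv_fourier_def)
qed

text \<open>If |\<omega>| is large compared with 2^j, the cut-off at \<omega> + \<eta> is nonzero
  only when |\<eta>| is at least a fixed fraction of |\<omega>|. The factor growing with |\<omega>|
  / 2^j is thus slow growth in \<eta>, uniformly in j and \<omega>. The proof treats the two
  rescaled copies of \<open>\<phi>\<close> in \<open>fat\<close> separately.\<close>

lemma multiplier_family_fat:
  "multiplier_family (\<lambda>(j, \<omega>) \<eta>. complex_of_real ((1 + norm ((1/2) ^ j *\<^sub>R \<omega>)) ^ (2 * DIM('a))) * fat j (\<omega> + \<eta>))"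
proof -
  let ?D = "2 * DIM('a)"
  let ?A = "\<lambda>(j, \<omega>::'a). complex_of_real ((1 + norm ((1/2) ^ j *\<^sub>R \<omega>)) ^ ?D)"
  define c1 v1 where "c1 = (\<lambda>(j, \<omega>::'a). (1/2::real) ^ (j + 1))" and "v1 = (\<lambda>(j, \<omega>::'a). (1/2::real) ^ (j + 1) *\<^sub>R \<omega>)"
  define c2 v2 where "c2 = (\<lambda>(j, \<omega>::'a). (1/2::real) ^ (j - 2))" and "v2 = (\<lambda>(j, \<omega>::'a). (1/2::real) ^ (j - 2) *\<^sub>R \<omega>)"
  define a2 where "a2 = (\<lambda>(j, \<omega>::'a). if j < 2 then 0 else - ?A (j, \<omega>))"
  have norm_A: "cmod (?A (j, \<omega>)) = (1 + norm ((1/2) ^ j *\<^sub>R \<omega>)) ^ ?D" for j \<omega>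
    unfolding prod.case norm_of_real by simp
  have 1: "multiplier_family (\<lambda>i \<eta>. ?A i * \<phi> (v1 i + c1 i *\<^sub>R \<eta>))"
  proof (rule multiplier_family_affine[where D="2 ^ ?D" and k="?D"])
    fix i :: "nat \<times> 'a"
    show "\<bar>c1 i\<bar> \<le> 1"
      using power_le_one[of "1/2::real" "Suc (fst i)"] by (cases i) (simp add: c1_def power_abs)
    \<comment> \<open>The translation \<open>v1\<close> has the scale 2^(-(j+1)), half of that in
      the weight, at the cost of the constant 2^(2d).\<close>
    show "cmod (?A i) \<le> 2 ^ ?D * (1 + norm (v1 i)) ^ ?D"
    proof (cases i)
      case (Pair j \<omega>)
      have "(1 + norm ((1/2) ^ j *\<^sub>R \<omega>)) ^ ?D \<le> (2 * (1 + norm (v1 (j, \<omega>)))) ^ ?D"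
        by (intro power_mono) (simp_all add: v1_def)
      then show ?thesis unfolding Pair norm_A power_mult_distrib .
    qed
  qed (rule \<phi>_schwartz)
  \<comment> \<open>For j < 2 the subtracted term of \<open>fat\<close> is absent and
    \<open>a2\<close> vanishes. Otherwise the translation \<open>v2\<close> has a larger scale than
    the weight, and the constant is 1.\<close>
  have 2: "multiplier_family (\<lambda>i \<eta>. a2 i * \<phi> (v2 i + c2 i *\<^sub>R \<eta>))"
  proof (rule multiplier_family_affine[where D="1" and k="?D"])
    fix i :: "nat \<times> 'a"
    show "\<bar>c2 i\<bar> \<le> 1" by (cases i) (simp add: c2_def power_abs power_le_one)
    show "cmod (a2 i) \<le> 1 * (1 + norm (v2 i)) ^ ?D"
    proof (cases i)
      case (Pair j \<omega>)
      have "(1/2::real) ^ j \<le> (1/2) ^ (j - 2)" by (intro power_decreasing) auto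
      then have "(1 + norm ((1/2) ^ j *\<^sub>R \<omega>)) ^ ?D \<le> (1 + norm (v2 (j, \<omega>))) ^ ?D"
        by (intro power_mono) (auto simp: v2_def intro!: mult_right_mono)
      then show ?thesis unfolding Pair
        using norm_A[of j \<omega>] by (simp add: a2_def)
    qed
  qed (rule \<phi>_schwartz)
  have "(\<lambda>(j, \<omega>) \<eta>. complex_of_real ((1 + norm ((1/2) ^ j *\<^sub>R \<omega>)) ^ ?D) * fat j (\<omega> + \<eta>))
      = (\<lambda>i \<eta>. ?A i * \<phi> (v1 i + c1 i *\<^sub>R \<eta>) + a2 i * \<phi> (v2 i + c2 i *\<^sub>R \<eta>))"
    by (auto simp: fun_eq_iff fat_def v1_def c1_def v2_def c2_def a2_def scaleR_add_right right_diff_distrib)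
  then show ?thesis using multiplier_family_add[OF 1 2] by simp
qed

text \<open>At the index (j, 0) of the weighted family the weight is 1, which leaves the cut-off
  itself.\<close>

lemma fat_mult_schwartz: "f \<in> schwartz \<Longrightarrow> (\<lambda>\<xi>. fat j \<xi> * f \<xi>) \<in> schwartz"
  using schwartz_family_mult[OF multiplier_family_fat schwartz_family_const[of f], THEN schwartz_family_imp_schwartz[of _ "(j, 0)"]]
  by simp

lemma kernel_schwartz: "kernel j x \<omega> \<in> schwartz"
  unfolding kernel_def by (intro schwartz_fourier fat_mult_schwartz schwartz_inv_fourier window_at_schwartz)

section \<open>Supports and overlap of the cut-offs\<close>

lemma \<phi>_scaled:
  shows \<phi>_scaled_zero: "2 ^ Suc i \<le> norm \<xi> \<Longrightarrow> \<phi> ((1/2) ^ i *\<^sub>R \<xi>) = 0"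
    and \<phi>_scaled_one: "norm \<xi> \<le> 2 ^ i \<Longrightarrow> \<phi> ((1/2) ^ i *\<^sub>R \<xi>) = 1"
  using generator by (simp_all add: dyadic_generator_def field_simps power_divide)

lemma fat_zero:
  assumes "norm \<xi> \<ge> 2 ^ (j + 2) \<or> j \<ge> 2 \<and> norm \<xi> \<le> 2 ^ (j - 2)"
  shows "fat j \<xi> = 0"
  using assms
proof
  assume *: "norm \<xi> \<ge> 2 ^ (j + 2)"
  have "(2::real) ^ Suc (j - 2) \<le> 2 ^ (j + 2)"
    by (intro power_increasing) auto
  with * have "2 ^ Suc (j - 2) \<le> norm \<xi>" and "2 ^ Suc (j + 1) \<le> norm \<xi>" by (linarith, simp)
  then show ?thesis unfolding fat_def by (simp only: \<phi>_scaled_zero) simp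
next
  assume *: "j \<ge> 2 \<and> norm \<xi> \<le> 2 ^ (j - 2)"
  have "(2::real) ^ (j - 2) \<le> 2 ^ (j + 1)"
    by (intro power_increasing) auto
  with * have "norm \<xi> \<le> 2 ^ (j + 1)" and "norm \<xi> \<le> 2 ^ (j - 2)" and "\<not> j < 2" by linarith+
  then show ?thesis unfolding fat_def by (simp only: \<phi>_scaled_one) simp
qed

text \<open>The dyadic function lives on 2^(j-1) <= |\<xi>| <= 2^(j+1), or on a ball if j = 0; there
  the outer term of \<open>fat\<close> is 1 and the inner one is 0 or absent. Hence the fattened
  cut-off can be inserted into a block for free.\<close>

lemma dyadic_mult_fat: "dyadic \<phi> j \<xi> * fat j \<xi> = dyadic \<phi> j \<xi>"
proof (cases "2 ^ Suc j \<le> norm \<xi>")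
  case True
  have "(2::real) ^ Suc (j - 1) \<le> 2 ^ Suc j"
    by (intro power_increasing) auto
  with True have "2 ^ Suc (j - 1) \<le> norm \<xi>" by linarith
  from \<phi>_scaled_zero[OF this] \<phi>_scaled_zero[OF True] have "dyadic \<phi> j \<xi> = 0"
    by (cases "j = 0") (simp_all add: dyadic_def)
  then show ?thesis by simp
next
  case False
  then have 1: "\<phi> ((1/2) ^ (j + 1) *\<^sub>R \<xi>) = 1"
    by (intro \<phi>_scaled_one) simp
  show ?thesis
  proof (cases "2 \<le> j \<and> norm \<xi> \<le> 2 ^ (j - 1)")
    case True
    have "(2::real) ^ (j - 1) \<le> 2 ^ j"
      by (intro power_increasing) auto
    with True have "norm \<xi> \<le> 2 ^ j" and "norm \<xi> \<le> 2 ^ (j - 1)" and "j \<noteq> 0" by linarith+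
    then have "dyadic \<phi> j \<xi> = 0"
      unfolding dyadic_def by (simp only: \<phi>_scaled_one) simp
    then show ?thesis by simp
  next
    case False
    have "\<phi> ((1/2) ^ (j - 2) *\<^sub>R \<xi>) = 0" if "2 \<le> j"
    proof (rule \<phi>_scaled_zero)
      have "Suc (j - 2) = j - 1" using that by simp
      with False that show "2 ^ Suc (j - 2) \<le> norm \<xi>" by simp
    qed
    with 1 show ?thesis by (simp add: fat_def)
  qed
qed

lemma fat_bounded: "\<exists>M\<ge>0. \<forall>j \<xi>. cmod (fat j \<xi>) \<le> M"
proof -
  obtain C where "\<And>x. (1 + norm x) ^ 0 * cmod (\<phi> x) \<le> C" and "0 \<le> C"
    using schwartz_decay[OF \<phi>_schwartz] by blast
  then have C: "cmod (\<phi> x) \<le> C" for x by simp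
  have "cmod (fat j \<xi>) \<le> C + C" for j \<xi>
    unfolding fat_def using C \<open>0 \<le> C\<close>
    by (intro order_trans[OF norm_triangle_ineq4] add_mono) auto
  with \<open>0 \<le> C\<close> show ?thesis by (intro exI[of _ "C + C"]) auto
qed

text \<open>\<open>fat m\<close> vanishes from radius 2^(m+2) on and \<open>fat j\<close> up to
  radius 2^(j-2), so two of them can be nonzero at the same point only if their indices differ by
  less than 4.\<close>

lemma card_overlap: "finite {j. fat j \<xi> \<noteq> 0} \<and> card {j. fat j \<xi> \<noteq> 0} \<le> 4"
proof (cases "{j. fat j \<xi> \<noteq> 0} = {}")
  case False
  define m where "m = (LEAST j. fat j \<xi> \<noteq> 0)"
  have m: "fat m \<xi> \<noteq> 0" unfolding m_def by (rule LeastI_ex) (use False in auto)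
  have "{j. fat j \<xi> \<noteq> 0} \<subseteq> {m..<m+4}"
  proof
    fix j assume "j \<in> {j. fat j \<xi> \<noteq> 0}"
    then have j: "fat j \<xi> \<noteq> 0" and "m \<le> j" unfolding m_def by (auto intro: Least_le)
    have "j < m + 4"
    proof (rule ccontr)
      assume "\<not> j < m + 4"
      then have "2 \<le> j" and "m + 2 \<le> j - 2" by simp_all
      moreover from this have "(2::real) ^ (m + 2) \<le> 2 ^ (j - 2)"
        by (intro power_increasing) simp_all
      ultimately show False using j m fat_zero[of j \<xi>] fat_zero[of m \<xi>] by linarith
    qed
    with \<open>m \<le> j\<close> show "j \<in> {m..<m+4}" by simp
  qed
  from finite_subset[OF this] card_mono[OF _ this] show ?thesis by simp
qed simp

lemma sum_fat_bounded: "\<exists>C\<ge>0. \<forall>J \<xi>. (\<Sum>j<J. (cmod (fat j \<xi>))\<^sup>2) \<le> C"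
proof -
  obtain M where M: "\<And>j \<xi>. cmod (fat j \<xi>) \<le> M" "0 \<le> M" using fat_bounded by blast
  have "(\<Sum>j<J. (cmod (fat j \<xi>))\<^sup>2) \<le> 4 * M\<^sup>2" for J \<xi>
  proof -
    let ?S = "{j. fat j \<xi> \<noteq> 0}"
    have "(\<Sum>j<J. (cmod (fat j \<xi>))\<^sup>2) = (\<Sum>j\<in>{..<J} \<inter> ?S. (cmod (fat j \<xi>))\<^sup>2)"
      by (rule sum.mono_neutral_right) auto
    also have "\<dots> \<le> (\<Sum>j\<in>{..<J} \<inter> ?S. M\<^sup>2)"
      by (intro sum_mono power_mono M) auto
    also have "\<dots> = real (card ({..<J} \<inter> ?S)) * M\<^sup>2" by simp
    also have "\<dots> \<le> 4 * M\<^sup>2"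
      using card_overlap[of \<xi>] card_mono[of ?S "{..<J} \<inter> ?S"] by (intro mult_right_mono) auto
    finally show ?thesis .
  qed
  then show ?thesis by (intro exI[of _ "4 * M\<^sup>2"]) auto
qed

section \<open>The kernel and its two integral estimates\<close>

lemma kernel_eq:
  "kernel j x \<omega> y = wave \<omega> y * fourier (\<lambda>\<eta>. fat j (\<omega> + \<eta>) * \<gamma> \<eta>) (y - x)"
proof -
  have "kernel j x \<omega> y = (\<integral>\<xi>. fat j \<xi> * (cis (2 * pi * (x \<bullet> (\<xi> - \<omega>))) * \<gamma> (\<xi> - \<omega>)) * wave \<xi> y \<partial>lborel)"
    unfolding kernel_def fourier_def inv_fourier_window_at ..
  also have "\<dots> = (\<integral>\<eta>. fat j (\<omega> + \<eta>) * (cis (2 * pi * (x \<bullet> \<eta>)) * \<gamma> \<eta>) * wave (\<omega> + \<eta>) y \<partial>lborel)"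
    using integral_lborel_isometry[of "\<lambda>\<xi>. fat j \<xi> * (cis (2 * pi * (x \<bullet> (\<xi> - \<omega>))) * \<gamma> (\<xi> - \<omega>)) * wave \<xi> y" 1 \<omega>]
    by simp
  also have "\<dots> = (\<integral>\<eta>. wave \<omega> y * (fat j (\<omega> + \<eta>) * \<gamma> \<eta> * wave \<eta> (y - x)) \<partial>lborel)"
  proof (rule Bochner_Integration.integral_cong[OF refl])
    fix \<eta>
    have e: "cis (2 * pi * (x \<bullet> \<eta>)) * wave (\<omega> + \<eta>) y
        = wave \<omega> y * wave \<eta> (y - x)"
      by (simp add: cis_mult inner_add_left inner_diff_right inner_commute algebra_simps)
    have "fat j (\<omega> + \<eta>) * (cis (2 * pi * (x \<bullet> \<eta>)) * \<gamma> \<eta>) * wave (\<omega> + \<eta>) y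
        = fat j (\<omega> + \<eta>) * \<gamma> \<eta> * (cis (2 * pi * (x \<bullet> \<eta>)) * wave (\<omega> + \<eta>) y)"
      by (simp only: mult_ac)
    then show "fat j (\<omega> + \<eta>) * (cis (2 * pi * (x \<bullet> \<eta>)) * \<gamma> \<eta>) * wave (\<omega> + \<eta>) y
        = wave \<omega> y * (fat j (\<omega> + \<eta>) * \<gamma> \<eta> * wave \<eta> (y - x))"
      unfolding e by (simp only: mult_ac)
  qed
  finally show ?thesis by (simp add: fourier_def)
qed

text \<open>By \<open>kernel_eq\<close> the kernel is, up to a phase, a Fourier transform evaluated
  at y - x. After multiplication by (1 + |2^(-j) \<omega>|)^(2d) the transformed functions still
  form one Schwartz family in (j, \<omega>), so a single C serves all of them, and the factor
  reappears as decay in \<omega> at scale 2^j.\<close>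

lemma kernel_bound:
  "\<exists>C\<ge>0. \<forall>j x \<omega> y. cmod (kernel j x \<omega> y) \<le> C * weight (y - x) * weight ((1/2) ^ j *\<^sub>R \<omega>)"
proof -
  let ?A = "\<lambda>j \<omega>. (1 + norm ((1/2) ^ j *\<^sub>R (\<omega>::'a))) ^ (2 * DIM('a))"
  have "schwartz_family (\<lambda>(j, \<omega>) \<eta>. complex_of_real (?A j \<omega>) * fat j (\<omega> + \<eta>) * \<gamma> \<eta>)"
    using schwartz_family_mult[OF multiplier_family_fat schwartz_family_const[OF \<gamma>_schwartz]]
    by (simp add: case_prod_unfold)
  from schwartz_family_weight[OF schwartz_family_fourier[OF this]]
  obtain C where "0 \<le> C" and C: "\<And>j \<omega> z. cmod (fourier (\<lambda>\<eta>. complex_of_real (?A j \<omega>) * fat j (\<omega> + \<eta>) * \<gamma> \<eta>) z) \<le> C * weight z"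
    by fastforce
  have "cmod (kernel j x \<omega> y) \<le> C * weight (y - x) * weight ((1/2) ^ j *\<^sub>R \<omega>)" for j x \<omega> y
  proof (rule le_weightI)
    have "fourier (\<lambda>\<eta>. complex_of_real (?A j \<omega>) * fat j (\<omega> + \<eta>) * \<gamma> \<eta>) (y - x)
        = complex_of_real (?A j \<omega>) * fourier (\<lambda>\<eta>. fat j (\<omega> + \<eta>) * \<gamma> \<eta>) (y - x)"
      unfolding fourier_def mult.assoc by (rule integral_mult_right_zero)
    moreover have "cmod (complex_of_real (?A j \<omega>)) = ?A j \<omega>"
      unfolding norm_of_real by (rule abs_of_nonneg) simp
    ultimately have "?A j \<omega> * cmod (kernel j x \<omega> y)
        = cmod (fourier (\<lambda>\<eta>. complex_of_real (?A j \<omega>) * fat j (\<omega> + \<eta>) * \<gamma> \<eta>) (y - x))"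
      unfolding kernel_eq by (simp only: norm_mult norm_cis mult_1_left)
    also have "\<dots> \<le> C * weight (y - x)" by (rule C)
    finally show "?A j \<omega> * cmod (kernel j x \<omega> y) \<le> C * weight (y - x)" .
  qed simp
  with \<open>0 \<le> C\<close> show ?thesis by blast
qed

lemma local_stft_measurable:
  assumes [measurable]: "h \<in> borel_measurable borel"
  shows "(\<lambda>(\<omega>, x). local_stft j h x \<omega>) \<in> borel_measurable lborel2"
  unfolding local_stft_def kernel_eq fourier_def by measurable

lemma local_stft_add:
  assumes "integrable lborel h" and "integrable lborel h'"
  shows "local_stft j (\<lambda>y. h y + h' y) x \<omega> = local_stft j h x \<omega> + local_stft j h' x \<omega>"
proof -
  obtain C where C: "\<And>y. (1 + norm y) ^ 0 * cmod (kernel j x \<omega> y) \<le> C"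
    using schwartz_decay[OF kernel_schwartz] by blast
  have "integrable lborel (\<lambda>y. f y * kernel j x \<omega> y)" if "integrable lborel f" for f
    using C by (intro integrable_mult_bounded[OF that]) (auto simp: schwartz_measurable[OF kernel_schwartz])
  then show ?thesis
    using assms by (simp add: local_stft_def distrib_right)
qed

text \<open>The kernel bound is a product, so its integral in x gives the constant K for every y,
  and its integral in \<omega> gives another K times 2^(jd) after rescaling by 2^j. This factor is
  the source of the smoothness that the embedding costs.\<close>

lemma nn_integral_local_stft:
  "\<exists>C\<ge>0. \<forall>j h. h \<in> borel_measurable borel \<longrightarrow>
    (\<integral>\<^sup>+z. ennreal (cmod (local_stft j h (snd z) (fst z))) \<partial>lborel2)
      \<le> ennreal (C * (2 ^ j) ^ DIM('a)) * (\<integral>\<^sup>+y. ennreal (cmod (h y)) \<partial>lborel)"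
proof -
  obtain C where "0 \<le> C" and C: "\<And>j x \<omega> y. cmod (kernel j x \<omega> y) \<le> C * weight (y - x) * weight ((1/2) ^ j *\<^sub>R \<omega>)"
    using kernel_bound by blast
  obtain K where K: "(\<integral>\<^sup>+x. ennreal (weight (x::'a)) \<partial>lborel) = ennreal K" and "0 \<le> K"
  proof
    show "(\<integral>\<^sup>+x. ennreal (weight (x::'a)) \<partial>lborel) = ennreal (\<integral>x. weight (x::'a) \<partial>lborel)"
      by (rule nn_integral_eq_integral[OF integrable_weight]) auto
  qed simp
  have "(\<integral>\<^sup>+z. ennreal (cmod (local_stft j h (snd z) (fst z))) \<partial>lborel2)
      \<le> ennreal (C * K * K * (2 ^ j) ^ DIM('a)) * (\<integral>\<^sup>+y. ennreal (cmod (h y)) \<partial>lborel)"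
    if [measurable]: "h \<in> borel_measurable borel" for j h
  proof -
    have [measurable]: "(\<lambda>(\<omega>, x). local_stft j h x \<omega>) \<in> borel_measurable lborel2"
      by (rule local_stft_measurable) measurable
    let ?W = "\<lambda>\<omega>::'a. ennreal (C * weight ((1/2) ^ j *\<^sub>R \<omega>))"
    have scaled: "(\<integral>\<^sup>+\<omega>. ?W \<omega> \<partial>lborel) = ennreal (C * K * (2 ^ j) ^ DIM('a))"
    proof -
      have "(\<integral>\<^sup>+\<omega>. ?W \<omega> \<partial>lborel) = ennreal ((2 ^ j) ^ DIM('a)) * (\<integral>\<^sup>+\<omega>. ?W (0 + 2 ^ j *\<^sub>R \<omega>) \<partial>lborel)"
        using nn_integral_lborel_affine[of ?W "2 ^ j" 0] by simp
      also have "(\<integral>\<^sup>+\<omega>. ?W (0 + 2 ^ j *\<^sub>R \<omega>) \<partial>lborel) = ennreal C * (\<integral>\<^sup>+\<omega>. ennreal (weight (\<omega>::'a)) \<partial>lborel)"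
        using \<open>0 \<le> C\<close> by (simp add: ennreal_mult nn_integral_cmult power_one_over)
      finally show ?thesis
        using \<open>0 \<le> C\<close> \<open>0 \<le> K\<close> by (simp add: K mult_ac flip: ennreal_mult)
    qed
    have shifted: "(\<integral>\<^sup>+x. ennreal (weight (y - x)) \<partial>lborel) = ennreal K" for y :: 'a
      using nn_integral_lborel_isometry[of "\<lambda>x. ennreal (weight (x::'a))" "-1" y] K by simp
    have "(\<integral>\<^sup>+z. ennreal (cmod (local_stft j h (snd z) (fst z))) \<partial>lborel2)
      = (\<integral>\<^sup>+\<omega>. (\<integral>\<^sup>+x. ennreal (cmod (local_stft j h x \<omega>)) \<partial>lborel) \<partial>lborel)"
      by (subst lborel.nn_integral_fst[symmetric]) (auto simp: case_prod_unfold)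
    also have "\<dots> \<le> (\<integral>\<^sup>+\<omega>. (\<integral>\<^sup>+x. ?W \<omega> * (\<integral>\<^sup>+y. ennreal (cmod (h y)) * ennreal (weight (y - x)) \<partial>lborel) \<partial>lborel) \<partial>lborel)"
    proof (intro nn_integral_mono)
      fix x \<omega> :: 'a
      have "ennreal (cmod (local_stft j h x \<omega>)) \<le> (\<integral>\<^sup>+y. ennreal (cmod (h y * kernel j x \<omega> y)) \<partial>lborel)"
        unfolding local_stft_def by (rule norm_integral_le_nn_integral)
      also have "\<dots> \<le> (\<integral>\<^sup>+y. ?W \<omega> * (ennreal (cmod (h y)) * ennreal (weight (y - x))) \<partial>lborel)"
      proof (intro nn_integral_mono)
        fix y
        have "cmod (h y * kernel j x \<omega> y) \<le> cmod (h y) * (C * weight (y - x) * weight ((1/2) ^ j *\<^sub>R \<omega>))"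
          unfolding norm_mult by (intro mult_left_mono C) auto
        also have "\<dots> = (C * weight ((1/2) ^ j *\<^sub>R \<omega>)) * (cmod (h y) * weight (y - x))" by simp
        finally show "ennreal (cmod (h y * kernel j x \<omega> y)) \<le> ?W \<omega> * (ennreal (cmod (h y)) * ennreal (weight (y - x)))"
          using \<open>0 \<le> C\<close> by (simp flip: ennreal_mult add: ennreal_leI)
      qed
      also have "\<dots> = ?W \<omega> * (\<integral>\<^sup>+y. ennreal (cmod (h y)) * ennreal (weight (y - x)) \<partial>lborel)"
        by (rule nn_integral_cmult) measurable
      finally show "ennreal (cmod (local_stft j h x \<omega>)) \<le> \<dots>" .
    qed
    also have "\<dots> = (\<integral>\<^sup>+\<omega>. ?W \<omega> \<partial>lborel) * (\<integral>\<^sup>+x. (\<integral>\<^sup>+y. ennreal (cmod (h y)) * ennreal (weight (y - x)) \<partial>lborel) \<partial>lborel)"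
      by (simp add: nn_integral_cmult nn_integral_multc)
    also have "(\<integral>\<^sup>+x. (\<integral>\<^sup>+y. ennreal (cmod (h y)) * ennreal (weight (y - x)) \<partial>lborel) \<partial>lborel)
        = (\<integral>\<^sup>+y. (\<integral>\<^sup>+x. ennreal (cmod (h y)) * ennreal (weight (y - x)) \<partial>lborel) \<partial>lborel)"
      by (rule lborel_pair.Fubini') measurable
    also have "\<dots> = ennreal K * (\<integral>\<^sup>+y. ennreal (cmod (h y)) \<partial>lborel)"
      by (simp add: nn_integral_cmult nn_integral_multc shifted mult.commute)
    finally show ?thesis
      unfolding scaled using \<open>0 \<le> C\<close> \<open>0 \<le> K\<close> by (simp add: ennreal_mult mult_ac)
  qed
  moreover have "0 \<le> C * K * K" using \<open>0 \<le> C\<close> \<open>0 \<le> K\<close> by simp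
  ultimately show ?thesis by blast
qed

text \<open>The multiplication formula moves the transform from the kernel to h. For fixed \<omega>
  the result is, up to a phase, an inverse transform in x, the form to which Bessel's inequality
  applies.\<close>

lemma local_stft_fourier:
  assumes h: "integrable lborel h"
  shows "local_stft j h x \<omega> = wave x \<omega> * inv_fourier (\<lambda>\<xi>. fat j \<xi> * fourier h \<xi> * \<gamma> (\<xi> - \<omega>)) x"
proof -
  have "local_stft j h x \<omega> = (\<integral>\<xi>. fourier h \<xi> * (fat j \<xi> * inv_fourier (window_at x \<omega>) \<xi>) \<partial>lborel)"
    unfolding local_stft_def kernel_def
    by (rule fourier_multiplication_formula[symmetric, OF h])
       (intro schwartz_integrable fat_mult_schwartz schwartz_inv_fourier window_at_schwartz)
  also have "\<dots> = (\<integral>\<xi>. wave x \<omega> * (fat j \<xi> * fourier h \<xi> * \<gamma> (\<xi> - \<omega>) * cis (2 * pi * (x \<bullet> \<xi>))) \<partial>lborel)"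
  proof (rule Bochner_Integration.integral_cong[OF refl])
    fix \<xi>
    have "cis (2 * pi * (x \<bullet> (\<xi> - \<omega>))) = wave x \<omega> * cis (2 * pi * (x \<bullet> \<xi>))"
      by (simp add: cis_mult inner_diff_right algebra_simps)
    then show "fourier h \<xi> * (fat j \<xi> * inv_fourier (window_at x \<omega>) \<xi>)
        = wave x \<omega> * (fat j \<xi> * fourier h \<xi> * \<gamma> (\<xi> - \<omega>) * cis (2 * pi * (x \<bullet> \<xi>)))"
      unfolding inv_fourier_window_at by simp
  qed
  finally show ?thesis by (simp add: inv_fourier_def)
qed

text \<open>For fixed \<omega> the sum is, up to a phase, the inverse transform of \<gamma>(\<xi> -
  \<omega>) S(\<xi>) with S independent of \<omega>. After Bessel's inequality in x, the integral
  over \<omega> merely contributes G, the squared L^2 norm of \<gamma>; this is why no factor 2^(jd)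
  appears.\<close>

lemma nn_integral_square_local_stft:
  "\<exists>C\<ge>0. \<forall>J h. (\<forall>j. integrable lborel (h j)) \<longrightarrow>
    (\<integral>\<^sup>+z. ennreal ((cmod (local_stft_sum J h z))\<^sup>2) \<partial>lborel2)
      \<le> ennreal C * (\<Sum>j<J. \<integral>\<^sup>+y. ennreal ((cmod (h j y))\<^sup>2) \<partial>lborel)"
proof -
  obtain M where "0 \<le> M" and M: "\<And>j \<xi>. cmod (fat j \<xi>) \<le> M" using fat_bounded by blast
  obtain C where "0 \<le> C" and C: "\<And>J \<xi>. (\<Sum>j<J. (cmod (fat j \<xi>))\<^sup>2) \<le> C" using sum_fat_bounded by blast
  obtain B where "\<And>x. (1 + norm x) ^ 0 * cmod (\<gamma> x) \<le> B"
    using schwartz_decay[OF \<gamma>_schwartz] by blast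
  then have B: "cmod (\<gamma> x) \<le> B" for x by simp
  have "integrable lborel (\<lambda>x. (cmod (\<gamma> x))\<^sup>2)"
    using integrable_norm[OF integrable_mult_bounded[OF schwartz_integrable[OF \<gamma>_schwartz] \<gamma>_measurable B]]
    by (simp add: norm_mult power2_eq_square)
  then obtain G where G: "(\<integral>\<^sup>+x. ennreal ((cmod (\<gamma> x))\<^sup>2) \<partial>lborel) = ennreal G" and "0 \<le> G"
    using that[of "\<integral>x. (cmod (\<gamma> x))\<^sup>2 \<partial>lborel"] by (simp add: nn_integral_eq_integral)
  have "(\<integral>\<^sup>+z. ennreal ((cmod (local_stft_sum J h z))\<^sup>2) \<partial>lborel2)
      \<le> ennreal (G * C) * (\<Sum>j<J. \<integral>\<^sup>+y. ennreal ((cmod (h j y))\<^sup>2) \<partial>lborel)"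
    if h: "\<And>j. integrable lborel (h j)" for J h
  proof -
    have [measurable]: "h j \<in> borel_measurable borel" for j using h[of j] by auto
    have [measurable]: "(\<lambda>(\<omega>, x). local_stft j (h j) x \<omega>) \<in> borel_measurable lborel2" for j
      by (rule local_stft_measurable) measurable
    define S where "S \<xi> = (\<Sum>j<J. fat j \<xi> * fourier (h j) \<xi>)" for \<xi>
    have [measurable]: "S \<in> borel_measurable borel" unfolding S_def[abs_def] by measurable
    let ?H = "\<lambda>\<omega> \<xi>. \<gamma> (\<xi> - \<omega>) * S \<xi>"
    have fat_fourier: "cmod (fat j \<xi> * fourier (h j) \<xi>) \<le> M * (\<integral>x. cmod (h j x) \<partial>lborel)" for j \<xi>
      unfolding norm_mult by (intro mult_mono M norm_fourier_le) (use \<open>0 \<le> M\<close> in auto)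
    have S_bound: "cmod (S \<xi>) \<le> (\<Sum>j<J. M * (\<integral>x. cmod (h j x) \<partial>lborel))" for \<xi>
      unfolding S_def by (intro order_trans[OF norm_sum] sum_mono fat_fourier)
    have \<gamma>_shift: "integrable lborel (\<lambda>\<xi>. \<gamma> (\<xi> - \<omega>))" for \<omega>
      using integrable_lborel_isometry[OF schwartz_integrable[OF \<gamma>_schwartz], of 1 "- \<omega>"] by simp
    have int: "integrable lborel (\<lambda>\<xi>. \<gamma> (\<xi> - \<omega>) * (fat j \<xi> * fourier (h j) \<xi>))" for j \<omega>
      by (rule integrable_mult_bounded[OF \<gamma>_shift _ fat_fourier]) measurable
    have intS: "integrable lborel (\<lambda>\<xi>. \<gamma> (\<xi> - \<omega>) * S \<xi>)" for \<omega>
      by (rule integrable_mult_bounded[OF \<gamma>_shift _ S_bound]) measurable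
    have sum_eq: "(\<Sum>j<J. local_stft j (h j) x \<omega>) = wave x \<omega> * inv_fourier (?H \<omega>) x" for x \<omega>
    proof -
      have "inv_fourier (?H \<omega>) x
        = (\<integral>\<xi>. (\<Sum>j<J. \<gamma> (\<xi> - \<omega>) * (fat j \<xi> * fourier (h j) \<xi>) * cis (2 * pi * (x \<bullet> \<xi>))) \<partial>lborel)"
        unfolding inv_fourier_def S_def by (simp add: sum_distrib_left sum_distrib_right)
      also have "\<dots> = (\<Sum>j<J. \<integral>\<xi>. \<gamma> (\<xi> - \<omega>) * (fat j \<xi> * fourier (h j) \<xi>) * cis (2 * pi * (x \<bullet> \<xi>)) \<partial>lborel)"
        by (intro Bochner_Integration.integral_sum integrable_mult_bounded[where B=1, OF int]) auto
      finally show ?thesis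
        by (simp add: local_stft_fourier[OF h] inv_fourier_def sum_distrib_left mult_ac)
    qed
    have "(\<integral>\<^sup>+z. ennreal ((cmod (local_stft_sum J h z))\<^sup>2) \<partial>lborel2)
      = (\<integral>\<^sup>+\<omega>. (\<integral>\<^sup>+x. ennreal ((cmod (\<Sum>j<J. local_stft j (h j) x \<omega>))\<^sup>2) \<partial>lborel) \<partial>lborel)"
      by (subst lborel.nn_integral_fst[symmetric]) (auto simp: case_prod_unfold)
    also have "\<dots> = (\<integral>\<^sup>+\<omega>. (\<integral>\<^sup>+x. ennreal ((cmod (fourier (?H \<omega>) (- x)))\<^sup>2) \<partial>lborel) \<partial>lborel)"
      unfolding sum_eq inv_fourier_eq by (simp add: norm_mult)
    also have "\<dots> = (\<integral>\<^sup>+\<omega>. (\<integral>\<^sup>+x. ennreal ((cmod (fourier (?H \<omega>) x))\<^sup>2) \<partial>lborel) \<partial>lborel)"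
    proof (rule nn_integral_cong)
      fix \<omega>
      show "(\<integral>\<^sup>+x. ennreal ((cmod (fourier (?H \<omega>) (- x)))\<^sup>2) \<partial>lborel)
        = (\<integral>\<^sup>+x. ennreal ((cmod (fourier (?H \<omega>) x))\<^sup>2) \<partial>lborel)"
        using nn_integral_lborel_isometry[of "\<lambda>x. ennreal ((cmod (fourier (?H \<omega>) x))\<^sup>2)" "-1" 0]
        by simp
    qed
    also have "\<dots> \<le> (\<integral>\<^sup>+\<omega>. (\<integral>\<^sup>+\<xi>. ennreal ((cmod (\<gamma> (\<xi> - \<omega>) * S \<xi>))\<^sup>2) \<partial>lborel) \<partial>lborel)"
      by (rule nn_integral_mono) (rule bessel[OF intS])
    also have "\<dots> = (\<integral>\<^sup>+\<xi>. (\<integral>\<^sup>+\<omega>. ennreal ((cmod (\<gamma> (\<xi> - \<omega>) * S \<xi>))\<^sup>2) \<partial>lborel) \<partial>lborel)"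
      by (rule lborel_pair.Fubini') measurable
    also have "\<dots> = (\<integral>\<^sup>+\<xi>. ennreal G * ennreal ((cmod (S \<xi>))\<^sup>2) \<partial>lborel)"
    proof (rule nn_integral_cong)
      fix \<xi>
      have "(\<integral>\<^sup>+\<omega>. ennreal ((cmod (\<gamma> (\<xi> - \<omega>) * S \<xi>))\<^sup>2) \<partial>lborel)
        = (\<integral>\<^sup>+\<omega>. ennreal ((cmod (\<gamma> (\<xi> - \<omega>)))\<^sup>2) \<partial>lborel) * ennreal ((cmod (S \<xi>))\<^sup>2)"
        by (subst nn_integral_multc[symmetric]) (auto simp: norm_mult power_mult_distrib ennreal_mult)
      also have "(\<integral>\<^sup>+\<omega>. ennreal ((cmod (\<gamma> (\<xi> - \<omega>)))\<^sup>2) \<partial>lborel) = ennreal G"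
        using nn_integral_lborel_isometry[of "\<lambda>\<omega>. ennreal ((cmod (\<gamma> \<omega>))\<^sup>2)" "-1" \<xi>] G by simp
      finally show "(\<integral>\<^sup>+\<omega>. ennreal ((cmod (\<gamma> (\<xi> - \<omega>) * S \<xi>))\<^sup>2) \<partial>lborel) = ennreal G * ennreal ((cmod (S \<xi>))\<^sup>2)" .
    qed
    also have "\<dots> \<le> (\<integral>\<^sup>+\<xi>. ennreal G * (ennreal C * (\<Sum>j<J. ennreal ((cmod (fourier (h j) \<xi>))\<^sup>2))) \<partial>lborel)"
    proof (rule nn_integral_mono)
      fix \<xi>
      \<comment> \<open>Cauchy-Schwarz collects the cut-offs in one factor, which finite overlap
        bounds independently of J.\<close>
      have "(cmod (S \<xi>))\<^sup>2 \<le> (\<Sum>j<J. cmod (fat j \<xi>) * cmod (fourier (h j) \<xi>))\<^sup>2"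
        unfolding S_def by (intro power_mono order_trans[OF norm_sum] sum_mono) (auto simp: norm_mult)
      also have "\<dots> \<le> (\<Sum>j<J. (cmod (fat j \<xi>))\<^sup>2) * (\<Sum>j<J. (cmod (fourier (h j) \<xi>))\<^sup>2)"
        by (rule Cauchy_Schwarz_ineq_sum)
      also have "\<dots> \<le> C * (\<Sum>j<J. (cmod (fourier (h j) \<xi>))\<^sup>2)"
        by (intro mult_right_mono C sum_nonneg) auto
      finally have "ennreal ((cmod (S \<xi>))\<^sup>2) \<le> ennreal C * (\<Sum>j<J. ennreal ((cmod (fourier (h j) \<xi>))\<^sup>2))"
        using \<open>0 \<le> C\<close> by (simp add: sum_ennreal sum_nonneg ennreal_leI flip: ennreal_mult)
      then show "ennreal G * ennreal ((cmod (S \<xi>))\<^sup>2)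
          \<le> ennreal G * (ennreal C * (\<Sum>j<J. ennreal ((cmod (fourier (h j) \<xi>))\<^sup>2)))"
        by (rule mult_left_mono) simp
    qed
    also have "\<dots> = ennreal G * (ennreal C * (\<Sum>j<J. \<integral>\<^sup>+\<xi>. ennreal ((cmod (fourier (h j) \<xi>))\<^sup>2) \<partial>lborel))"
      by (simp add: nn_integral_cmult nn_integral_sum del: sum_ennreal)
    also have "\<dots> \<le> ennreal G * (ennreal C * (\<Sum>j<J. \<integral>\<^sup>+y. ennreal ((cmod (h j y))\<^sup>2) \<partial>lborel))"
      by (intro mult_left_mono sum_mono bessel h) auto
    finally show ?thesis
      using \<open>0 \<le> C\<close> \<open>0 \<le> G\<close> by (simp add: ennreal_mult mult.assoc)
  qed
  moreover have "0 \<le> G * C" using \<open>0 \<le> C\<close> \<open>0 \<le> G\<close> by simp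
  ultimately show ?thesis by blast
qed

end

section \<open>Marcinkiewicz interpolation\<close>

lemma nn_integral_powr_from_0:
  fixes a c :: real
  assumes "-1 < a" and "0 \<le> c"
  shows "(\<integral>\<^sup>+l. ennreal (if 0 \<le> l \<and> l \<le> c then l powr a else 0) \<partial>lborel) = ennreal (c powr (a + 1) / (a + 1))"
proof -
  have "((\<lambda>l. if l \<in> {0..c} then l powr a else 0) has_integral (c powr (a + 1) / (a + 1))) UNIV"
    unfolding has_integral_restrict_UNIV by (rule has_integral_powr_from_0[OF assms])
  from nn_integral_has_integral_lborel[OF _ _ this] show ?thesis by simp
qed

lemma nn_integral_powr_to_inf:
  fixes a c :: real
  assumes "a < -1" and "0 < c"
  shows "(\<integral>\<^sup>+l. ennreal (if c \<le> l then l powr a else 0) \<partial>lborel) = ennreal (c powr (a + 1) / - (a + 1))"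
proof -
  have "((\<lambda>l. if l \<in> {c..} then l powr a else 0) has_integral (- (c powr (a + 1)) / (a + 1))) UNIV"
    unfolding has_integral_restrict_UNIV by (rule has_integral_powr_to_inf[OF assms])
  moreover have "- (c powr (a + 1)) / (a + 1) = c powr (a + 1) / - (a + 1)"
    by (simp only: minus_divide_left[symmetric] divide_minus_right)
  ultimately have "((\<lambda>l. if l \<in> {c..} then l powr a else 0) has_integral (c powr (a + 1) / - (a + 1))) UNIV"
    by (simp only:)
  from nn_integral_has_integral_lborel[OF _ _ this] show ?thesis by simp
qed

text \<open>Integrate F^P = P 2^P \<integral> l^(P-1) dl over 0 <= l <= F/2 and exchange the
  integrals. The level is 2 l because F will be split into two parts, one of which must then reach
  l.\<close>

lemma nn_integral_layer_cake:
  fixes F :: "'b \<Rightarrow> real"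
  assumes N: "sigma_finite_measure N" and [measurable]: "F \<in> borel_measurable N"
    and F: "\<And>z. 0 \<le> F z" and P: "0 < P"
  shows "(\<integral>\<^sup>+z. ennreal (F z powr P) \<partial>N)
    = (\<integral>\<^sup>+l. ennreal (if 0 \<le> l then P * 2 powr P * l powr (P - 1) else 0) * emeasure N {z\<in>space N. 2 * l \<le> F z} \<partial>lborel)"
proof -
  interpret N: sigma_finite_measure N by (rule N)
  interpret pair_sigma_finite N "lborel :: real measure" ..
  let ?w = "\<lambda>l. ennreal (if 0 \<le> l then P * 2 powr P * l powr (P - 1) else 0)"
  let ?G = "\<lambda>z l. ennreal (if 0 \<le> l \<and> 2 * l \<le> F z then P * 2 powr P * l powr (P - 1) else 0)"
  have "ennreal (F z powr P) = (\<integral>\<^sup>+l. ?G z l \<partial>lborel)" for z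
  proof -
    have "(\<integral>\<^sup>+l. ?G z l \<partial>lborel)
      = (\<integral>\<^sup>+l. ennreal (P * 2 powr P) * ennreal (if 0 \<le> l \<and> l \<le> F z / 2 then l powr (P - 1) else 0) \<partial>lborel)"
      using P by (intro nn_integral_cong) (auto simp flip: ennreal_mult)
    also have "\<dots> = ennreal (P * 2 powr P) * ennreal ((F z / 2) powr P / P)"
      using nn_integral_powr_from_0[of "P - 1" "F z / 2"] F[of z] P by (simp add: nn_integral_cmult)
    also have "\<dots> = ennreal (F z powr P)"
      using F[of z] P by (simp add: powr_divide flip: ennreal_mult)
    finally show ?thesis ..
  qed
  then have "(\<integral>\<^sup>+z. ennreal (F z powr P) \<partial>N) = (\<integral>\<^sup>+z. (\<integral>\<^sup>+l. ?G z l \<partial>lborel) \<partial>N)"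
    by simp
  also have "\<dots> = (\<integral>\<^sup>+l. (\<integral>\<^sup>+z. ?G z l \<partial>N) \<partial>lborel)"
    by (rule Fubini'[symmetric]) measurable
  also have "\<dots> = (\<integral>\<^sup>+l. ?w l * emeasure N {z\<in>space N. 2 * l \<le> F z} \<partial>lborel)"
  proof (rule nn_integral_cong)
    fix l :: real
    have "(\<integral>\<^sup>+z. ?G z l \<partial>N) = (\<integral>\<^sup>+z. ?w l * indicator {z\<in>space N. 2 * l \<le> F z} z \<partial>N)"
      by (intro nn_integral_cong) (auto simp: indicator_def)
    also have "\<dots> = ?w l * emeasure N {z\<in>space N. 2 * l \<le> F z}"
      by (rule nn_integral_cmult_indicator) measurable
    finally show "(\<integral>\<^sup>+z. ?G z l \<partial>N) = ?w l * emeasure N {z\<in>space N. 2 * l \<le> F z}" .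
  qed
  finally show ?thesis .
qed

text \<open>The level at which a function is split may depend on the component: component \<open>j\<close> is cut at
  height \<open>A\<^sub>j \<lambda>\<close>. This turns the norm \<open>A\<^sub>j\<close> of the \<open>L\<^sup>1\<close> estimate into the factor \<open>A\<^sub>j\<^sup>2\<^sup>-\<^sup>P\<close>.\<close>

lemma marcinkiewicz:
  fixes F :: "'b \<Rightarrow> real" and k :: "nat \<Rightarrow> 'a::euclidean_space \<Rightarrow> real"
  assumes N: "sigma_finite_measure N" and [measurable]: "F \<in> borel_measurable N"
    and F: "\<And>z. 0 \<le> F z" and P: "1 < P" "P < 2" and B: "0 \<le> B"
    and [measurable]: "\<And>j. k j \<in> borel_measurable borel" and k: "\<And>j y. 0 \<le> k j y"
    and A: "\<And>j. 0 < A j"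
    and split: "\<And>l. 0 < l \<Longrightarrow> \<exists>F0 F1. F0 \<in> borel_measurable N \<and> F1 \<in> borel_measurable N \<and>
      (\<forall>z. 0 \<le> F0 z \<and> 0 \<le> F1 z \<and> F z \<le> F0 z + F1 z) \<and>
      (\<integral>\<^sup>+z. ennreal (F0 z) \<partial>N) \<le> ennreal B * (\<Sum>j<J. ennreal (A j) * (\<integral>\<^sup>+y. ennreal (if A j * l < k j y then k j y else 0) \<partial>lborel)) \<and>
      (\<integral>\<^sup>+z. ennreal ((F1 z)\<^sup>2) \<partial>N) \<le> ennreal B * (\<Sum>j<J. \<integral>\<^sup>+y. ennreal (if k j y \<le> A j * l then (k j y)\<^sup>2 else 0) \<partial>lborel)"
  shows "(\<integral>\<^sup>+z. ennreal (F z powr P) \<partial>N) \<le> ennreal (P * 2 powr P * B * (1 / (P - 1) + 1 / (2 - P)))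
    * (\<Sum>j<J. ennreal (A j powr (2 - P)) * (\<integral>\<^sup>+y. ennreal (k j y powr P) \<partial>lborel))"
proof -
  let ?lev = "\<lambda>l. {z\<in>space N. 2 * l \<le> F z}"
  let ?w = "\<lambda>l. ennreal (if 0 \<le> l then P * 2 powr P * l powr (P - 1) else 0)"
  let ?a = "\<lambda>j. ennreal (A j powr (1 - P) / (P - 1))" and ?b = "\<lambda>j. ennreal (A j powr (2 - P) / (2 - P))"
  let ?k = "\<lambda>j y. ennreal (k j y powr P)"
  let ?u = "\<lambda>j l y. if A j * l < k j y then k j y else 0"
  let ?v = "\<lambda>j l y. if k j y \<le> A j * l then (k j y)\<^sup>2 else 0"
  define U where "U j l = (\<integral>\<^sup>+y. ennreal (?u j l y) \<partial>lborel)" for j and l :: real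
  define V where "V j l = (\<integral>\<^sup>+y. ennreal (?v j l y) \<partial>lborel)" for j and l :: real
  have [measurable]: "U j \<in> borel_measurable borel" "V j \<in> borel_measurable borel" for j
    unfolding U_def[abs_def] V_def[abs_def] by measurable
  define K where "K j = (\<integral>\<^sup>+y. ?k j y \<partial>lborel)" for j
  let ?p = "\<lambda>a l. ennreal (if 0 < l then l powr a else 0)"
  let ?s = "\<lambda>l. \<Sum>j<J. ennreal (A j) * (ennreal (1 / l) * U j l) + ennreal (1 / l\<^sup>2) * V j l"
  \<comment> \<open>Where F is at least 2 l, one of the two parts is at least l. Chebyshev's
    inequality is used with the first power of F0 and with the square of F1.\<close>
  have level: "emeasure N (?lev l)
      \<le> ennreal B * ?s l" if l: "0 < l" for l
  proof -
    obtain F0 F1 where [measurable]: "F0 \<in> borel_measurable N" "F1 \<in> borel_measurable N"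
      and nn: "\<And>z. 0 \<le> F0 z" "\<And>z. 0 \<le> F1 z" and le: "\<And>z. F z \<le> F0 z + F1 z"
      and F0: "(\<integral>\<^sup>+z. ennreal (F0 z) \<partial>N) \<le> ennreal B * (\<Sum>j<J. ennreal (A j) * U j l)"
      and F1: "(\<integral>\<^sup>+z. ennreal ((F1 z)\<^sup>2) \<partial>N) \<le> ennreal B * (\<Sum>j<J. V j l)"
      using split[OF l] unfolding U_def V_def by blast
    have "emeasure N (?lev l) = (\<integral>\<^sup>+z. indicator (?lev l) z \<partial>N)"
      by (rule nn_integral_indicator[symmetric]) measurable
    also have "\<dots> \<le> (\<integral>\<^sup>+z. ennreal (1 / l) * ennreal (F0 z) + ennreal (1 / l\<^sup>2) * ennreal ((F1 z)\<^sup>2) \<partial>N)"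
    proof (rule nn_integral_mono)
      fix z
      have "1 \<le> F0 z / l + (F1 z)\<^sup>2 / l\<^sup>2" if "2 * l \<le> F z"
      proof -
        from that le[of z] have "l \<le> F0 z \<or> l \<le> F1 z" by linarith
        then show ?thesis
        proof
          assume "l \<le> F0 z"
          then have "1 \<le> F0 z / l" using l by simp
          moreover have "0 \<le> (F1 z)\<^sup>2 / l\<^sup>2" by simp
          ultimately show ?thesis by linarith
        next
          assume "l \<le> F1 z"
          then have "l\<^sup>2 \<le> (F1 z)\<^sup>2" using l by (intro power_mono) auto
          then have "1 \<le> (F1 z)\<^sup>2 / l\<^sup>2" using l by simp
          moreover have "0 \<le> F0 z / l" using l nn by simp
          ultimately show ?thesis by linarith
        qed
      qed
      then have "ennreal (indicator (?lev l) z) \<le> ennreal (F0 z / l + (F1 z)\<^sup>2 / l\<^sup>2)"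
        using l nn by (intro ennreal_leI) (auto simp: indicator_def)
      also have "\<dots> = ennreal (1 / l) * ennreal (F0 z) + ennreal (1 / l\<^sup>2) * ennreal ((F1 z)\<^sup>2)"
        using l nn by (simp flip: ennreal_mult ennreal_plus)
      finally show "indicator (?lev l) z \<le> ennreal (1 / l) * ennreal (F0 z) + ennreal (1 / l\<^sup>2) * ennreal ((F1 z)\<^sup>2)"
        unfolding ennreal_indicator .
    qed
    also have "\<dots> = ennreal (1 / l) * (\<integral>\<^sup>+z. ennreal (F0 z) \<partial>N) + ennreal (1 / l\<^sup>2) * (\<integral>\<^sup>+z. ennreal ((F1 z)\<^sup>2) \<partial>N)"
      by (simp add: nn_integral_add nn_integral_cmult)
    also have "\<dots> \<le> ennreal (1 / l) * (ennreal B * (\<Sum>j<J. ennreal (A j) * U j l)) + ennreal (1 / l\<^sup>2) * (ennreal B * (\<Sum>j<J. V j l))"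
      by (intro add_mono mult_left_mono F0 F1) auto
    also have "\<dots> = ennreal B * ?s l"
      by (simp add: sum.distrib sum_distrib_left distrib_left mult_ac)
    finally show ?thesis .
  qed
  \<comment> \<open>For fixed y the large part is present as long as l is below k_j(y) / A_j, and
    l^(P-2) is integrable at 0 because P > 1.\<close>
  have U_int: "(\<integral>\<^sup>+l. ?p (P - 2) l * U j l \<partial>lborel) \<le> ?a j * K j" for j
  proof -
    have "(\<integral>\<^sup>+l. ?p (P - 2) l * U j l \<partial>lborel)
      = (\<integral>\<^sup>+l. (\<integral>\<^sup>+y. ?p (P - 2) l * ennreal (?u j l y) \<partial>lborel) \<partial>lborel)"
      unfolding U_def by (intro nn_integral_cong nn_integral_cmult[symmetric]) measurable
    also have "\<dots> = (\<integral>\<^sup>+y. (\<integral>\<^sup>+l. ?p (P - 2) l * ennreal (?u j l y) \<partial>lborel) \<partial>lborel)"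
      by (rule lborel_pair.Fubini') measurable
    also have "\<dots> \<le> (\<integral>\<^sup>+y. ?a j * ?k j y \<partial>lborel)"
    proof (rule nn_integral_mono)
      fix y
      have "(\<integral>\<^sup>+l. ?p (P - 2) l * ennreal (?u j l y) \<partial>lborel)
        \<le> (\<integral>\<^sup>+l. ennreal (k j y) * ennreal (if 0 \<le> l \<and> l \<le> k j y / A j then l powr (P - 2) else 0) \<partial>lborel)"
        using A[of j] k[of j y] by (intro nn_integral_mono) (auto simp: field_simps simp flip: ennreal_mult)
      also have "\<dots> = ennreal (k j y) * ennreal ((k j y / A j) powr (P - 1) / (P - 1))"
        using nn_integral_powr_from_0[of "P - 2" "k j y / A j"] A[of j] k[of j y] P by (simp add: nn_integral_cmult)
      also have "\<dots> = ennreal (k j y * ((k j y / A j) powr (P - 1) / (P - 1)))"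
        using k[of j y] P by (subst ennreal_mult) auto
      also have "k j y * ((k j y / A j) powr (P - 1) / (P - 1)) = A j powr (1 - P) / (P - 1) * k j y powr P"
      proof (cases "k j y = 0")
        case False
        then have "0 < k j y" using k[of j y] by simp
        then have "k j y * k j y powr (P - 1) = k j y powr P"
          using powr_mult_base[of "k j y" "P - 1"] by simp
        moreover have "(k j y / A j) powr (P - 1) = k j y powr (P - 1) * A j powr (1 - P)"
          using A[of j] k[of j y] powr_minus_divide[of "A j" "P - 1"] by (simp add: powr_divide)
        ultimately show ?thesis by (simp add: mult_ac)
      qed simp
      also have "ennreal \<dots> = ?a j * ?k j y"
        using P by (intro ennreal_mult) auto
      finally show "(\<integral>\<^sup>+l. ?p (P - 2) l * ennreal (?u j l y) \<partial>lborel)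
        \<le> ?a j * ?k j y" .
    qed
    also have "\<dots> = ?a j * K j"
      unfolding K_def by (rule nn_integral_cmult) measurable
    finally show ?thesis .
  qed
  \<comment> \<open>The small part is present from l = k_j(y) / A_j on, and l^(P-3) is integrable at
    infinity because P < 2.\<close>
  have V_int: "(\<integral>\<^sup>+l. ?p (P - 3) l * V j l \<partial>lborel) \<le> ?b j * K j" for j
  proof -
    have "(\<integral>\<^sup>+l. ?p (P - 3) l * V j l \<partial>lborel)
      = (\<integral>\<^sup>+l. (\<integral>\<^sup>+y. ?p (P - 3) l * ennreal (?v j l y) \<partial>lborel) \<partial>lborel)"
      unfolding V_def by (intro nn_integral_cong nn_integral_cmult[symmetric]) measurable
    also have "\<dots> = (\<integral>\<^sup>+y. (\<integral>\<^sup>+l. ?p (P - 3) l * ennreal (?v j l y) \<partial>lborel) \<partial>lborel)"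
      by (rule lborel_pair.Fubini') measurable
    also have "\<dots> \<le> (\<integral>\<^sup>+y. ?b j * ?k j y \<partial>lborel)"
    proof (rule nn_integral_mono)
      fix y
      show "(\<integral>\<^sup>+l. ?p (P - 3) l * ennreal (?v j l y) \<partial>lborel)
        \<le> ?b j * ?k j y"
      \<comment> \<open>At a zero of k the l-integral would start at 0, where l^(P-3) is not
        integrable, but the integrand itself vanishes.\<close>
      proof (cases "k j y = 0")
        case True
        have "(\<integral>\<^sup>+l. ?p (P - 3) l * ennreal (?v j l y) \<partial>lborel) = (\<integral>\<^sup>+(l::real). 0 \<partial>lborel)"
          by (intro nn_integral_cong) (simp add: True)
        then show ?thesis by simp
      next
        case False
        then have pos: "0 < k j y" using k[of j y] by simp
        have "(\<integral>\<^sup>+l. ?p (P - 3) l * ennreal (?v j l y) \<partial>lborel)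
          \<le> (\<integral>\<^sup>+l. ennreal ((k j y)\<^sup>2) * ennreal (if k j y / A j \<le> l then l powr (P - 3) else 0) \<partial>lborel)"
          using A[of j] pos by (intro nn_integral_mono) (auto simp: field_simps simp flip: ennreal_mult)
        also have "\<dots> = ennreal ((k j y)\<^sup>2) * ennreal ((k j y / A j) powr (P - 2) / (2 - P))"
          using nn_integral_powr_to_inf[of "P - 3" "k j y / A j"] A[of j] pos P by (simp add: nn_integral_cmult)
        also have "\<dots> = ennreal ((k j y)\<^sup>2 * ((k j y / A j) powr (P - 2) / (2 - P)))"
          using P by (subst ennreal_mult) auto
        also have "(k j y)\<^sup>2 * ((k j y / A j) powr (P - 2) / (2 - P)) = A j powr (2 - P) / (2 - P) * k j y powr P"
        proof -
          have "(k j y)\<^sup>2 * k j y powr (P - 2) = k j y powr P"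
            using pos powr_add[of "k j y" 2 "P - 2"] by (simp add: powr_numeral)
          moreover have "(k j y / A j) powr (P - 2) = k j y powr (P - 2) * A j powr (2 - P)"
            using A[of j] pos powr_minus_divide[of "A j" "P - 2"] by (simp add: powr_divide)
          ultimately show ?thesis by (simp add: mult_ac)
        qed
        also have "ennreal \<dots> = ?b j * ?k j y"
          using P by (intro ennreal_mult) auto
        finally show ?thesis .
      qed
    qed
    also have "\<dots> = ?b j * K j"
      unfolding K_def by (rule nn_integral_cmult) measurable
    finally show ?thesis .
  qed
  let ?c = "P * 2 powr P * B"
  have c: "0 \<le> ?c" using P B by simp
  have "(\<integral>\<^sup>+z. ennreal (F z powr P) \<partial>N)
    = (\<integral>\<^sup>+l. ?w l * emeasure N (?lev l) \<partial>lborel)"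
    using P by (intro nn_integral_layer_cake N F) auto
  also have "\<dots> \<le> (\<integral>\<^sup>+l. ennreal ?c * (\<Sum>j<J. ennreal (A j) * (?p (P - 2) l * U j l) + ?p (P - 3) l * V j l) \<partial>lborel)"
  proof (rule nn_integral_mono)
    fix l :: real
    show "?w l * emeasure N (?lev l)
      \<le> ennreal ?c * (\<Sum>j<J. ennreal (A j) * (?p (P - 2) l * U j l) + ?p (P - 3) l * V j l)"
    proof (cases "0 < l")
      case l: True
      have p1: "ennreal (l powr (P - 1)) * ennreal (1 / l) = ?p (P - 2) l"
        using l powr_diff[of l "P - 1" 1] by (simp flip: ennreal_mult add: algebra_simps)
      have p2: "ennreal (l powr (P - 1)) * ennreal (1 / l\<^sup>2) = ?p (P - 3) l"
        using l powr_diff[of l "P - 1" 2] by (simp flip: ennreal_mult add: algebra_simps powr_numeral)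
      have "?w l * emeasure N (?lev l)
        \<le> ennreal (P * 2 powr P * l powr (P - 1)) * (ennreal B * ?s l)"
        using l by (intro mult_mono level) auto
      also have "\<dots> = ennreal ?c * (\<Sum>j<J. ennreal (A j) * (ennreal (l powr (P - 1)) * ennreal (1 / l) * U j l)
          + ennreal (l powr (P - 1)) * ennreal (1 / l\<^sup>2) * V j l)"
        using P B by (simp add: ennreal_mult sum_distrib_left distrib_left mult_ac)
      finally show ?thesis unfolding p1 p2 .
    qed auto
  qed
  also have "\<dots> = ennreal ?c * (\<Sum>j<J. ennreal (A j) * (\<integral>\<^sup>+l. ?p (P - 2) l * U j l \<partial>lborel) + (\<integral>\<^sup>+l. ?p (P - 3) l * V j l \<partial>lborel))"
    by (simp add: nn_integral_cmult nn_integral_sum nn_integral_add)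
  also have "\<dots> \<le> ennreal ?c * (\<Sum>j<J. ennreal (A j) * (?a j * K j) + ?b j * K j)"
    by (intro mult_left_mono sum_mono add_mono U_int V_int) auto
  also have "\<dots> = ennreal ?c * (\<Sum>j<J. ennreal (1 / (P - 1) + 1 / (2 - P)) * (ennreal (A j powr (2 - P)) * K j))"
  proof (intro arg_cong2[where f="(*)"] refl sum.cong)
    fix j
    \<comment> \<open>The norm A_j of the L^1 estimate raises the exponent 1 - P to the 2 - P that
      the square part already has. The split height A_j l is chosen to make these two weights
      agree.\<close>
    have "A j * A j powr (1 - P) = A j powr (2 - P)"
      using A[of j] powr_mult_base[of "A j" "1 - P"] by simp
    then have "ennreal (A j) * ?a j = ennreal (A j powr (2 - P) / (P - 1))"
      using A[of j] P by (simp flip: ennreal_mult)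
    then have "ennreal (A j) * (?a j * K j) + ?b j * K j
      = (ennreal (A j powr (2 - P) / (P - 1)) + ?b j) * K j"
      by (simp add: distrib_right mult.assoc[symmetric])
    also have "ennreal (A j powr (2 - P) / (P - 1)) + ?b j
      = ennreal (1 / (P - 1) + 1 / (2 - P)) * ennreal (A j powr (2 - P))"
      using P by (simp add: distrib_right flip: ennreal_mult ennreal_plus)
    finally show "ennreal (A j) * (?a j * K j) + ?b j * K j
      = ennreal (1 / (P - 1) + 1 / (2 - P)) * (ennreal (A j powr (2 - P)) * K j)"
      by (simp add: mult.assoc)
  qed
  also have "\<dots> = ennreal (?c * (1 / (P - 1) + 1 / (2 - P))) * (\<Sum>j<J. ennreal (A j powr (2 - P)) * K j)"
  proof -
    have "ennreal (?c * (1 / (P - 1) + 1 / (2 - P))) = ennreal ?c * ennreal (1 / (P - 1) + 1 / (2 - P))"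
      using P by (intro ennreal_mult c) auto
    then show ?thesis by (simp only: sum_distrib_left mult.assoc)
  qed
  finally show ?thesis unfolding K_def .
qed

section \<open>Interpolation for the localised transforms\<close>

context dyadic_window
begin

lemma local_stft_sum_measurable [measurable]:
  assumes "\<And>j. h j \<in> borel_measurable borel"
  shows "(\<lambda>z. \<Sum>j<J. local_stft j (h j) (snd z) (fst z)) \<in> borel_measurable lborel2"
proof (rule borel_measurable_sum)
  show "(\<lambda>z. local_stft j (h j) (snd z) (fst z)) \<in> borel_measurable lborel2" for j
    using local_stft_measurable[OF assms, of j] unfolding case_prod_unfold .
qed

lemma sigma_finite_pair: "sigma_finite_measure lborel2"
  unfolding lborel_prod by (rule sigma_finite_lborel)

text \<open>At P = 1 and P = 2 the two integral estimates apply as they are, since the constant of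
  the interpolation blows up there. In between, \<open>marcinkiewicz\<close> is applied to the
  modulus of the sum, with A_j = 2^(jd).\<close>

lemma nn_integral_powr_local_stft_integrable:
  assumes P: "1 \<le> P" "P \<le> 2"
  shows "\<exists>C\<ge>0. \<forall>J h. (\<forall>j. integrable lborel (h j)) \<longrightarrow>
    stft_power P J h
      \<le> ennreal C * weighted_norms P J h"
proof -
  obtain C1 where "0 \<le> C1" and C1: "\<And>j h. h \<in> borel_measurable borel \<Longrightarrow>
    (\<integral>\<^sup>+z. ennreal (cmod (local_stft j h (snd z) (fst z))) \<partial>lborel2)
      \<le> ennreal (C1 * (2 ^ j) ^ DIM('a)) * (\<integral>\<^sup>+y. ennreal (cmod (h y)) \<partial>lborel)"
    using nn_integral_local_stft by blast
  obtain C2 where C2': "0 \<le> C2 \<and> (\<forall>J h. (\<forall>j. integrable lborel (h j)) \<longrightarrow>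
    (\<integral>\<^sup>+z. ennreal ((cmod (local_stft_sum J h z))\<^sup>2) \<partial>lborel2)
      \<le> ennreal C2 * (\<Sum>j<J. \<integral>\<^sup>+y. ennreal ((cmod (h j y))\<^sup>2) \<partial>lborel))"
    using nn_integral_square_local_stft by (rule exE)
  then have "0 \<le> C2" ..
  note C2 = conjunct2[OF C2', rule_format]
  let ?A = "\<lambda>j. (2 ^ j) ^ DIM('a) :: real"
  have L1: "(\<integral>\<^sup>+z. ennreal (cmod (local_stft_sum J h z)) \<partial>lborel2)
      \<le> ennreal C1 * (\<Sum>j<J. ennreal (?A j) * (\<integral>\<^sup>+y. ennreal (cmod (h j y)) \<partial>lborel))"
    if h: "\<And>j. integrable lborel (h j)" for J h
  proof -
    have hm: "h j \<in> borel_measurable borel" for j using h[of j] by auto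
    have [measurable]: "(\<lambda>z. local_stft j (h j) (snd z) (fst z)) \<in> borel_measurable lborel2" for j
      using local_stft_measurable[OF hm, of j] unfolding case_prod_unfold .
    have "(\<integral>\<^sup>+z. ennreal (cmod (local_stft_sum J h z)) \<partial>lborel2)
      \<le> (\<integral>\<^sup>+z. (\<Sum>j<J. ennreal (cmod (local_stft j (h j) (snd z) (fst z)))) \<partial>lborel2)"
      by (intro nn_integral_mono) (simp add: sum_ennreal ennreal_leI norm_sum)
    also have "\<dots> = (\<Sum>j<J. \<integral>\<^sup>+z. ennreal (cmod (local_stft j (h j) (snd z) (fst z))) \<partial>lborel2)"
      by (rule nn_integral_sum) measurable
    also have "\<dots> \<le> (\<Sum>j<J. ennreal (C1 * ?A j) * (\<integral>\<^sup>+y. ennreal (cmod (h j y)) \<partial>lborel))"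
      by (intro sum_mono C1 hm)
    also have "\<dots> = ennreal C1 * (\<Sum>j<J. ennreal (?A j) * (\<integral>\<^sup>+y. ennreal (cmod (h j y)) \<partial>lborel))"
      using \<open>0 \<le> C1\<close> by (simp add: ennreal_mult sum_distrib_left mult.assoc)
    finally show ?thesis .
  qed
  consider "P = 1" | "1 < P" "P < 2" | "P = 2" using P by linarith
  then show ?thesis
  proof cases
    case 1
    show ?thesis using L1 \<open>0 \<le> C1\<close> unfolding 1 by (intro exI[of _ C1]) (auto simp: powr_one)
  next
    case 3
    show ?thesis using C2 \<open>0 \<le> C2\<close> unfolding 3 by (intro exI[of _ C2]) (auto simp: powr_numeral)
  next
    case 2
    define B where "B = max C1 C2"
    have B: "0 \<le> B" "ennreal C1 \<le> ennreal B" "ennreal C2 \<le> ennreal B"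
      using \<open>0 \<le> C1\<close> by (auto simp: B_def intro: ennreal_leI)
    have "stft_power P J h
      \<le> ennreal (P * 2 powr P * B * (1 / (P - 1) + 1 / (2 - P))) *
        weighted_norms P J h"
      if h: "\<And>j. integrable lborel (h j)" for J h
    proof -
      have [measurable]: "h j \<in> borel_measurable borel" for j using h[of j] by auto
      show ?thesis
      proof (rule marcinkiewicz[OF sigma_finite_pair _ _ 2 B(1)], goal_cases)
        case (6 l)
        \<comment> \<open>The large values go to the L^1 estimate and the small ones to the L^2
          estimate. Both are pointwise bounded by h j, hence integrable, and linearity of the
          transform splits the sum.\<close>
        define h0 where "h0 j y = (if ?A j * l < cmod (h j y) then h j y else 0)" for j y
        define h1 where "h1 j y = (if cmod (h j y) \<le> ?A j * l then h j y else 0)" for j y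
        have [measurable]: "h0 j \<in> borel_measurable borel" "h1 j \<in> borel_measurable borel" for j
          unfolding h0_def[abs_def] h1_def[abs_def] by measurable
        have i0: "integrable lborel (h0 j)" and i1: "integrable lborel (h1 j)" for j
          by (rule Bochner_Integration.integrable_bound[OF h[of j]]; auto simp: h0_def h1_def)+
        have split: "h j = (\<lambda>y. h0 j y + h1 j y)" for j by (auto simp: h0_def h1_def fun_eq_iff)
        let ?F = "\<lambda>h z. cmod (local_stft_sum J h z)"
        have le: "?F h z \<le> ?F h0 z + ?F h1 z" for z
          unfolding split local_stft_add[OF i0 i1] sum.distrib by (rule norm_triangle_ineq)
        have F0: "(\<integral>\<^sup>+z. ennreal (?F h0 z) \<partial>lborel2)
          \<le> ennreal B * (\<Sum>j<J. ennreal (?A j) * (\<integral>\<^sup>+y. ennreal (if ?A j * l < cmod (h j y) then cmod (h j y) else 0) \<partial>lborel))"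
          using order_trans[OF L1[where h=h0 and J=J, OF i0] mult_right_mono[OF B(2)]]
          by (simp add: h0_def if_distrib[of cmod] cong: if_cong)
        have F1: "(\<integral>\<^sup>+z. ennreal ((?F h1 z)\<^sup>2) \<partial>lborel2)
          \<le> ennreal B * (\<Sum>j<J. \<integral>\<^sup>+y. ennreal (if cmod (h j y) \<le> ?A j * l then (cmod (h j y))\<^sup>2 else 0) \<partial>lborel)"
          using order_trans[OF C2[of h1 J, OF i1] mult_right_mono[OF B(3)]]
          by (simp add: h1_def if_distrib[of cmod] if_distrib[of "\<lambda>x. x\<^sup>2"] cong: if_cong)
        have meas: "?F h0 \<in> borel_measurable lborel2" "?F h1 \<in> borel_measurable lborel2"
          by measurable
        show ?case
          by (rule exI[of _ "?F h0"], rule exI[of _ "?F h1"]) (intro conjI allI norm_ge_zero meas le F0 F1)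
      qed auto
    qed
    moreover have "0 \<le> P * 2 powr P * B * (1 / (P - 1) + 1 / (2 - P))"
      using 2 B(1) by simp
    ultimately show ?thesis by blast
  qed
qed

end

section \<open>The embedding\<close>

lemma schwartz_scale:
  assumes "f \<in> schwartz"
  shows "(\<lambda>x. a * f x) \<in> schwartz"
  by (rule multiplier_mult_schwartz[OF multiplier_family_const[OF order_refl] assms])

lemma schwartz_lincomb:
  assumes "f \<in> schwartz" and "h \<in> schwartz"
  shows "(\<lambda>x. a * f x + b * h x) \<in> schwartz"
  using schwartz_family_add[of "\<lambda>_::unit. \<lambda>x. a * f x" "\<lambda>_. \<lambda>x. b * h x"] schwartz_scale[OF assms(1)] schwartz_scale[OF assms(2)]
  by (simp add: schwartz_iff_family)

lemma fourier_lincomb: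
  assumes "f \<in> schwartz" and "h \<in> schwartz"
  shows "fourier (\<lambda>x. a * f x + b * h x) = (\<lambda>\<omega>. a * fourier f \<omega> + b * fourier h \<omega>)"
proof
  fix \<omega>
  have i: "integrable lborel (\<lambda>x. f x * wave x \<omega>)" "integrable lborel (\<lambda>x. h x * wave x \<omega>)"
    by (rule integrable_fourier_integrand[OF schwartz_integrable] assms)+
  have "fourier (\<lambda>x. a * f x + b * h x) \<omega>
      = (\<integral>x. a * (f x * wave x \<omega>) + b * (h x * wave x \<omega>) \<partial>lborel)"
    unfolding fourier_def by (simp add: distrib_right mult.assoc)
  also have "\<dots> = a * fourier f \<omega> + b * fourier h \<omega>"
    unfolding fourier_def
    by (subst Bochner_Integration.integral_add[OF integrable_mult_right[OF i(1)] integrable_mult_right[OF i(2)]])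
       (simp only: integral_mult_right_zero)
  finally show "fourier (\<lambda>x. a * f x + b * h x) \<omega> = a * fourier f \<omega> + b * fourier h \<omega>" .
qed

lemma tempered_lincomb:
  "u \<in> tempered \<Longrightarrow> f \<in> schwartz \<Longrightarrow> h \<in> schwartz \<Longrightarrow> u (\<lambda>x. a * f x + b * h x) = a * u f + b * u h"
  unfolding tempered_def by blast

text \<open>Continuity of u is a bound by one seminorm, and that seminorm is uniformly bounded over
  the family.\<close>

lemma tempered_bounded_on_family:
  fixes f :: "'i \<Rightarrow> 'a::euclidean_space \<Rightarrow> complex"
  assumes "u \<in> tempered" and "schwartz_family f"
  shows "\<exists>C. \<forall>i. cmod (u (f i)) \<le> C"
proof -
  obtain C N where C: "\<And>f. f \<in> schwartz \<Longrightarrow> cmod (u f) \<le> C * schwartz_seminorm N f"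
    using assms(1) unfolding tempered_def by blast
  obtain D where D: "\<And>i. schwartz_seminorm N (f i) \<le> D"
    using schwartz_family_seminorm[OF assms(2)] by blast
  have nonneg: "0 \<le> schwartz_seminorm N (f i)" for i
    unfolding schwartz_seminorm_def
  proof (intro sum_nonneg)
    fix k and bs :: "'a list" assume "bs \<in> {bs. set bs \<subseteq> Basis \<and> length bs \<le> N}"
    then have "bdd_above (range (\<lambda>x. norm x ^ k * cmod (iter_deriv bs (f i) x)))"
      using schwartz_family_imp_schwartz[OF assms(2), of i] unfolding schwartz_def by auto
    then show "0 \<le> (SUP x. norm x ^ k * cmod (iter_deriv bs (f i) x))"
      by (rule cSUP_upper2[where x=0]) auto
  qed
  have "cmod (u (f i)) \<le> \<bar>C\<bar> * D" for i
  proof -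
    have "cmod (u (f i)) \<le> C * schwartz_seminorm N (f i)"
      by (rule C[OF schwartz_family_imp_schwartz[OF assms(2)]])
    also have "\<dots> \<le> \<bar>C\<bar> * schwartz_seminorm N (f i)"
      by (intro mult_right_mono nonneg) simp
    also have "\<dots> \<le> \<bar>C\<bar> * D"
      by (intro mult_left_mono D) simp
    finally show ?thesis .
  qed
  then show ?thesis by blast
qed

context dyadic_window
begin

lemma low_pass_schwartz:
  assumes "f \<in> schwartz"
  shows "(\<lambda>\<xi>. \<phi> ((1/2) ^ J *\<^sub>R \<xi>) * f \<xi>) \<in> schwartz"
proof -
  have "multiplier_family (\<lambda>_::unit. \<lambda>\<xi>. 1 * \<phi> (0 + (1/2) ^ J *\<^sub>R \<xi>))"
    by (rule multiplier_family_affine[where D=1 and k=0, OF _ \<phi>_schwartz]) (simp_all add: power_abs power_le_one)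
  from multiplier_mult_schwartz[OF this assms] show ?thesis by simp
qed

lemma dyadic_Suc: "dyadic \<phi> (Suc j) \<xi> = \<phi> ((1/2) ^ Suc j *\<^sub>R \<xi>) - \<phi> ((1/2) ^ j *\<^sub>R \<xi>)"
  by (simp add: dyadic_def)

lemma dyadic_mult_schwartz:
  assumes "f \<in> schwartz"
  shows "(\<lambda>\<xi>. dyadic \<phi> j \<xi> * f \<xi>) \<in> schwartz"
proof (cases j)
  case 0
  then show ?thesis using low_pass_schwartz[OF assms, of 0] by (simp add: dyadic_def)
next
  case (Suc i)
  show ?thesis
    using schwartz_lincomb[OF low_pass_schwartz[OF assms, of "Suc i"] low_pass_schwartz[OF assms, of i], of 1 "-1"]
    unfolding Suc dyadic_Suc by (simp add: left_diff_distrib)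
qed

lemma LP_block_apply:
  assumes f: "f \<in> schwartz"
  shows "LP_block \<phi> j u f = u (fourier (\<lambda>\<xi>. dyadic \<phi> j \<xi> * inv_fourier f \<xi>))"
  using f schwartz_inv_fourier[OF f] dyadic_mult_schwartz[OF schwartz_inv_fourier[OF f], of j]
  by (simp add: LP_block_def inv_fourier_dist_def mult_dist_def fourier_dist_def)

text \<open>Each dyadic function with j >= 1 is a difference of consecutive low-pass functions, so
  the sum telescopes; \<open>Suc J\<close> blocks, from 0 to J, leave the low-pass function of scale
  2^J.\<close>

lemma sum_LP_block:
  assumes u: "u \<in> tempered" and f: "f \<in> schwartz"
  shows "(\<Sum>j<Suc J. LP_block \<phi> j u f) = u (fourier (\<lambda>\<xi>. \<phi> ((1/2) ^ J *\<^sub>R \<xi>) * inv_fourier f \<xi>))"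
proof (induction J)
  case 0
  show ?case by (simp add: LP_block_apply[OF f] dyadic_def)
next
  case (Suc J)
  have f': "inv_fourier f \<in> schwartz" by (rule schwartz_inv_fourier[OF f])
  let ?low = "\<lambda>J \<xi>. \<phi> ((1/2) ^ J *\<^sub>R \<xi>) * inv_fourier f \<xi>"
  let ?d = "\<lambda>\<xi>. dyadic \<phi> (Suc J) \<xi> * inv_fourier f \<xi>"
  have "?low (Suc J) = (\<lambda>\<xi>. 1 * ?low J \<xi> + 1 * ?d \<xi>)"
    unfolding dyadic_Suc by (simp add: left_diff_distrib)
  then have "u (fourier (?low (Suc J))) = u (\<lambda>\<omega>. 1 * fourier (?low J) \<omega> + 1 * fourier ?d \<omega>)"
    using fourier_lincomb[OF low_pass_schwartz[OF f'] dyadic_mult_schwartz[OF f'], of 1 J 1 "Suc J"] by simp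
  also have "\<dots> = 1 * u (fourier (?low J)) + 1 * u (fourier ?d)"
    by (intro tempered_lincomb u schwartz_fourier low_pass_schwartz dyadic_mult_schwartz f')
  finally show ?case
    unfolding sum.lessThan_Suc[of _ "Suc J"] unfolding Suc.IH unfolding LP_block_apply[OF f] by simp
qed

text \<open>The error of the low-pass approximation is 2^(-J) times u at the transform of
  \<open>?r J\<close>. These form a Schwartz family, on which u is bounded, so the error is of order
  2^(-J).\<close>

lemma LP_block_sums:
  assumes u: "u \<in> tempered" and f: "f \<in> schwartz"
  shows "(\<lambda>J. \<Sum>j<J. LP_block \<phi> j u f) \<longlonglongrightarrow> u f"
proof -
  have f': "inv_fourier f \<in> schwartz" by (rule schwartz_inv_fourier[OF f])
  let ?low = "\<lambda>J \<xi>. \<phi> ((1/2) ^ J *\<^sub>R \<xi>) * inv_fourier f \<xi>"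
  let ?r = "\<lambda>J \<xi>. 2 ^ J * (\<phi> ((1/2) ^ J *\<^sub>R \<xi>) - 1) * inv_fourier f \<xi>"
  have r: "schwartz_family ?r"
    by (rule schwartz_family_mult[OF multiplier_family_low_pass[OF generator] schwartz_family_const[OF f']])
  obtain C where C: "\<And>J. cmod (u (fourier (?r J))) \<le> C"
    using tempered_bounded_on_family[OF u schwartz_family_fourier[OF r]] by blast
  have eq: "u (fourier (?low J)) = u f + (1/2) ^ J * u (fourier (?r J))" for J
  proof -
    have "?low J = (\<lambda>\<xi>. 1 * inv_fourier f \<xi> + (1/2) ^ J * ?r J \<xi>)"
      by (simp add: fun_eq_iff algebra_simps power_one_over)
    then have "u (fourier (?low J)) = u (\<lambda>\<omega>. 1 * fourier (inv_fourier f) \<omega> + (1/2) ^ J * fourier (?r J) \<omega>)"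
      using fourier_lincomb[OF f' schwartz_family_imp_schwartz[OF r], of 1 "(1/2) ^ J" J] by simp
    also have "\<dots> = 1 * u (fourier (inv_fourier f)) + (1/2) ^ J * u (fourier (?r J))"
      by (intro tempered_lincomb u schwartz_fourier f' schwartz_family_imp_schwartz[OF r])
    finally show ?thesis by (simp add: fourier_inv_fourier[OF f])
  qed
  have "(\<lambda>J. (1/2) ^ J * u (fourier (?r J))) \<longlonglongrightarrow> 0"
  proof (rule Lim_null_comparison)
    show "\<forall>\<^sub>F J in sequentially. norm ((1/2) ^ J * u (fourier (?r J))) \<le> (1/2) ^ J * C"
      by (intro always_eventually allI) (simp add: norm_mult norm_power norm_divide mult_left_mono C)
    have "(\<lambda>J. (1/2) ^ J * C) \<longlonglongrightarrow> 0 * C"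
      by (intro tendsto_intros LIMSEQ_realpow_zero) auto
    then show "(\<lambda>J. (1/2) ^ J * C) \<longlonglongrightarrow> 0" by simp
  qed
  then have "(\<lambda>J. u f + (1/2) ^ J * u (fourier (?r J))) \<longlonglongrightarrow> u f + 0"
    by (intro tendsto_intros)
  then have "(\<lambda>J. \<Sum>j<Suc J. LP_block \<phi> j u f) \<longlonglongrightarrow> u f"
    unfolding sum_LP_block[OF u f] eq by simp
  then show ?thesis by (rule LIMSEQ_imp_Suc)
qed

text \<open>The representing function may be paired with the kernel because the kernel is a Schwartz
  function. In the pairing, the cut-off in the kernel meets the dyadic function of the block and is
  absorbed by it, which leaves the plain window.\<close>

lemma local_stft_LP_block:
  assumes h: "represents h (LP_block \<phi> j u)"
  shows "local_stft j h x \<omega> = LP_block \<phi> j u (window_at x \<omega>)"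
proof -
  let ?w = "inv_fourier (window_at x \<omega>)"
  have w: "?w \<in> schwartz" by (rule schwartz_inv_fourier[OF window_at_schwartz])
  have "local_stft j h x \<omega> = LP_block \<phi> j u (kernel j x \<omega>)"
    using h kernel_schwartz unfolding represents_def local_stft_def by metis
  also have "\<dots> = u (fourier (\<lambda>\<xi>. dyadic \<phi> j \<xi> * (fat j \<xi> * ?w \<xi>)))"
    unfolding LP_block_apply[OF kernel_schwartz]
    unfolding kernel_def fourier_inversion[OF fat_mult_schwartz[OF w]] ..
  also have "\<dots> = LP_block \<phi> j u (window_at x \<omega>)"
    unfolding LP_block_apply[OF window_at_schwartz] mult.assoc[symmetric] dyadic_mult_fat ..
  finally show ?thesis .
qed

text \<open>Truncation in height and in radius makes the h j integrable without increasing their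
  norms. The localised transforms converge by dominated convergence, since h j times the kernel is
  integrable, and Fatou's lemma carries the estimate to the limit.\<close>

lemma nn_integral_powr_local_stft:
  assumes P: "1 \<le> P" "P \<le> 2"
  shows "\<exists>C\<ge>0. \<forall>J h. (\<forall>j. h j \<in> borel_measurable borel \<and> (\<forall>f\<in>schwartz. integrable lborel (\<lambda>x. h j x * f x))) \<longrightarrow>
    stft_power P J h
      \<le> ennreal C * weighted_norms P J h"
proof -
  obtain C where C': "0 \<le> C \<and> (\<forall>J h. (\<forall>j. integrable lborel (h j)) \<longrightarrow>
    stft_power P J h
      \<le> ennreal C * weighted_norms P J h)"
    using nn_integral_powr_local_stft_integrable[OF P] by (rule exE)
  note C = conjunct2[OF C', rule_format]
  have "stft_power P J h
      \<le> ennreal C * weighted_norms P J h"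
    if h[measurable]: "\<And>j. h j \<in> borel_measurable borel"
      and int: "\<And>j f. f \<in> schwartz \<Longrightarrow> integrable lborel (\<lambda>x. h j x * f x)" for J h
  proof -
    define t where "t n j y = (if cmod (h j y) \<le> real n \<and> norm y \<le> real n then h j y else 0)" for n j and y :: 'a
    have [measurable]: "t n j \<in> borel_measurable borel" for n j
      unfolding t_def[abs_def] by measurable
    have t_le: "cmod (t n j y) \<le> cmod (h j y)" for n j y
      by (simp add: t_def)
    have t_int: "integrable lborel (t n j)" for n j
    proof (rule Bochner_Integration.integrable_bound)
      show "integrable lborel (\<lambda>y::'a. real n * indicator (cball 0 (real n)) y)"
        by (intro integrable_mult_right integrable_real_indicator) (auto simp: emeasure_bounded_finite[OF bounded_cball, unfolded infinity_ennreal_def])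
      show "AE y in lborel. norm (t n j y) \<le> norm (real n * indicator (cball 0 (real n)) y)"
        by (intro AE_I2) (auto simp: t_def indicator_def)
    qed measurable
    have t_lim: "(\<lambda>n. t n j y) \<longlonglongrightarrow> h j y" for j y
    proof (rule tendsto_eventually)
      obtain n0 :: nat where "max (cmod (h j y)) (norm y) \<le> real n0"
        using real_arch_simple by blast
      then show "\<forall>\<^sub>F n in sequentially. t n j y = h j y"
        by (intro eventually_sequentiallyI[of n0]) (auto simp: t_def)
    qed
    have lim: "(\<lambda>n. local_stft j (t n j) x \<omega>) \<longlonglongrightarrow> local_stft j (h j) x \<omega>" for j x \<omega>
      unfolding local_stft_def
    proof (rule integral_dominated_convergence[where w="\<lambda>y. cmod (h j y * kernel j x \<omega> y)"])
      have [measurable]: "kernel j x \<omega> \<in> borel_measurable borel"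
        by (rule schwartz_measurable[OF kernel_schwartz])
      show "(\<lambda>y. h j y * kernel j x \<omega> y) \<in> borel_measurable lborel" by measurable
      show "(\<lambda>y. t n j y * kernel j x \<omega> y) \<in> borel_measurable lborel" for n by measurable
      show "integrable lborel (\<lambda>y. cmod (h j y * kernel j x \<omega> y))"
        by (intro integrable_norm int kernel_schwartz)
      show "AE y in lborel. (\<lambda>n. t n j y * kernel j x \<omega> y) \<longlonglongrightarrow> h j y * kernel j x \<omega> y"
        by (intro AE_I2 tendsto_intros t_lim)
      show "AE y in lborel. norm (t n j y * kernel j x \<omega> y) \<le> cmod (h j y * kernel j x \<omega> y)" for n
        unfolding norm_mult by (intro AE_I2 mult_right_mono t_le) auto
    qed
    show ?thesis
    proof (rule nn_integral_le_limit)
      show "(\<lambda>z. ennreal (cmod (local_stft_sum J (t n) z) powr P)) \<in> borel_measurable lborel2" for n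
        by measurable
      have "(\<lambda>n. cmod (local_stft_sum J (t n) z) powr P)
          \<longlonglongrightarrow> cmod (local_stft_sum J h z) powr P" for z
        by (rule tendsto_powr') (use P in \<open>auto intro!: tendsto_intros lim\<close>)
      then show "(\<lambda>n. ennreal (cmod (local_stft_sum J (t n) z) powr P))
          \<longlonglongrightarrow> ennreal (cmod (local_stft_sum J h z) powr P)" for z
        by (intro tendsto_ennrealI)
      show "(\<integral>\<^sup>+z. ennreal (cmod (local_stft_sum J (t n) z) powr P) \<partial>lborel2)
        \<le> ennreal C * weighted_norms P J h" for n
        using P by (intro order_trans[OF C[OF t_int]] mult_left_mono sum_mono nn_integral_mono ennreal_leI powr_mono2 t_le) auto
    qed
  qed
  with conjunct1[OF C'] show ?thesis by blast
qed

end

section \<open>Lebesgue and sequence norms\<close>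

lemma ennreal_powr_ennreal: "0 \<le> r \<Longrightarrow> ennreal_powr (ennreal r) a = ennreal (r powr a)"
  by (simp add: ennreal_powr_def)

lemma ennreal_powr_mono: "0 \<le> a \<Longrightarrow> x \<le> y \<Longrightarrow> ennreal_powr x a \<le> ennreal_powr y a"
  by (cases x; cases y) (auto simp: ennreal_powr_def top_unique intro!: ennreal_leI powr_mono2)

lemma ennreal_powr_powr: "ennreal_powr (ennreal_powr x a) b = ennreal_powr x (a * b)"
  by (cases x) (auto simp: ennreal_powr_def powr_powr)

lemma ennreal_powr_one [simp]: "ennreal_powr x 1 = x"
  by (cases x) (auto simp: ennreal_powr_def)

lemma Lp_enorm_ennreal:
  "0 \<le> P \<Longrightarrow> Lp_enorm M (ennreal P) f = ennreal_powr (\<integral>\<^sup>+x. ennreal_powr (f x) P \<partial>M) (1 / P)"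
  by (simp add: Lp_enorm_def)

lemma Lp_enorm_ennreal_powr:
  "0 < P \<Longrightarrow> ennreal_powr (Lp_enorm M (ennreal P) f) P = (\<integral>\<^sup>+x. ennreal_powr (f x) P \<partial>M)"
  by (simp add: Lp_enorm_ennreal ennreal_powr_powr)

text \<open>For infinite q, a counting measure has only the empty null set, so the essential bound
  holds at every index. For finite q, one term is at most the whole sum.\<close>

lemma le_Lp_enorm_count_space:
  assumes q: "1 \<le> q"
  shows "f j \<le> Lp_enorm (count_space (UNIV :: nat set)) q f"
proof (cases q)
  case top
  have "AE i in count_space UNIV. f i \<le> esssup (count_space UNIV) f"
    by (rule esssup_AE)
  then show ?thesis by (simp add: top Lp_enorm_def AE_count_space)
next
  case (real Q)
  then have Q: "1 \<le> Q" using q by (simp add: ennreal_1[symmetric] del: ennreal_1)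
  have "f j = ennreal_powr (ennreal_powr (f j) Q) (1 / Q)"
    using Q by (simp add: ennreal_powr_powr)
  also have "\<dots> \<le> ennreal_powr (\<integral>\<^sup>+i. ennreal_powr (f i) Q \<partial>count_space UNIV) (1 / Q)"
    using Q by (intro ennreal_powr_mono nn_integral_ge_point) auto
  also have "\<dots> = Lp_enorm (count_space UNIV) q f"
    using Q by (simp add: real Lp_enorm_ennreal)
  finally show ?thesis .
qed

text \<open>The inclusion of l^q in l^P with constant 1: every x_j is at most b, so x_j^P <= x_j^Q
  b^(P-Q), and summing the Q-th powers supplies the remaining b^Q.\<close>

lemma sum_powr_le_Lp_enorm_count_space:
  assumes x: "\<And>j. 0 \<le> x j" and b: "Lp_enorm (count_space (UNIV :: nat set)) q (\<lambda>j. ennreal (x j)) = ennreal b" "0 \<le> b"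
    and q: "1 \<le> q" "q \<le> ennreal P"
  shows "(\<Sum>j<J. x j powr P) \<le> b powr P"
proof -
  obtain Q where Q: "q = ennreal Q" "0 \<le> Q"
    using q(2) by (cases q) (auto simp: top_unique)
  with q have "1 \<le> Q" "Q \<le> P"
    by (auto simp: ennreal_1[symmetric] ennreal_le_iff2 simp del: ennreal_1)
  have xb: "x j \<le> b" for j
    using le_Lp_enorm_count_space[OF q(1), of "\<lambda>j. ennreal (x j)" j] b x by simp
  have "ennreal (\<Sum>j<J. x j powr Q) = (\<Sum>j<J. ennreal_powr (ennreal (x j)) Q)"
    using x by (simp add: ennreal_powr_ennreal sum_ennreal)
  also have "\<dots> \<le> (\<Sum>j. ennreal_powr (ennreal (x j)) Q)"
    by (rule sum_le_suminf) auto
  also have "\<dots> = (\<integral>\<^sup>+j. ennreal_powr (ennreal (x j)) Q \<partial>count_space UNIV)"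
    by (rule nn_integral_count_space_nat[symmetric])
  also have "\<dots> = ennreal (b powr Q)"
    using b \<open>1 \<le> Q\<close> Lp_enorm_ennreal_powr[of Q "count_space UNIV" "\<lambda>j. ennreal (x j)"] Q
    by (simp add: ennreal_powr_ennreal)
  finally have sum: "(\<Sum>j<J. x j powr Q) \<le> b powr Q" by simp
  have "(\<Sum>j<J. x j powr P) \<le> (\<Sum>j<J. x j powr Q * b powr (P - Q))"
  proof (intro sum_mono)
    fix j
    have "x j powr P = x j powr Q * x j powr (P - Q)" by (simp flip: powr_add)
    also have "\<dots> \<le> x j powr Q * b powr (P - Q)"
      using \<open>Q \<le> P\<close> x xb by (intro mult_left_mono powr_mono2) auto
    finally show "x j powr P \<le> x j powr Q * b powr (P - Q)" .
  qed
  also have "\<dots> \<le> b powr Q * b powr (P - Q)"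
    unfolding sum_distrib_right[symmetric] by (intro mult_right_mono sum) auto
  also have "\<dots> = b powr P" by (simp flip: powr_add)
  finally show ?thesis .
qed

abbreviation weighted_sum :: "nat \<Rightarrow> real \<Rightarrow> nat \<Rightarrow> (nat \<Rightarrow> real) \<Rightarrow> real" where
  "weighted_sum d P J n \<equiv> \<Sum>j<J. ((2 ^ j) ^ d) powr (2 - P) * n j powr P"

text \<open>The origin of the critical smoothness: (2^(jd))^(2-P) is the P-th power of 2^(j
  \<theta>) with \<theta> = d (2/P - 1).\<close>

lemma dyadic_weight:
  fixes P :: real
  assumes "0 < P" and "0 \<le> n"
  shows "((2 ^ j) ^ d) powr (2 - P) * n powr P = (2 powr (real j * (real d * (2 / P - 1))) * n) powr P"
proof -
  have "((2::real) ^ j) ^ d = 2 powr (real j * real d)"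
    by (simp add: powr_realpow[symmetric] powr_powr)
  then have "((2 ^ j) ^ d) powr (2 - P) = 2 powr (real j * real d * (2 - P))"
    by (simp add: powr_powr)
  also have "real j * real d * (2 - P) = real j * (real d * (2 / P - 1)) * P"
    using assms by (simp add: field_simps)
  finally show ?thesis
    using assms by (simp add: powr_mult powr_powr)
qed

section \<open>From block norms to the modulation norm\<close>

context dyadic_window
begin

abbreviation block_norm :: "real \<Rightarrow> 'a functional \<Rightarrow> nat \<Rightarrow> ennreal" where
  "block_norm P u j \<equiv> Lp_enorm_dist (ennreal P) (LP_block \<phi> j u)"

abbreviation block_norms :: "real \<Rightarrow> 'a functional \<Rightarrow> (nat \<Rightarrow> real) \<Rightarrow> bool" where
  "block_norms P u n \<equiv> \<forall>j. 0 \<le> n j \<and> block_norm P u j = ennreal (n j)"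

abbreviation full_stft_power :: "real \<Rightarrow> 'a functional \<Rightarrow> ennreal" where
  "full_stft_power P u \<equiv> \<integral>\<^sup>+\<omega>. (\<integral>\<^sup>+x. ennreal (cmod (stft g u x \<omega>) powr P) \<partial>lborel) \<partial>lborel"

lemma stft_eq: "stft g u x \<omega> = u (window_at x \<omega>)"
  by (simp add: stft_def window_at_def)

text \<open>A block norm is an infimum over representing functions. Working with representatives
  whose norm exceeds it by at most \<epsilon>, and letting \<epsilon> tend to 0 for fixed J, avoids
  any appeal to their uniqueness. Fatou's lemma then takes the estimate to infinitely many
  blocks.\<close>

lemma nn_integral_stft_le:
  assumes P: "1 \<le> P" "P \<le> 2"
  shows "\<exists>C\<ge>0. \<forall>u n S. u \<in> tempered \<longrightarrow>
    block_norms P u n \<longrightarrow>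
    (\<forall>J. weighted_sum DIM('a) P J n \<le> S) \<longrightarrow>
    (full_stft_power P u) \<le> ennreal (C * S)"
proof -
  obtain C where C': "0 \<le> C \<and> (\<forall>J h. (\<forall>j. h j \<in> borel_measurable borel \<and> (\<forall>f\<in>schwartz. integrable lborel (\<lambda>x. h j x * f x))) \<longrightarrow>
    stft_power P J h
      \<le> ennreal C * weighted_norms P J h)"
    using nn_integral_powr_local_stft[OF P] by (rule exE)
  then have "0 \<le> C" ..
  note C = conjunct2[OF C', rule_format]
  have "(full_stft_power P u) \<le> ennreal (C * S)"
    if u: "u \<in> tempered"
      and n: "\<And>j. 0 \<le> n j" "\<And>j. block_norm P u j = ennreal (n j)"
      and S: "\<And>J. weighted_sum DIM('a) P J n \<le> S" for u S and n :: "nat \<Rightarrow> real"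
  proof -
    let ?a = "\<lambda>j. ((2 ^ j) ^ DIM('a)) powr (2 - P) :: real"
    let ?F = "\<lambda>J z. \<Sum>j<J. LP_block \<phi> j u (window_at (snd z) (fst z))"
    have near: "\<exists>h. \<forall>j. represents (h j) (LP_block \<phi> j u) \<and>
        (\<integral>\<^sup>+y. ennreal (cmod (h j y) powr P) \<partial>lborel) \<le> ennreal ((n j + \<epsilon>) powr P)" if \<epsilon>: "0 < \<epsilon>" for \<epsilon>
    proof (intro choice allI)
      fix j
      have "block_norm P u j < ennreal (n j + \<epsilon>)"
        using n[of j] \<epsilon> by (simp add: ennreal_less_iff)
      then obtain h where h: "represents h (LP_block \<phi> j u)"
        and less: "Lp_enorm lborel (ennreal P) (\<lambda>x. ennreal (cmod (h x))) < ennreal (n j + \<epsilon>)"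
        unfolding Lp_enorm_dist_def INF_less_iff by auto
      have "(\<integral>\<^sup>+y. ennreal (cmod (h y) powr P) \<partial>lborel) = ennreal_powr (Lp_enorm lborel (ennreal P) (\<lambda>x. ennreal (cmod (h x)))) P"
        using P by (subst Lp_enorm_ennreal_powr) (auto simp: ennreal_powr_ennreal)
      also have "\<dots> \<le> ennreal_powr (ennreal (n j + \<epsilon>)) P"
        using P less by (intro ennreal_powr_mono) auto
      also have "\<dots> = ennreal ((n j + \<epsilon>) powr P)"
        using n(1)[of j] \<epsilon> by (intro ennreal_powr_ennreal) simp
      finally show "\<exists>h. represents h (LP_block \<phi> j u) \<and>
        (\<integral>\<^sup>+y. ennreal (cmod (h y) powr P) \<partial>lborel) \<le> ennreal ((n j + \<epsilon>) powr P)"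
        using h by blast
    qed
    \<comment> \<open>The left-hand side does not involve h, so the representatives may change with
      \<epsilon> while the function being estimated stays the same.\<close>
    have F_local: "?F J z = (local_stft_sum J h z)"
      if "\<And>j. represents (h j) (LP_block \<phi> j u)" for h J z
      by (intro sum.cong refl local_stft_LP_block[symmetric] that)
    have F_eps: "(\<integral>\<^sup>+z. ennreal (cmod (?F J z) powr P) \<partial>lborel2)
        \<le> ennreal (C * (\<Sum>j<J. ?a j * (n j + \<epsilon>) powr P))" if \<epsilon>: "0 < \<epsilon>" for J \<epsilon>
    proof -
      obtain h where h: "\<And>j. represents (h j) (LP_block \<phi> j u)"
        and le: "\<And>j. (\<integral>\<^sup>+y. ennreal (cmod (h j y) powr P) \<partial>lborel) \<le> ennreal ((n j + \<epsilon>) powr P)"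
        using near[OF \<epsilon>] by blast
      have "(\<integral>\<^sup>+z. ennreal (cmod (?F J z) powr P) \<partial>lborel2)
        \<le> ennreal C * (\<Sum>j<J. ennreal (?a j) * (\<integral>\<^sup>+y. ennreal (cmod (h j y) powr P) \<partial>lborel))"
        unfolding F_local[OF h] by (rule C) (use h in \<open>simp add: represents_def\<close>)
      also have "\<dots> \<le> ennreal C * (\<Sum>j<J. ennreal (?a j) * ennreal ((n j + \<epsilon>) powr P))"
        by (intro mult_left_mono sum_mono le) auto
      also have "\<dots> = ennreal (C * (\<Sum>j<J. ?a j * (n j + \<epsilon>) powr P))"
        using \<open>0 \<le> C\<close> by (simp add: ennreal_mult[symmetric] sum_ennreal sum_nonneg)
      finally show ?thesis .
    qed
    have F_le: "(\<integral>\<^sup>+z. ennreal (cmod (?F J z) powr P) \<partial>lborel2) \<le> ennreal (C * S)" for J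
    proof -
      have "(\<lambda>m. 1 / real (Suc m)) \<longlonglongrightarrow> 0"
        using LIMSEQ_inverse_real_of_nat by (simp add: inverse_eq_divide)
      then have lim: "(\<lambda>m. (n j + 1 / real (Suc m)) powr P) \<longlonglongrightarrow> (n j + 0) powr P" for j
        using n(1)[of j] P by (intro tendsto_powr' tendsto_intros) auto
      have "(\<lambda>m. C * (\<Sum>j<J. ?a j * (n j + 1 / real (Suc m)) powr P)) \<longlonglongrightarrow> C * (\<Sum>j<J. ?a j * (n j + 0) powr P)"
        by (intro tendsto_mult tendsto_sum tendsto_const lim)
      then have "(\<lambda>m. ennreal (C * (\<Sum>j<J. ?a j * (n j + 1 / real (Suc m)) powr P))) \<longlonglongrightarrow> ennreal (C * (\<Sum>j<J. ?a j * n j powr P))"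
        by (intro tendsto_ennrealI) simp
      then have "(\<integral>\<^sup>+z. ennreal (cmod (?F J z) powr P) \<partial>lborel2) \<le> ennreal (C * (\<Sum>j<J. ?a j * n j powr P))"
        by (rule LIMSEQ_le_const) (auto intro!: exI[of _ 0] F_eps)
      also have "\<dots> \<le> ennreal (C * S)"
        using \<open>0 \<le> C\<close> by (intro ennreal_leI mult_left_mono S)
      finally show ?thesis .
    qed
    \<comment> \<open>Any representatives will do: they only serve to make the partial sums
      measurable in z.\<close>
    obtain h where h: "\<And>j. represents (h j) (LP_block \<phi> j u)"
      using near[of 1] by auto
    have [measurable]: "?F J \<in> borel_measurable lborel2" for J
      unfolding F_local[OF h] by (rule local_stft_sum_measurable) (use h in \<open>simp add: represents_def\<close>)
    have lim: "(\<lambda>J. ?F J z) \<longlonglongrightarrow> stft g u (snd z) (fst z)" for z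
      unfolding stft_eq by (rule LP_block_sums[OF u window_at_schwartz])
    have V: "(\<lambda>z. stft g u (snd z) (fst z)) \<in> borel_measurable lborel2"
      by (rule borel_measurable_LIMSEQ_metric[OF _ lim]) measurable
    have "(full_stft_power P u)
      = (\<integral>\<^sup>+z. ennreal (cmod (stft g u (snd z) (fst z)) powr P) \<partial>lborel2)"
      using lborel.nn_integral_fst[OF measurable_compose[OF V, of "\<lambda>v. ennreal (cmod v powr P)"]] by simp
    also have "\<dots> \<le> ennreal (C * S)"
    proof (rule nn_integral_le_limit[OF _ _ F_le])
      show "(\<lambda>z. ennreal (cmod (?F J z) powr P)) \<in> borel_measurable lborel2" for J
        by measurable
      show "(\<lambda>J. ennreal (cmod (?F J z) powr P)) \<longlonglongrightarrow> ennreal (cmod (stft g u (snd z) (fst z)) powr P)" for z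
        by (intro tendsto_ennrealI tendsto_powr' tendsto_norm lim tendsto_const) (use P in auto)
    qed
    finally show ?thesis .
  qed
  with \<open>0 \<le> C\<close> show ?thesis by blast
qed

text \<open>Passing from weight 2^(js) to the critical weight 2^(j \<theta>) multiplies the j-th
  term by 2^(-j(s-\<theta>)). If s >= \<theta> this is at most 1, and q <= P lets l^q pass to l^P.
  If s > \<theta>, a supremum bound on the terms is enough, because the factors form a geometric
  series.\<close>

lemma besov_sum_bound:
  assumes P: "1 \<le> P" "P \<le> 2" and q: "1 \<le> q"
    and s: "q \<le> ennreal P \<and> real DIM('a) * (2 / P - 1) \<le> s \<or> real DIM('a) * (2 / P - 1) < s"
  shows "\<exists>K\<ge>0. \<forall>u\<in>besov_space \<phi> (ennreal P) q s. \<exists>n b. 0 \<le> b \<and> besov_enorm \<phi> (ennreal P) q s u = ennreal b \<and>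
    block_norms P u n \<and>
    (\<forall>J. weighted_sum DIM('a) P J n \<le> K * b powr P)"
proof -
  let ?\<theta> = "real DIM('a) * (2 / P - 1)"
  let ?r = "\<lambda>j. 2 powr (- (real j * (s - ?\<theta>)))" and ?x = "\<lambda>n j. 2 powr (real j * s) * n j"
  let ?Q = "\<lambda>n b. Lp_enorm (count_space UNIV) q (\<lambda>j. ennreal (?x n j)) = ennreal b"
  \<comment> \<open>Finiteness of the Besov norm bounds every weighted block norm, and the weights
    are positive. The block norms are therefore finite and may be treated as real numbers.\<close>
  have components: "\<exists>n b. 0 \<le> b \<and> besov_enorm \<phi> (ennreal P) q s u = ennreal b \<and>
    block_norms P u n \<and>
    ?Q n b"
    if u: "u \<in> besov_space \<phi> (ennreal P) q s" for u
  proof -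
    obtain b where b: "besov_enorm \<phi> (ennreal P) q s u = ennreal b" "0 \<le> b"
      using u by (cases "besov_enorm \<phi> (ennreal P) q s u") (auto simp: besov_space_def)
    let ?N = "\<lambda>j. block_norm P u j"
    have "ennreal (2 powr (real j * s)) * ?N j \<le> ennreal b" for j
      using le_Lp_enorm_count_space[OF q, of "\<lambda>j. ennreal (2 powr (real j * s)) * ?N j" j] b
      by (simp add: besov_enorm_def)
    then have "ennreal (2 powr (real j * s)) * ?N j < top" for j
      using le_less_trans[OF _ ennreal_less_top] by blast
    from this[unfolded ennreal_mult_less_top] have "?N j < top" for j
      by (auto dest: meta_spec[of _ j])
    then have N: "?N j = ennreal (enn2real (?N j))" for j
      by simp
    have eq: "(\<lambda>j. ennreal (2 powr (real j * s)) * ?N j) = (\<lambda>j. ennreal (2 powr (real j * s) * enn2real (?N j)))"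
      by (subst N) (simp add: ennreal_mult)
    show ?thesis
      using b N eq by (intro exI[of _ "\<lambda>j. enn2real (?N j)"] exI[of _ b]) (simp add: besov_enorm_def)
  qed
  have conv: "((2 ^ j) ^ DIM('a)) powr (2 - P) * n powr P
      = (?r j * (2 powr (real j * s) * n)) powr P" if "0 \<le> n" for j and n :: real
  proof -
    have E: "?r j * (2 powr (real j * s) * n) = 2 powr (real j * ?\<theta>) * n"
      by (simp add: mult.assoc[symmetric] right_diff_distrib flip: powr_add)
    show ?thesis unfolding E by (rule dyadic_weight) (use P that in auto)
  qed
  have suffices: ?thesis if K: "0 \<le> K" and le: "\<And>n b J. (\<And>j. 0 \<le> n j) \<Longrightarrow> 0 \<le> b \<Longrightarrow>
      ?Q n b \<Longrightarrow>
      weighted_sum DIM('a) P J n \<le> K * b powr P" for K :: real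
  proof (intro exI[of _ K] conjI ballI K)
    fix u assume "u \<in> besov_space \<phi> (ennreal P) q s"
    from components[OF this] obtain n b where "0 \<le> b"
      and "besov_enorm \<phi> (ennreal P) q s u = ennreal b"
      and n: "block_norms P u n"
      and x: "?Q n b"
      by (elim exE conjE)
    moreover have "\<forall>J. weighted_sum DIM('a) P J n \<le> K * b powr P"
      using n by (intro allI le[OF _ \<open>0 \<le> b\<close> x]) simp
    ultimately show "\<exists>n b. 0 \<le> b \<and> besov_enorm \<phi> (ennreal P) q s u = ennreal b \<and>
      block_norms P u n \<and>
      (\<forall>J. weighted_sum DIM('a) P J n \<le> K * b powr P)"
      by (intro exI[of _ n] exI[of _ b] conjI)
  qed
  from s show ?thesis
  proof
    assume s: "q \<le> ennreal P \<and> ?\<theta> \<le> s"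
    have "weighted_sum DIM('a) P J n \<le> 1 * b powr P"
      if n: "\<And>j. 0 \<le> n j" and b: "0 \<le> b"
        and x: "?Q n b" for n b J
    proof -
      have "weighted_sum DIM('a) P J n \<le> (\<Sum>j<J. (?x n j) powr P)"
      proof (intro sum_mono)
        fix j
        have "?r j \<le> 2 powr (0::real)"
          using s by (intro powr_mono) auto
        then have "?r j * ?x n j \<le> 1 * ?x n j"
          using n by (intro mult_right_mono) auto
        then show "((2 ^ j) ^ DIM('a)) powr (2 - P) * n j powr P \<le> (?x n j) powr P"
          unfolding conv[OF n] using P n by (intro powr_mono2) auto
      qed
      also have "\<dots> \<le> b powr P"
        using n s by (intro sum_powr_le_Lp_enorm_count_space[OF _ x b q]) auto
      finally show ?thesis by simp
    qed
    then show ?thesis by (rule suffices[of 1, OF zero_le_one])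
  next
    assume s: "?\<theta> < s"
    \<comment> \<open>The ratio of the geometric series: r^j is the P-th power of
      2^(-j(s-\<theta>)), and r < 1 because s > \<theta>.\<close>
    define r where "r = 2 powr (- (s - ?\<theta>) * P)"
    have "- (s - ?\<theta>) * P < 0"
      using s P by (intro mult_neg_pos) auto
    then have r: "0 \<le> r" "r < 1"
      unfolding r_def using powr_less_mono[of _ 0 2] by auto
    have "weighted_sum DIM('a) P J n \<le> 1 / (1 - r) * b powr P"
      if n: "\<And>j. 0 \<le> n j" and b: "0 \<le> b"
        and x: "?Q n b" for n b J
    proof -
      have "weighted_sum DIM('a) P J n \<le> (\<Sum>j<J. r ^ j * b powr P)"
      proof (intro sum_mono)
        fix j
        have xb: "2 powr (real j * s) * n j \<le> b"
          using le_Lp_enorm_count_space[OF q, of "\<lambda>j. ennreal (?x n j)" j] x b n by simp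
        have "r ^ j = r powr real j"
          by (simp add: r_def powr_realpow)
        also have "\<dots> = ?r j powr P"
          unfolding r_def powr_powr by (rule arg_cong[of _ _ "\<lambda>x. 2 powr x"]) algebra
        finally have "r ^ j = ?r j powr P" .
        then have "((2 ^ j) ^ DIM('a)) powr (2 - P) * n j powr P = r ^ j * (?x n j) powr P"
          unfolding conv[OF n] using n by (simp add: powr_mult)
        also have "\<dots> \<le> r ^ j * b powr P"
          using P n r xb by (intro mult_left_mono powr_mono2) auto
        finally show "((2 ^ j) ^ DIM('a)) powr (2 - P) * n j powr P \<le> r ^ j * b powr P" .
      qed
      also have "\<dots> = (\<Sum>j<J. r ^ j) * b powr P" by (simp add: sum_distrib_right)
      also have "\<dots> \<le> (\<Sum>j. r ^ j) * b powr P"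
        using r by (intro mult_right_mono sum_le_suminf summable_geometric) auto
      also have "(\<Sum>j. r ^ j) = 1 / (1 - r)"
        using r by (intro suminf_geometric) auto
      finally show ?thesis .
    qed
    then show ?thesis by (rule suffices[of "1 / (1 - r)", rotated]) (use r in auto)
  qed
qed

lemma besov_embedding:
  assumes P: "1 \<le> P" "P \<le> 2" and q: "1 \<le> q"
    and s: "q \<le> ennreal P \<and> real DIM('a) * (2 / P - 1) \<le> s \<or> real DIM('a) * (2 / P - 1) < s"
  shows "continuously_embedded (besov_space \<phi> (ennreal P) q s) (besov_enorm \<phi> (ennreal P) q s)
    (modulation_space g (ennreal P) (ennreal P)) (modulation_enorm g (ennreal P) (ennreal P))"
proof -
  obtain C where C': "0 \<le> C \<and> (\<forall>u n S. u \<in> tempered \<longrightarrow>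
    block_norms P u n \<longrightarrow>
    (\<forall>J. weighted_sum DIM('a) P J n \<le> S) \<longrightarrow>
    (full_stft_power P u) \<le> ennreal (C * S))"
    using nn_integral_stft_le[OF P] by (rule exE)
  then have "0 \<le> C" ..
  obtain K where "0 \<le> K" and K: "\<And>u. u \<in> besov_space \<phi> (ennreal P) q s \<Longrightarrow>
    \<exists>n b. 0 \<le> b \<and> besov_enorm \<phi> (ennreal P) q s u = ennreal b \<and>
    block_norms P u n \<and>
    (\<forall>J. weighted_sum DIM('a) P J n \<le> K * b powr P)"
    using besov_sum_bound[OF assms] by blast
  \<comment> \<open>The estimate of P-th powers has the constant C K, so the root 1 / P yields the
    constant (C K)^(1/P) and turns b^P into b.\<close>
  have bound: "modulation_enorm g (ennreal P) (ennreal P) u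
      \<le> ennreal ((C * K) powr (1 / P)) * besov_enorm \<phi> (ennreal P) q s u" if u: "u \<in> besov_space \<phi> (ennreal P) q s" for u
  proof -
    obtain n b where b: "0 \<le> b" "besov_enorm \<phi> (ennreal P) q s u = ennreal b"
      and n: "block_norms P u n"
      and S: "\<forall>J. weighted_sum DIM('a) P J n \<le> K * b powr P"
      using K[OF u] by blast
    have "u \<in> tempered" using u by (simp add: besov_space_def)
    with C' n S have le: "(full_stft_power P u) \<le> ennreal (C * (K * b powr P))"
      by blast
    have "modulation_enorm g (ennreal P) (ennreal P) u
      = ennreal_powr (full_stft_power P u) (1 / P)"
      using P by (simp add: modulation_enorm_def Lp_enorm_ennreal ennreal_powr_powr ennreal_powr_ennreal)
    also have "\<dots> \<le> ennreal_powr (ennreal (C * (K * b powr P))) (1 / P)"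
      using P by (intro ennreal_powr_mono le) auto
    also have "\<dots> = ennreal ((C * K) powr (1 / P) * b)"
      using P \<open>0 \<le> C\<close> \<open>0 \<le> K\<close> b(1) by (subst ennreal_powr_ennreal) (auto simp: powr_mult powr_powr mult.assoc)
    also have "\<dots> = ennreal ((C * K) powr (1 / P)) * besov_enorm \<phi> (ennreal P) q s u"
      unfolding b(2) by (rule ennreal_mult) (use b in auto)
    finally show ?thesis .
  qed
  show ?thesis
    unfolding continuously_embedded_def
  proof (intro conjI subsetI exI ballI)
    fix u assume u: "u \<in> besov_space \<phi> (ennreal P) q s"
    then have "ennreal ((C * K) powr (1 / P)) * besov_enorm \<phi> (ennreal P) q s u < \<infinity>"
      by (simp add: besov_space_def ennreal_mult_less_top)
    with bound[OF u] u show "u \<in> modulation_space g (ennreal P) (ennreal P)"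
      by (auto simp: besov_space_def modulation_space_def intro: le_less_trans)
  qed (rule bound)
qed

end

theorem theorem5p4:
  fixes p p' :: ennreal
    and \<phi> g :: "'a::euclidean_space \<Rightarrow> complex"
  assumes "1 \<le> p" and "p \<le> 2" and "1 / p + 1 / p' = 1"
    and "dyadic_generator \<phi>"
    and "g \<in> schwartz" and "g \<noteq> (\<lambda>_. 0)"
  shows "(\<forall>(s::real) (q::ennreal).
            s \<ge> real DIM('a) * (enn2real (1 / p) - enn2real (1 / p')) \<and> 1 \<le> q \<and> q \<le> p \<longrightarrow>
            continuously_embedded (besov_space \<phi> p q s) (besov_enorm \<phi> p q s)
              (modulation_space g p p) (modulation_enorm g p p))
       \<and> (\<forall>(s::real) (q::ennreal).
            s > real DIM('a) * (enn2real (1 / p) - enn2real (1 / p')) \<and> 1 \<le> q \<and> q \<le> \<infinity> \<longrightarrow>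
            continuously_embedded (besov_space \<phi> p q s) (besov_enorm \<phi> p q s)
              (modulation_space g p p) (modulation_enorm g p p))"
proof -
  interpret dyadic_window \<phi> g by standard (rule assms)+
  obtain P where p: "p = ennreal P" and P0: "0 \<le> P"
    using assms(2) by (cases p) (auto simp: top_unique)
  have P: "1 \<le> P" "P \<le> 2"
    using assms(1,2) P0 unfolding p by (auto simp: ennreal_le_iff2 simp flip: ennreal_1 ennreal_numeral)
  have inv_p: "1 / p = ennreal (1 / P)"
    using P unfolding p by (subst ennreal_1[symmetric], subst divide_ennreal) auto
  \<comment> \<open>For p = 1 the conjugate exponent is infinite, so it is 1 / p' and not p' that is
    turned into a real number.\<close>
  have "1 / p' \<noteq> top"
    using assms(3) by auto
  then obtain r where r: "1 / p' = ennreal r" "0 \<le> r"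
    by (cases "1 / p'") auto
  have "ennreal (1 / P + r) = ennreal 1"
    using assms(3) P r unfolding inv_p by (simp flip: ennreal_plus)
  then have "r = 1 - 1 / P"
    using P r by (subst (asm) ennreal_inj) auto
  \<comment> \<open>Since 1/p' = 1 - 1/P, the difference of the reciprocals is 2/P - 1, the form in
    which \<open>besov_embedding\<close> states the threshold.\<close>
  then have "enn2real (1 / p) - enn2real (1 / p') = 2 / P - 1"
    unfolding inv_p r(1) using P r(2) by simp
  then show ?thesis
    using besov_embedding[OF P] unfolding p by auto
qed

end
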